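(* There exists an absolute constant $c>0$ such that the following holds. Let $h\in\mathbb{Z}[x]$ be an intersective polynomial of degree $k$. Then there exists a constant $C_h>0$, depending only on $h$, such that for every $d\in\mathbb{N}$, all $\alpha_1,\dots,\alpha_d\in\mathbb{R}$ and every $N\in\mathbb{N}$, there exists an integer $n$ with $1\le n\le N$, $h(n)\neq 0$, and $$\|h(n)\alpha_j\|\le C_h\, d\, N^{-c^k/d^2}\quad\text{for all } 1\le j\le d.$$
   Context: For $\alpha\in\mathbb{R}$, $\|\alpha\|$ denotes the distance from $\alpha$ to the nearest integer. $\mathbb{N}$ denotes the positive integers. A polynomial $h\in\mathbb{Z}[x]$ is called intersective if for every $q\in\mathbb{N}$ there exists $r\in\mathbb{Z}$ with $q\mid h(r)$ (equivalently, $h$ has a root in the $p$-adic integers for every prime $p$). An absolute constant is one that does not depend on any of the other parameters ($h$, $k$, $d$, $N$, $\alpha_1,\dots,\alpha_d$).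
   Formalization: It is additionally assumed that some integer m with 1 ≤ m ≤ N has h(m) ≠ 0; without this the claim fails, e.g. for h(x) = x − 1 and N = 1, where the only candidate n = 1 has h(n) = 0. *)

theory Defs
  imports "HOL-Computational_Algebra.Polynomial" "HOL-Analysis.Analysis"
begin

definition intersective :: "int poly \<Rightarrow> bool" where
  "intersective h \<longleftrightarrow> (\<forall>q::nat. q \<ge> 1 \<longrightarrow> (\<exists>r::int. int q dvd poly h r))"

definition dist_nearest_int :: "real \<Rightarrow> real" where
  "dist_nearest_int x = infdist x \<int>"

lemma dist_nearest_int_eq_round: "dist_nearest_int x = \<bar>x - of_int (round x)\<bar>"
proof (rule antisym)
  show "dist_nearest_int x \<le> \<bar>x - of_int (round x)\<bar>"
    unfolding dist_nearest_int_def
    using infdist_le[of "of_int (round x)" "\<int>" x] by (simp add: dist_real_def)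
next
  have "\<bar>x - of_int (round x)\<bar> \<le> (INF a\<in>\<int>. dist x a)"
  proof (rule cINF_greatest)
    fix a :: real
    assume "a \<in> \<int>"
    then obtain m :: int where "a = of_int m"
      by (auto elim: Ints_cases)
    then show "\<bar>x - of_int (round x)\<bar> \<le> dist x a"
      using round_diff_minimal[of x m] by (simp add: dist_real_def)
  qed (use Ints_0 in blast)
  moreover have "(\<int> :: real set) \<noteq> {}"
    using Ints_0 by blast
  ultimately show "\<bar>x - of_int (round x)\<bar> \<le> dist_nearest_int x"
    by (simp add: dist_nearest_int_def infdist_def)
qed

end

theory Submission
  imports Defs "Jordan_Normal_Form.Determinant"
begin

text \<open>
Let \<open>e(x) = exp(2 \<pi> i x)\<close>, let \<open>\<xi> \<cdot> \<alpha> = \<Sum>\<^sub>j \<xi>\<^sub>j \<alpha>\<^sub>j\<close>, and fix a natural number \<open>y\<close>; an integer \<open>n \<le> N\<close> with every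
\<open>h(n) \<alpha>\<^sub>j\<close> within \<open>1/y\<close> of an integer is wanted as soon as \<open>N\<close> is at least \<open>y\<close> to the power \<open>d\<^sup>2\<close> times a
constant to the power \<open>k\<close>. Taking \<open>y\<close> slightly larger than \<open>N\<close> to the power \<open>c\<^sup>k / d\<^sup>2\<close> then gives the
theorem; when \<open>y\<close> would be smaller than \<open>C d\<close>, the bound to be proved is at least \<open>1/2\<close> and holds
trivially.

The detector is \<open>F(x) = \<Prod>\<^sub>j cos(\<pi> x\<^sub>j)^(2 s)\<close> with \<open>s = y\<^sup>5\<close>. It is tiny when some \<open>x\<^sub>j\<close> is further than
\<open>1/y\<close> from the integers, and it is a trigonometric polynomial with nonnegative coefficients of sum
\<open>1\<close>, with frequencies \<open>\<xi>\<close> in the box \<open>[-s, s]\<^sup>d\<close> and with constant coefficient at least \<open>2/T\<close>, where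
\<open>T = s^(2 d)\<close>. Average \<open>F(h(n) \<alpha>)\<close> over a progression of integers \<open>n\<close>. Because the coefficients are
nonnegative, a frequency whose phases \<open>h(n) \<xi> \<cdot> \<alpha>\<close> are all near integers can only increase the
average, and frequencies whose exponential sum saves a factor \<open>T\<close> cannot spoil the constant term.
So either the average is large and a good \<open>n\<close> exists, or some frequency has a large
exponential sum although its phases are not near integers.

In the second case Weyl's inequality (\<open>major_arc\<close>) says that \<open>\<xi> \<cdot> \<alpha>\<close> is extremely close to a rational
number with a controlled denominator. Passing to a subprogression along which \<open>h\<close> is divisible by
that denominator, and shortening the range a little, turns \<open>\<xi>\<close> into a frequency of the harmless
kind. Moreover every frequency that depends linearly on the harmless ones becomes harmless after
multiplying the modulus by one determinant (\<open>near_int_dependent\<close>, resting on Cramer's rule in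
\<open>minor_extends_or_dependent\<close>). Hence the new frequency can be taken linearly independent of the old
ones, and the process stops after at most \<open>d\<close> steps (\<open>state_Suc\<close>, \<open>state_rank_le\<close>). Each step costs a
power of \<open>T = y^(10 d)\<close>, which accounts for the exponent \<open>d\<^sup>2\<close>.

Intersectivity is what makes the subprogressions available. A class \<open>r\<close> modulo \<open>Q\<close> that contains
roots of \<open>h\<close> to every modulus has a subclass modulo \<open>Q t\<close> with the same property. Choosing in it a
representative at which \<open>h\<close> vanishes to a large modulus, one can write \<open>h(r + Q x) = \<lambda> g(x)\<close> where the
nonconstant coefficients of \<open>g\<close> have no common factor and \<open>\<lambda>\<close> gains at least a factor \<open>t\<close> at each
refinement (\<open>primitive_refinement\<close>). The common factor has to be removed because the rational
approximation must be to \<open>\<lambda> \<xi> \<cdot> \<alpha>\<close> itself: losing a power \<open>Q\<^sup>k\<close> at every step would be fatal.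

The exponent \<open>c\<^sup>k\<close> requires care in Weyl's inequality, since all coefficients of \<open>g\<close> must be handled with
denominators at most \<open>T\<close> to the power of a constant to the \<open>k\<close>. Treating the coefficients one after
the other by passing to progressions would raise the denominator to the power of the degree at each
step and lead to \<open>k!\<close>. Instead the already understood top coefficients are kept as a periodic
unimodular twist, which disappears after a single Weyl differencing with shifts that are multiples
of the period (\<open>weyl_twisted\<close>); this way the denominators only multiply.
\<close>

section \<open>Distance to the integers and additive characters\<close>

definition near_int :: "real \<Rightarrow> real \<Rightarrow> bool" where
  "near_int \<kappa> x \<longleftrightarrow> (\<exists>u::int. \<bar>x - of_int u\<bar> \<le> \<kappa>)"

lemma near_int_mono: "near_int \<kappa> x \<Longrightarrow> \<kappa> \<le> \<kappa>' \<Longrightarrow> near_int \<kappa>' x"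
  unfolding near_int_def by (meson order_trans)

lemma near_int_mult_of_int: "near_int \<kappa> x \<Longrightarrow> near_int (\<bar>of_int n\<bar> * \<kappa>) (of_int n * x)"
proof -
  assume "near_int \<kappa> x"
  then obtain u :: int where u: "\<bar>x - of_int u\<bar> \<le> \<kappa>" unfolding near_int_def by blast
  have "\<bar>of_int n * x - of_int (n * u)\<bar> = \<bar>of_int n\<bar> * \<bar>x - of_int u\<bar>"
    by (simp add: abs_mult [symmetric] algebra_simps)
  also have "\<dots> \<le> \<bar>of_int n\<bar> * \<kappa>" using u by (intro mult_left_mono) auto
  finally show ?thesis unfolding near_int_def by blast
qed

lemma near_int_add: "near_int \<kappa> x \<Longrightarrow> near_int \<kappa>' y \<Longrightarrow> near_int (\<kappa> + \<kappa>') (x + y)"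
proof -
  assume "near_int \<kappa> x" "near_int \<kappa>' y"
  then obtain u v :: int where "\<bar>x - of_int u\<bar> \<le> \<kappa>" "\<bar>y - of_int v\<bar> \<le> \<kappa>'" 
    unfolding near_int_def by blast
  then have "\<bar>(x + y) - of_int (u + v)\<bar> \<le> \<kappa> + \<kappa>'" by simp
  then show ?thesis unfolding near_int_def by blast
qed

lemma near_int_minus: "near_int \<kappa> x \<Longrightarrow> near_int \<kappa> (- x)"
  using near_int_mult_of_int [of \<kappa> x "-1"] by simp

lemma near_int_diff: "near_int \<kappa> x \<Longrightarrow> near_int \<kappa>' y \<Longrightarrow> near_int (\<kappa> + \<kappa>') (x - y)"
  using near_int_add [OF _ near_int_minus] by fastforce

lemma near_int_sum:
  assumes "finite A" "\<And>a. a \<in> A \<Longrightarrow> near_int (\<kappa> a) (x a)"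
  shows "near_int (sum \<kappa> A) (sum x A)"
  using assms
proof (induction A rule: finite_induct)
  case empty
  then show ?case by (simp add: near_int_def exI [of _ 0])
next
  case (insert a A)
  then show ?case by (simp add: near_int_add)
qed

definition e :: "real \<Rightarrow> complex" where
  "e x = cis (2 * pi * x)"

lemma e_add: "e (x + y) = e x * e y"
  by (simp add: e_def cis_mult algebra_simps)

lemma e_minus: "e (- x) = cnj (e x)"
  by (simp add: e_def cis_cnj)

lemma e_diff: "e (x - y) = e x * cnj (e y)"
  using e_add [of x "- y"] by (simp add: e_minus)

lemma norm_e [simp]: "norm (e x) = 1"
  by (simp add: e_def)

lemma e_0 [simp]: "e 0 = 1"
  by (simp add: e_def)

lemma e_of_int [simp]: "e (of_int n) = 1"
  using cis_multiple_2pi [of "of_int n"] by (simp add: e_def)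

lemma norm_e_minus_1: "norm (e x - 1) = 2 * \<bar>sin (pi * x)\<bar>"
proof -
  have "e x - 1 = cis (pi * x) * (cis (pi * x) - cis (- (pi * x)))"
    by (simp add: e_def right_diff_distrib cis_mult algebra_simps)
  also have "cis (pi * x) - cis (- (pi * x)) = 2 * \<i> * of_real (sin (pi * x))"
    by (simp add: complex_eq_iff)
  finally show ?thesis by (simp add: norm_mult)
qed

lemma norm_e_diff_le: "norm (e x - e y) \<le> 2 * pi * \<bar>x - y\<bar>"
proof -
  have "e x - e y = e y * (e (x - y) - 1)"
    using e_add [of y "x - y"] by (simp add: algebra_simps)
  then have "norm (e x - e y) = 2 * \<bar>sin (pi * (x - y))\<bar>"
    by (simp add: norm_mult norm_e_minus_1)
  also have "\<dots> \<le> 2 * \<bar>pi * (x - y)\<bar>" using abs_sin_x_le_abs_x by simp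
  finally show ?thesis by (simp add: abs_mult)
qed

text \<open>
A weak form of Jordan's inequality: the cubic Taylor bound serves up to \<open>1/4\<close>, monotonicity beyond.
\<close>

lemma abs_sin_pi_ge:
  assumes "\<bar>x\<bar> \<le> 1/2"
  shows "\<bar>x\<bar> \<le> \<bar>sin (pi * x)\<bar>"
proof -
  have *: "y \<le> sin (pi * y)" if y: "0 \<le> y" "y \<le> 1/2" for y :: real
  proof (cases "y \<le> 1/4")
    case True
    let ?z = "pi * y"
    have z: "0 \<le> ?z" "?z \<le> 1" using y True pi_less_4 
      by (auto intro: order_trans [OF mult_mono [of pi 4 y "1/4"]])
    have "z - z ^ 3 / 6 \<le> sin z" if "z \<ge> 0" for z :: real
    proof -
      have "\<bar>sin z - (\<Sum>m<3. sin_coeff m * z ^ m)\<bar> \<le> inverse (fact 3) * \<bar>z\<bar> ^ 3"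
        by (rule Maclaurin_sin_bound)
      moreover have "(\<Sum>m<3. sin_coeff m * z ^ m) = z"
        by (simp add: sin_coeff_def eval_nat_numeral lessThan_Suc)
      ultimately have "\<bar>sin z - z\<bar> \<le> z ^ 3 / 6" using that
        by (simp add: fact_numeral)
      then show ?thesis by linarith
    qed
    from this [OF z(1)] have "?z - ?z ^ 3 / 6 \<le> sin ?z" .
    moreover have "?z ^ 3 \<le> ?z" using z power_decreasing [of 1 3 ?z] by simp
    moreover have "?z \<ge> 3 * y" using y pi_gt3 by (intro mult_right_mono) auto
    ultimately show ?thesis using y by simp
  next
    case False
    have "sin (pi * (1/4)) \<le> sin (pi * y)"
      using False y pi_gt_zero by (intro sin_monotone_2pi_le) (auto simp: field_simps intro: order_trans)
    moreover have "sin (pi * (1/4)) = sqrt 2 / 2" by (simp add: sin_45)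
    moreover have "sqrt 2 \<ge> 1" by simp
    ultimately show ?thesis using y by linarith
  qed
  show ?thesis
    using * [of x] * [of "- x"] assms by (cases "x \<ge> 0") auto
qed

lemma near_int_norm_e: "near_int (norm (e x - 1)) x"
proof -
  let ?y = "x - of_int (round x)"
  have y: "\<bar>?y\<bar> \<le> 1/2" using of_int_round_abs_le [of x] by (simp add: abs_minus_commute)
  have "e x = e ?y" using e_add [of ?y "of_int (round x)"] by simp
  then have "norm (e x - 1) = 2 * \<bar>sin (pi * ?y)\<bar>" by (simp add: norm_e_minus_1)
  with abs_sin_pi_ge [OF y] have "\<bar>?y\<bar> \<le> norm (e x - 1)" by linarith
  then show ?thesis unfolding near_int_def by blast
qed

section \<open>Polynomial phases\<close>

text \<open>
The phase \<open>F\<close> behaves like a polynomial of degree \<open>j\<close> whose \<open>j\<close>-th difference is the constant \<open>\<gamma>\<close>, that is,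
\<open>j!\<close> times the leading coefficient. Recursion over differences is the form in which Weyl
differencing consumes the degree, and it avoids tracking lower order coefficients.
\<close>

primrec polyphase :: "nat \<Rightarrow> real \<Rightarrow> (int \<Rightarrow> real) \<Rightarrow> bool" where
  "polyphase 0 \<gamma> F \<longleftrightarrow> (\<forall>m. F m = \<gamma>)"
| "polyphase (Suc j) \<gamma> F \<longleftrightarrow> (\<forall>h. polyphase j (of_int h * \<gamma>) (\<lambda>m. F (m + h) - F m))"

lemma coeff_shift_diff:
  fixes p :: "'a :: comm_ring_1 poly"
  assumes "degree p \<le> Suc j"
  shows "degree (pcompose p [:h, 1:] - p) \<le> j \<and>
         coeff (pcompose p [:h, 1:] - p) j = of_nat (Suc j) * h * coeff p (Suc j)"
  using assms
proof (induction p arbitrary: j)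
  case 0
  then show ?case by simp
next
  case (pCons a p)
  have eq: "pcompose (pCons a p) [:h, 1:] - pCons a p =
      pCons 0 (pcompose p [:h, 1:] - p) + Polynomial.smult h (pcompose p [:h, 1:])"
    by (simp add: pcompose_pCons poly_eq_iff coeff_pCons split: nat.splits)
  show ?case
  proof (cases "p = 0")
    case True
    then show ?thesis by (simp add: pcompose_pCons)
  next
    case False
    then have dp: "degree p \<le> j" using pCons.prems by simp
    show ?thesis
    proof (cases j)
      case 0
      then obtain b where b: "p = [:b:]" using dp degree_eq_zeroE by (metis le_zero_eq)
      show ?thesis unfolding eq using 0 by (simp add: b pcompose_pCons)
    next
      case (Suc i)
      let ?D = "pcompose p [:h, 1:] - p"
      have D: "degree ?D \<le> i" "coeff ?D i = of_nat (Suc i) * h * coeff p (Suc i)"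
        using pCons.IH [of i] dp Suc by auto
      have eq': "pcompose (pCons a p) [:h, 1:] - pCons a p = pCons 0 ?D + Polynomial.smult h (p + ?D)"
        unfolding eq by simp
      have d1: "degree (p + ?D) \<le> j" using dp D Suc by (intro degree_add_le) auto
      have c1: "coeff (p + ?D) j = coeff p j" 
        using coeff_eq_0 [of ?D j] D(1) Suc by (simp add: less_Suc_eq_le)
      have "degree (pCons 0 ?D + Polynomial.smult h (p + ?D)) \<le> j"
        using d1 D(1) Suc degree_pCons_le [of 0 ?D] degree_smult_le [of h "p + ?D"]
        by (intro degree_add_le [of "pCons 0 ?D"]) linarith+
      moreover have "coeff (pCons 0 ?D + Polynomial.smult h (p + ?D)) j = of_nat (Suc j) * h * coeff p j"
        unfolding coeff_add coeff_smult c1 [unfolded coeff_add] using D(2) Suc c1 by (simp add: algebra_simps)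
      ultimately show ?thesis unfolding eq' coeff_pCons_Suc by blast
    qed
  qed
qed

lemma polyphase_poly:
  assumes "degree p \<le> j"
  shows "polyphase j (fact j * coeff p j) (\<lambda>m. poly p (of_int m))"
  using assms
proof (induction j arbitrary: p)
  case 0
  then obtain c where "p = [:c:]" using degree_eq_zeroE by (metis le_zero_eq)
  then show ?case by simp
next
  case (Suc j)
  show ?case
  proof (subst polyphase.simps, intro allI)
    fix h :: int
    let ?D = "pcompose p [:of_int h, 1:] - p"
    have "degree ?D \<le> j" "coeff ?D j = of_nat (Suc j) * of_int h * coeff p (Suc j)"
      using coeff_shift_diff [OF Suc.prems] by blast+
    with Suc.IH [of ?D] 
    show "polyphase j (of_int h * (fact (Suc j) * coeff p (Suc j)))
        (\<lambda>m. poly p (of_int (m + h)) - poly p (of_int m))"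
      by (simp add: poly_pcompose algebra_simps)
  qed
qed


section \<open>Many nearly integral multiples\<close>

lemma card_int_diameter_le:
  fixes X :: "int set"
  assumes "finite X" "0 \<le> l" "\<And>x y. x \<in> X \<Longrightarrow> y \<in> X \<Longrightarrow> of_int (x - y) \<le> (l::real)"
  shows "real (card X) \<le> l + 1"
proof (cases "X = {}")
  case False
  have "X \<subseteq> {Min X..Max X}" using assms(1) by auto
  then have "card X \<le> card {Min X..Max X}" by (intro card_mono) auto
  also have "\<dots> = nat (Max X - Min X + 1)" by simp
  finally have "real (card X) \<le> real (nat (Max X - Min X + 1))" by simp
  also have "\<dots> = of_int (Max X - Min X) + 1"
    using Min_le [OF assms(1) Max_in [OF assms(1) False]] by simp
  also have "of_int (Max X - Min X) \<le> l" using assms(1) False by (intro assms(3)) auto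
  finally show ?thesis by simp
qed (use assms in auto)

text \<open>
As \<open>x\<close> runs through an interval of length \<open>Z\<close>, the value \<open>c + x \<epsilon>\<close> meets at most \<open>Z \<bar>\<epsilon>\<bar> + 2 \<kappa> + 1\<close> of the
windows of radius \<open>\<kappa>\<close> around integers, and stays in each for at most \<open>2 \<kappa> / \<bar>\<epsilon>\<bar> + 1\<close> steps.
\<close>

lemma card_near_int_progression_le:
  fixes X :: "int set"
  assumes X: "finite X" "\<And>x y. x \<in> X \<Longrightarrow> y \<in> X \<Longrightarrow> of_int (x - y) \<le> (Z::real)" "0 \<le> Z"
    and \<kappa>: "0 \<le> \<kappa>" "\<epsilon> \<noteq> 0"
    and near: "\<And>x. x \<in> X \<Longrightarrow> near_int \<kappa> (c + of_int x * \<epsilon>)"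
  shows "real (card X) \<le> (Z * \<bar>\<epsilon>\<bar> + 2 * \<kappa> + 1) * (2 * \<kappa> / \<bar>\<epsilon>\<bar> + 1)"
proof -
  obtain u :: "int \<Rightarrow> int" where u: "\<And>x. x \<in> X \<Longrightarrow> \<bar>c + of_int x * \<epsilon> - of_int (u x)\<bar> \<le> \<kappa>"
    using near unfolding near_int_def by metis
  have A: "of_int (x - y) * \<epsilon> \<le> Z * \<bar>\<epsilon>\<bar>" if "x \<in> X" "y \<in> X" for x y
  proof -
    have "\<bar>of_int (x - y) :: real\<bar> \<le> Z" using X(2) [OF that] X(2) [OF that(2,1)] by auto
    then have "\<bar>of_int (x - y) * \<epsilon>\<bar> \<le> Z * \<bar>\<epsilon>\<bar>" unfolding abs_mult by (rule mult_right_mono) auto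
    then show ?thesis by linarith
  qed
  have "of_int (u x - u y) \<le> Z * \<bar>\<epsilon>\<bar> + 2 * \<kappa>" if "x \<in> X" "y \<in> X" for x y
  proof -
    have "of_int (u x - u y) \<le> of_int (x - y) * \<epsilon> + 2 * \<kappa>"
      using u [OF that(1)] u [OF that(2)] by (simp add: algebra_simps abs_le_iff)
    then show ?thesis using A [OF that] by linarith
  qed
  then have card_u: "real (card (u ` X)) \<le> (Z * \<bar>\<epsilon>\<bar> + 2 * \<kappa>) + 1"
    using X(1,3) \<kappa> by (intro card_int_diameter_le) auto
  have fibre: "real (card {x \<in> X. u x = n}) \<le> 2 * \<kappa> / \<bar>\<epsilon>\<bar> + 1" for n
  proof (rule card_int_diameter_le)
    fix x y assume *: "x \<in> {x \<in> X. u x = n}" "y \<in> {x \<in> X. u x = n}"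
    then have "\<bar>of_int (x - y) * \<epsilon>\<bar> \<le> 2 * \<kappa>" 
      using u [of x] u [of y] by (simp add: algebra_simps abs_le_iff)
    then have "\<bar>of_int (x - y)\<bar> * \<bar>\<epsilon>\<bar> \<le> 2 * \<kappa>" by (simp only: abs_mult)
    then have "\<bar>of_int (x - y)\<bar> \<le> 2 * \<kappa> / \<bar>\<epsilon>\<bar>" using \<kappa> by (simp add: pos_le_divide_eq)
    then show "of_int (x - y) \<le> 2 * \<kappa> / \<bar>\<epsilon>\<bar>" by linarith
  qed (use X \<kappa> in auto)
  have "card X = (\<Sum>n\<in>u ` X. card {x \<in> X. u x = n})"
    using sum.image_gen [OF X(1), of "\<lambda>_. 1::nat" u] by simp
  then have "real (card X) = (\<Sum>n\<in>u ` X. real (card {x \<in> X. u x = n}))" by simp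
  also have "\<dots> \<le> real (card (u ` X)) * (2 * \<kappa> / \<bar>\<epsilon>\<bar> + 1)"
    using fibre by (intro sum_bounded_above)
  also have "\<dots> \<le> (Z * \<bar>\<epsilon>\<bar> + 2 * \<kappa> + 1) * (2 * \<kappa> / \<bar>\<epsilon>\<bar> + 1)"
    using card_u \<kappa> by (intro mult_right_mono) auto
  finally show ?thesis .
qed

lemma pigeonhole_fibre:
  fixes G :: "'a set"
  assumes "finite G" "f ` G \<subseteq> V" "finite V" "V \<noteq> {}"
  obtains v where "v \<in> V" "real (card G) \<le> real (card V) * real (card {x \<in> G. f x = v})"
proof -
  have "\<exists>v\<in>V. real (card G) \<le> real (card V) * real (card {x \<in> G. f x = v})"
  proof (rule ccontr)
    assume "\<not> ?thesis"
    then have *: "real (card V) * real (card {x \<in> G. f x = v}) < real (card G)" if "v \<in> V" for v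
      using that by force
    have "card G = (\<Sum>v\<in>V. card {x \<in> G. f x = v})"
      using sum.group [OF assms(1,3,2), of "\<lambda>_. 1::nat"] by simp
    then have "real (card V) * real (card G) = (\<Sum>v\<in>V. real (card V) * real (card {x \<in> G. f x = v}))" 
      by (simp add: sum_distrib_left)
    also have "\<dots> < (\<Sum>v\<in>V. real (card G))" using assms(3,4) * by (intro sum_strict_mono)
    finally show False by simp
  qed
  then show ?thesis using that by blast
qed

text \<open>
Vinogradov's lemma. Two of the given multiples are close together, so their difference \<open>u\<close> is small and
\<open>u \<phi>\<close> lies within \<open>2 \<kappa>\<close> of an integer. The point is the gain of the factor \<open>K\<close>: with the
signed error \<open>\<epsilon>\<close> of \<open>u \<phi>\<close>, the multiples in one residue class modulo \<open>u\<close> drift in steps of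
\<open>\<epsilon>\<close>, and unless \<open>\<epsilon>\<close> is of order \<open>\<kappa> / K\<close> they leave the windows around the integers too often to be
as numerous as assumed.
\<close>

lemma near_int_of_many_multiples:
  fixes G :: "int set"
  assumes G: "G \<subseteq> {b..<b + int K}" and card: "real K / U \<le> real (card G)" and U: "1 \<le> U"
    and near: "\<And>h. h \<in> G \<Longrightarrow> near_int \<kappa> (of_int h * \<phi>)"
    and \<kappa>: "0 \<le> \<kappa>" "16 * U * \<kappa> \<le> 1" and K: "24 * U^2 \<le> real K"
  obtains u :: int where "1 \<le> u" "of_int u \<le> 2 * U" "near_int (24 * \<kappa> * U^2 / K) (of_int u * \<phi>)"
proof -
  have finG: "finite G" using G finite_subset by blast
  have K0: "real K > 0" using K U by (smt (verit) zero_less_power)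
  \<comment> \<open>Cells of length about \<open>2 * U\<close>: there are fewer of them than elements of \<open>G\<close>, so two elements share one.\<close>
  define w where "w = nat \<lceil>2 * U\<rceil>"
  have w: "2 * U \<le> real w" "real w < 2 * U + 1" "w \<ge> 2" using U unfolding w_def by linarith+
  define cell where "cell = (\<lambda>h. (h - b) div int w)"
  have KU: "24 * U \<le> real K / U" using K U by (simp add: field_simps power2_eq_square)
  have "real (card (cell ` G)) \<le> real K / w + 1"
  proof (rule card_int_diameter_le)
    fix x y assume "x \<in> cell ` G" "y \<in> cell ` G"
    then obtain h h' where h: "h \<in> {b..<b + int K}" "h' \<in> {b..<b + int K}" "x = cell h" "y = cell h'"
      using G by (meson image_iff subsetD)
    have "0 \<le> y" using h w by (simp add: cell_def pos_imp_zdiv_nonneg_iff)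
    moreover have "of_int x \<le> real K / w"
    proof -
      have "x * int w = (h - b) - (h - b) mod int w" using h by (simp add: cell_def minus_mod_eq_div_mult)
      moreover have "(h - b) mod int w \<ge> 0" using w by simp
      ultimately have "x * int w \<le> h - b" by linarith
      then have "x * int w \<le> int K" using h by simp
      then have "of_int x * real w \<le> real K" by (metis of_int_le_iff of_int_mult of_int_of_nat_eq)
      then show ?thesis using w by (simp add: field_simps)
    qed
    ultimately show "of_int (x - y) \<le> real K / w" by simp
  qed (use finG in auto)
  also have "\<dots> < real K / U"
  proof -
    have "real K / w \<le> real K / (2 * U)" using w U K0 by (intro divide_left_mono) auto
    moreover have "real K / (2 * U) = real K / U / 2" by simp
    ultimately show ?thesis using KU U by linarith
  qed
  finally have "real (card (cell ` G)) < real (card G)" using card by simp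
  then have "\<not> inj_on cell G" using card_image by fastforce
  then obtain h h' where hh: "h \<in> G" "h' \<in> G" "h < h'" "cell h = cell h'"
    unfolding inj_on_def by (metis linorder_less_linear)
  define u where "u = h' - h"
  have u1: "1 \<le> u" using hh by (simp add: u_def)
  have "u < int w"
  proof -
    have "h - b = int w * cell h + (h - b) mod int w" "h' - b = int w * cell h' + (h' - b) mod int w"
      by (simp_all add: cell_def)
    then have "u = (h' - b) mod int w - (h - b) mod int w" using hh by (simp add: u_def)
    moreover have "(h' - b) mod int w < int w" "(h - b) mod int w \<ge> 0" using w by auto
    ultimately show ?thesis by linarith
  qed
  then have "of_int u \<le> real w - 1" by linarith
  then have u2: "of_int u \<le> 2 * U" using w by linarith
  have "near_int (\<kappa> + \<kappa>) (of_int h' * \<phi> - of_int h * \<phi>)" using near hh by (intro near_int_diff)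
  then have "near_int (2 * \<kappa>) (of_int u * \<phi>)" by (simp add: u_def algebra_simps)
  then obtain n :: int where n: "\<bar>of_int u * \<phi> - of_int n\<bar> \<le> 2 * \<kappa>" unfolding near_int_def by blast
  define \<epsilon> where "\<epsilon> = of_int u * \<phi> - of_int n"
  have "\<bar>\<epsilon>\<bar> \<le> 24 * \<kappa> * U^2 / K"
  proof (cases "\<epsilon> = 0")
    case True
    then show ?thesis using \<kappa> by simp
  next
    case False
    define Z where "Z = real K / of_int u"
    have Z: "Z \<ge> 12 * U" 
    proof -
      have "12 * U * of_int u \<le> 12 * U * (2 * U)" using u2 U by (intro mult_left_mono) auto
      also have "\<dots> \<le> K" using K by (simp add: power2_eq_square)
      finally show ?thesis using u1 by (simp add: Z_def field_simps)
    qed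
    \<comment> \<open>Some residue class modulo \<open>u\<close> contains many elements of \<open>G\<close>; on it \<open>h * \<phi>\<close> moves in steps of \<open>\<epsilon>\<close>.\<close>
    have "(\<lambda>h. h mod u) ` G \<subseteq> {0..<u}" "{0..<u} \<noteq> {}" using u1 by auto
    then obtain r where r: "r \<in> {0..<u}" 
      "real (card G) \<le> real (card {0..<u}) * real (card {x \<in> G. x mod u = r})"
      using pigeonhole_fibre [OF finG, of "\<lambda>h. h mod u" "{0..<u}"] finite_atLeastLessThan_int by metis
    define R where "R = {x \<in> G. x mod u = r}"
    have finR: "finite R" using finG by (simp add: R_def)
    have "real K / U \<le> of_int u * real (card R)" using r card u1 by (simp add: R_def)
    then have "Z / U \<le> real (card R)" using u1 U by (simp add: Z_def field_simps)
    also have "card R = card ((\<lambda>h. h div u) ` R)"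
    proof (rule card_image [symmetric], rule inj_onI)
      fix x y assume "x \<in> R" "y \<in> R" "x div u = y div u"
      then show "x = y" unfolding R_def by (metis (mono_tags, lifting) div_mult_mod_eq mem_Collect_eq)
    qed
    also have "real \<dots> \<le> (Z * \<bar>\<epsilon>\<bar> + 2 * \<kappa> + 1) * (2 * \<kappa> / \<bar>\<epsilon>\<bar> + 1)"
    proof (rule card_near_int_progression_le [where c = "of_int r * \<phi>"])
      fix x y assume "x \<in> (\<lambda>h. h div u) ` R" "y \<in> (\<lambda>h. h div u) ` R"
      then obtain g g' where g: "g \<in> R" "g' \<in> R" "x = g div u" "y = g' div u" by blast
      then have "g mod u = r" "g' mod u = r" by (auto simp: R_def)
      then have "g = x * u + r" "g' = y * u + r" using g(3,4) div_mult_mod_eq [of g u] div_mult_mod_eq [of g' u] by auto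
      then have "(x - y) * u = g - g'" by (simp add: algebra_simps)
      moreover have "g \<in> {b..<b + int K}" "g' \<in> {b..<b + int K}" using g G by (auto simp: R_def)
      then have "g - g' \<le> int K" by simp
      ultimately have "(x - y) * u \<le> int K" by simp
      then have "of_int (x - y) * of_int u \<le> real K" by (metis of_int_le_iff of_int_mult of_int_of_nat_eq)
      then show "of_int (x - y) \<le> Z" using u1 by (simp add: Z_def field_simps)
    next
      fix x assume "x \<in> (\<lambda>h. h div u) ` R"
      then obtain g where g: "g \<in> R" "x = g div u" by blast
      then have g': "g = x * u + r" using div_mult_mod_eq [of g u] by (auto simp: R_def)
      have "of_int g * \<phi> = (of_int r * \<phi> + of_int x * \<epsilon>) + of_int (x * n)"
        by (simp add: g' \<epsilon>_def algebra_simps)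
      moreover have "near_int \<kappa> (of_int g * \<phi>)" using near g by (simp add: R_def)
      ultimately obtain v :: int where "\<bar>(of_int r * \<phi> + of_int x * \<epsilon>) + of_int (x * n) - of_int v\<bar> \<le> \<kappa>"
        unfolding near_int_def by auto
      then have "\<bar>(of_int r * \<phi> + of_int x * \<epsilon>) - of_int (v - x * n)\<bar> \<le> \<kappa>" by (simp add: algebra_simps)
      then show "near_int \<kappa> (of_int r * \<phi> + of_int x * \<epsilon>)" unfolding near_int_def by blast
    qed (use finR False Z U \<kappa> in auto)
    also have "\<dots> = 2 * \<kappa> * Z + Z * \<bar>\<epsilon>\<bar> + 4 * \<kappa> * (\<kappa> / \<bar>\<epsilon>\<bar>) + 2 * \<kappa> + 2 * (\<kappa> / \<bar>\<epsilon>\<bar>) + 1"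
      using False by (simp add: field_simps)
    also have "\<dots> \<le> 4 * \<kappa> * Z + 6 * (\<kappa> / \<bar>\<epsilon>\<bar>) + 3"
    proof -
      have \<kappa>1: "\<kappa> \<le> 1" using \<kappa> U by (smt (verit) mult_right_mono mult_cancel_right1)
      then have "4 * \<kappa> * (\<kappa> / \<bar>\<epsilon>\<bar>) \<le> 4 * 1 * (\<kappa> / \<bar>\<epsilon>\<bar>)" using \<kappa> by (intro mult_right_mono) auto
      moreover have "Z * \<bar>\<epsilon>\<bar> \<le> Z * (2 * \<kappa>)" using n Z U by (intro mult_left_mono) (auto simp: \<epsilon>_def)
      moreover have "Z * (2 * \<kappa>) = 2 * \<kappa> * Z" by simp
      ultimately show ?thesis using \<kappa>1 by linarith
    qed
    finally have main: "Z / U \<le> 4 * \<kappa> * Z + 6 * (\<kappa> / \<bar>\<epsilon>\<bar>) + 3" .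
    have "4 * \<kappa> * Z \<le> (Z / U) / 4"
    proof -
      have "16 * U * \<kappa> * Z \<le> 1 * Z" using \<kappa> Z U by (intro mult_right_mono) auto
      then show ?thesis using U by (simp add: field_simps)
    qed
    moreover have "3 \<le> (Z / U) / 4" using Z U by (simp add: field_simps)
    moreover have "w / 2 \<le> y" if "x \<le> w / 4" "3 \<le> w / 4" "w \<le> x + y + 3" for w x y :: real
      using that by linarith
    ultimately have "(Z / U) / 2 \<le> 6 * (\<kappa> / \<bar>\<epsilon>\<bar>)" using main by blast
    then have "\<bar>\<epsilon>\<bar> * Z \<le> 12 * \<kappa> * U" using False U by (simp add: field_simps)
    then have "\<bar>\<epsilon>\<bar> * K \<le> 12 * \<kappa> * U * of_int u" using u1 by (simp add: Z_def field_simps)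
    also have "\<dots> \<le> 12 * \<kappa> * U * (2 * U)" using u2 \<kappa> U by (intro mult_left_mono) auto
    finally show ?thesis using K0 by (simp add: field_simps power2_eq_square)
  qed
  then have "near_int (24 * \<kappa> * U^2 / K) (of_int u * \<phi>)" unfolding near_int_def \<epsilon>_def by blast
  then show ?thesis using that u1 u2 by blast
qed

section \<open>Weyl sums with a periodic twist\<close>

lemma norm_sum_squared_le:
  fixes g :: "'a \<Rightarrow> complex"
  shows "(norm (\<Sum>m\<in>R. g m))^2 \<le> real (card R) * (\<Sum>m\<in>R. (norm (g m))^2)"
proof -
  have "(norm (\<Sum>m\<in>R. g m))^2 \<le> (\<Sum>m\<in>R. norm (g m))^2"
    by (intro power_mono norm_sum) auto
  also have "\<dots> \<le> (\<Sum>m\<in>R. (norm (g m))^2) * real (card R)"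
    by (rule sum_squared_le_sum_of_squares)
  finally show ?thesis by (simp add: mult.commute)
qed

text \<open>
Van der Corput's inequality with shifts that are multiples of \<open>q\<close>: average the sum over \<open>K\<close> such shifts,
apply Cauchy-Schwarz, and expand the square into correlations. Fixing the best of the two shift
variables leaves a one-dimensional family of differences \<open>h\<close>.
\<close>

lemma van_der_Corput:
  fixes f :: "int \<Rightarrow> complex"
  assumes f: "\<And>m. m \<notin> {a..<b} \<Longrightarrow> f m = 0"
    and L: "of_int (b - a) \<le> (L::real)" "a \<le> b" "of_int q * real K \<le> L" "0 < L"
    and q: "1 \<le> q" and K: "1 \<le> K" and T: "0 < T"
    and large: "L / T \<le> norm (\<Sum>m\<in>{a..<b}. f m)"
  obtains c :: int where
    "real K * L / (2 * T^2) \<le> (\<Sum>h\<in>{c..<c + int K}. norm (\<Sum>m\<in>{a..<b}. f (m + q * h) * cnj (f m)))"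
proof -
  define S where "S = (\<Sum>m\<in>{a..<b}. f m)"
  define R where "R = {a - q * int K..<b}"
  define C where "C = (\<lambda>h. \<Sum>m\<in>{a..<b}. f (m + q * h) * cnj (f m))"
  have qK: "0 \<le> q * int l" "q * int l \<le> q * int K" if "l < K" for l
    using that q by (auto intro: mult_left_mono)
  have shift: "(\<Sum>m\<in>R. f (m + q * int l)) = S" if "l < K" for l
  proof -
    have "(\<Sum>m\<in>R. f (m + q * int l)) = (\<Sum>m\<in>(\<lambda>m. m + q * int l) ` R. f m)"
      by (subst sum.reindex) (auto simp: inj_on_def)
    also have "\<dots> = S" unfolding S_def
    proof (rule sum.mono_neutral_right)
      show "{a..<b} \<subseteq> (\<lambda>m. m + q * int l) ` R"
      proof
        fix m assume "m \<in> {a..<b}"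
        then have "m - q * int l \<in> R" using qK [OF that] by (auto simp: R_def)
        then show "m \<in> (\<lambda>m. m + q * int l) ` R" by (rule rev_image_eqI) simp
      qed
    qed (use f in \<open>auto simp: R_def\<close>)
    finally show ?thesis .
  qed
  have corr: "(\<Sum>m\<in>R. f (m + q * int l) * cnj (f (m + q * int l'))) = C (int l - int l')" if "l < K" "l' < K" for l l'
  proof -
    have "(\<Sum>m\<in>R. f (m + q * int l) * cnj (f (m + q * int l'))) =
          (\<Sum>m\<in>(\<lambda>m. m + q * int l') ` R. f (m + q * (int l - int l')) * cnj (f m))"
      by (subst sum.reindex) (auto simp: inj_on_def algebra_simps)
    also have "\<dots> = C (int l - int l')" unfolding C_def
    proof (rule sum.mono_neutral_right)
      show "{a..<b} \<subseteq> (\<lambda>m. m + q * int l') ` R"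
      proof
        fix m assume "m \<in> {a..<b}"
        then have "m - q * int l' \<in> R" using qK [OF that(2)] by (auto simp: R_def)
        then show "m \<in> (\<lambda>m. m + q * int l') ` R" by (rule rev_image_eqI) simp
      qed
    qed (use f in \<open>auto simp: R_def\<close>)
    finally show ?thesis .
  qed
  have "real K * norm S = norm (\<Sum>l<K. \<Sum>m\<in>R. f (m + q * int l))"
    using shift by (simp add: norm_mult)
  also have "\<dots> = norm (\<Sum>m\<in>R. \<Sum>l<K. f (m + q * int l))"
    by (subst sum.swap) simp
  finally have "(real K * norm S)^2 \<le> real (card R) * (\<Sum>m\<in>R. (norm (\<Sum>l<K. f (m + q * int l)))^2)"
    by (simp only: norm_sum_squared_le)
  also have "(\<Sum>m\<in>R. (norm (\<Sum>l<K. f (m + q * int l)))^2) = norm (\<Sum>l<K. \<Sum>l'<K. C (int l - int l'))"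
  proof -
    have "complex_of_real (\<Sum>m\<in>R. (norm (\<Sum>l<K. f (m + q * int l)))^2) =
       (\<Sum>m\<in>R. (\<Sum>l<K. f (m + q * int l)) * cnj (\<Sum>l<K. f (m + q * int l)))"
      by (simp only: of_real_sum complex_norm_square)
    also have "\<dots> = (\<Sum>m\<in>R. \<Sum>l<K. \<Sum>l'<K. f (m + q * int l) * cnj (f (m + q * int l')))"
      by (simp add: sum_product cnj_sum)
    also have "\<dots> = (\<Sum>l<K. \<Sum>m\<in>R. \<Sum>l'<K. f (m + q * int l) * cnj (f (m + q * int l')))"
      by (rule sum.swap)
    also have "\<dots> = (\<Sum>l<K. \<Sum>l'<K. \<Sum>m\<in>R. f (m + q * int l) * cnj (f (m + q * int l')))"
      by (intro sum.cong refl sum.swap)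
    also have "\<dots> = (\<Sum>l<K. \<Sum>l'<K. C (int l - int l'))"
      by (intro sum.cong refl corr) auto
    finally have "norm (complex_of_real (\<Sum>m\<in>R. (norm (\<Sum>l<K. f (m + q * int l)))^2)) = 
      norm (\<Sum>l<K. \<Sum>l'<K. C (int l - int l'))" by simp
    then show ?thesis by (simp only: norm_of_real abs_of_nonneg [OF sum_nonneg, OF zero_le_power2])
  qed
  also have "norm (\<Sum>l<K. \<Sum>l'<K. C (int l - int l')) = norm (\<Sum>l'<K. \<Sum>l<K. C (int l - int l'))"
    by (subst sum.swap) simp
  also have "real (card R) * norm (\<Sum>l'<K. \<Sum>l<K. C (int l - int l')) \<le>
      (2 * L) * (\<Sum>l'<K. \<Sum>l<K. norm (C (int l - int l')))"
  proof (intro mult_mono)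
    have "0 \<le> q * int K" using q by simp
    then have "int (card R) = b - a + q * int K" using L(2) by (simp add: R_def)
    then have "real (card R) = of_int (b - a) + of_int q * real K" by (metis of_int_add of_int_mult of_int_of_nat_eq)
    then show "real (card R) \<le> 2 * L" using L by simp
  qed (use L in \<open>auto intro!: sum_norm_le order_trans [OF norm_sum] sum_mono\<close>)
  finally have upper: "(real K * norm S)^2 \<le> (2 * L) * (\<Sum>l'<K. \<Sum>l<K. norm (C (int l - int l')))" .
  have "(2 * L) * (real K * (real K * L / (2 * T^2))) = (real K * (L / T))^2"
    using T by (simp add: field_simps power2_eq_square)
  also have "(real K * (L / T))^2 \<le> (real K * norm S)^2"
    using large L T by (intro power_mono mult_left_mono) (auto simp: S_def)
  also note upper
  finally have "(2 * L) * (real K * (real K * L / (2 * T^2))) \<le> (2 * L) * (\<Sum>l'<K. \<Sum>l<K. norm (C (int l - int l')))" .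
  then have total: "real K * (real K * L / (2 * T^2)) \<le> (\<Sum>l'<K. \<Sum>l<K. norm (C (int l - int l')))"
    using L(4) by (simp only: mult_le_cancel_left_pos)
  have "\<exists>l'<K. real K * L / (2 * T^2) \<le> (\<Sum>l<K. norm (C (int l - int l')))"
  proof (rule ccontr)
    assume "\<not> ?thesis"
    then have "(\<Sum>l'<K. \<Sum>l<K. norm (C (int l - int l'))) < (\<Sum>l'<K. real K * L / (2 * T^2))"
    proof (intro sum_strict_mono)
      have "0 \<in> {..<K}" using K by simp
      then show "{..<K} \<noteq> {}" by blast
    qed (auto simp: not_le)
    then show False using total by simp
  qed
  then obtain l' where l': "l' < K" "real K * L / (2 * T^2) \<le> (\<Sum>l<K. norm (C (int l - int l')))" by blast
  have "(\<Sum>l<K. norm (C (int l - int l'))) = (\<Sum>h\<in>{- int l'..<- int l' + int K}. norm (C h))"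
    by (rule sum.reindex_bij_witness [of _ "\<lambda>h. nat (h + int l')" "\<lambda>l. int l - int l'"]) auto
  with l'(2) have "real K * L / (2 * T^2) \<le> (\<Sum>h\<in>{- int l'..<- int l' + int K}. norm (C h))" by simp
  then show ?thesis unfolding C_def by (rule that)
qed


lemma periodic_add_mult:
  fixes \<psi> :: "int \<Rightarrow> 'a"
  assumes "\<And>m. \<psi> (m + q) = \<psi> m"
  shows "\<psi> (m + q * h) = \<psi> m"
proof (induction h rule: int_induct [of _ 0])
  case (step1 i)
  then show ?case using assms [of "m + q * i"] by (simp add: algebra_simps)
next
  case (step2 i)
  then show ?case using assms [of "m + q * (i - 1)"] by (simp add: algebra_simps)
qed simp

text \<open>
Shifting by \<open>q\<close> multiplies the summand by the constant \<open>e(q \<gamma>)\<close> but changes the sum only at the ends of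
the interval, so a large sum forces \<open>e(q \<gamma>)\<close> to be near \<open>1\<close>.
\<close>

lemma weyl_twisted_linear:
  assumes F: "polyphase 1 \<gamma> F" and \<psi>: "\<And>m. \<psi> (m + q) = \<psi> m" "\<And>m. norm (\<psi> m) = 1"
    and q: "1 \<le> q" and L: "0 < L" and T: "0 < T"
    and large: "L / T \<le> norm (\<Sum>m\<in>{a..<b}. \<psi> m * e (F m))"
  shows "near_int (2 * of_int q * T / L) (of_int q * \<gamma>)"
proof -
  let ?f = "\<lambda>m. \<psi> m * e (F m)"
  let ?X = "{a + q..<b + q}" and ?Y = "{a..<b}"
  have step: "?f (m + q) = ?f m * e (of_int q * \<gamma>)" for m
  proof -
    have "F (m + q) - F m = of_int q * \<gamma>" using F [unfolded One_nat_def polyphase.simps] by blast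
    then have "F (m + q) = F m + of_int q * \<gamma>" by simp
    then show ?thesis by (simp add: e_add \<psi> mult_ac)
  qed
  have "(e (of_int q * \<gamma>) - 1) * (\<Sum>m\<in>?Y. ?f m) = (\<Sum>m\<in>?Y. ?f (m + q)) - (\<Sum>m\<in>?Y. ?f m)"
  proof -
    have "(\<Sum>m\<in>?Y. ?f (m + q)) = (\<Sum>m\<in>?Y. ?f m) * e (of_int q * \<gamma>)"
      by (simp only: step sum_distrib_right)
    then show ?thesis by (simp only: left_diff_distrib mult_1 mult.commute)
  qed
  also have "(\<Sum>m\<in>?Y. ?f (m + q)) = (\<Sum>m\<in>?X. ?f m)"
    by (rule sum.reindex_bij_witness [of _ "\<lambda>m. m - q" "\<lambda>m. m + q"]) auto
  also have "\<dots> - (\<Sum>m\<in>?Y. ?f m) = (\<Sum>m\<in>?X - ?Y. ?f m) - (\<Sum>m\<in>?Y - ?X. ?f m)"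
    using sum.Int_Diff [of ?X ?f ?Y] sum.Int_Diff [of ?Y ?f ?X] by (simp add: Int_commute)
  finally have eq: "(e (of_int q * \<gamma>) - 1) * (\<Sum>m\<in>?Y. ?f m) = (\<Sum>m\<in>?X - ?Y. ?f m) - (\<Sum>m\<in>?Y - ?X. ?f m)" .
  have "norm (e (of_int q * \<gamma>) - 1) * norm (\<Sum>m\<in>?Y. ?f m) \<le> 
      norm (\<Sum>m\<in>?X - ?Y. ?f m) + norm (\<Sum>m\<in>?Y - ?X. ?f m)"
    unfolding norm_mult [symmetric] eq by (rule norm_triangle_ineq4)
  also have "\<dots> \<le> real (card (?X - ?Y)) + real (card (?Y - ?X))"
    by (intro add_mono order_trans [OF norm_sum]) (simp_all add: norm_mult \<psi>)
  also have "\<dots> \<le> of_int q + of_int q"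
  proof (intro add_mono)
    have "card (?X - ?Y) \<le> card {b..<b + q}" using q by (intro card_mono) auto
    then show "real (card (?X - ?Y)) \<le> of_int q" using q by (simp add: nat_le_iff le_nat_iff)
    have "card (?Y - ?X) \<le> card {a..<a + q}" using q by (intro card_mono) auto
    then show "real (card (?Y - ?X)) \<le> of_int q" using q by (simp add: nat_le_iff le_nat_iff)
  qed
  finally have "norm (e (of_int q * \<gamma>) - 1) * norm (\<Sum>m\<in>?Y. ?f m) \<le> 2 * of_int q" by simp
  moreover have "norm (e (of_int q * \<gamma>) - 1) * (L / T) \<le> norm (e (of_int q * \<gamma>) - 1) * norm (\<Sum>m\<in>?Y. ?f m)"
    using large by (intro mult_left_mono) auto
  ultimately have "norm (e (of_int q * \<gamma>) - 1) * (L / T) \<le> 2 * of_int q" by linarith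
  then have "norm (e (of_int q * \<gamma>) - 1) \<le> 2 * of_int q * T / L" using L T by (simp add: field_simps)
  with near_int_norm_e show ?thesis by (rule near_int_mono)
qed

text \<open>
Weyl's inequality without logarithms or divisor functions, by induction on the degree. Differencing
with shifts \<open>q h\<close> removes the \<open>q\<close>-periodic factor \<open>\<psi>\<close> and leaves, for many \<open>h\<close>, an untwisted sum of
one degree less and top difference \<open>q h \<gamma>\<close>. The induction hypothesis gives denominators, one
of them serves many \<open>h\<close>, and Vinogradov's lemma turns this into an approximation to \<open>q \<gamma>\<close>. Note that \<open>q\<close>
enters the conclusion only to the first power. One step replaces an exponent \<open>A\<close> by at most
\<open>9 A + 8\<close>, which \<open>10^j\<close> accommodates.
\<close>

lemma weyl_twisted:
  fixes T L :: real and q :: int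
  assumes "polyphase (Suc j) \<gamma> F" "\<And>m. \<psi> (m + q) = \<psi> m" "\<And>m. norm (\<psi> m) = 1" "1 \<le> q" 
    and "of_int (b - a) \<le> L" "of_int q * T ^ (10 ^ Suc j) \<le> L" "10 \<le> T" 
    and "L / T \<le> norm (\<Sum>m\<in>{a..<b}. \<psi> m * e (F m))"
  shows "\<exists>q'::int. 1 \<le> q' \<and> of_int q' \<le> T ^ (10 ^ Suc j) \<and> 
          near_int (of_int q * T ^ (10 ^ Suc j) / L ^ Suc j) (of_int q' * of_int q * \<gamma>)"
  using assms
proof (induction j arbitrary: \<gamma> F \<psi> q a b T)
  case 0
  have "0 < of_int q * T ^ (10 ^ Suc 0)" using "0.prems"(4,7) by (intro mult_pos_pos) auto
  then have L: "0 < L" using "0.prems"(6) by linarith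
  have "2 * of_int q * T / L \<le> of_int q * T ^ (10 ^ Suc 0) / L ^ Suc 0"
  proof -
    have "T ^ 2 \<le> T ^ 10" using "0.prems"(7) by (intro power_increasing) auto
    moreover have "2 * T \<le> T ^ 2" using "0.prems"(7) by (simp add: power2_eq_square)
    ultimately have "of_int q * (2 * T) \<le> of_int q * T ^ 10" using "0.prems"(4) by (intro mult_left_mono) auto
    then show ?thesis using L by (simp add: divide_right_mono mult_ac)
  qed
  moreover have "near_int (2 * of_int q * T / L) (of_int q * \<gamma>)"
    by (rule weyl_twisted_linear [OF _ "0.prems"(2,3,4) L _ "0.prems"(8)]) (use "0.prems"(1,7) in simp_all)
  ultimately have "near_int (of_int q * T ^ (10 ^ Suc 0) / L ^ Suc 0) (of_int 1 * of_int q * \<gamma>)"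
    using near_int_mono by simp
  moreover have "of_int 1 \<le> T ^ (10 ^ Suc 0)" using "0.prems"(7) by simp
  ultimately show ?case by (metis order_refl)
next
  case (Suc j)
  note F = Suc.prems(1) and \<psi> = Suc.prems(2,3) and q = Suc.prems(4) and I = Suc.prems(5)
    and T = Suc.prems(7) and large = Suc.prems(8)
  define A :: nat where "A = 10 ^ Suc j"
  have A10: "10 \<le> A" unfolding A_def by simp
  have expo: "10 ^ Suc (Suc j) = 10 * A" by (simp add: A_def)
  have L: "of_int q * T ^ (10 * A) \<le> L" using Suc.prems(6) unfolding expo .
  define T1 where "T1 = 4 * T^2"
  define U where "U = T1 ^ Suc A"
  define K where "K = nat \<lfloor>L / of_int q\<rfloor>"
  \<comment> \<open>As \<open>T1\<close> is at most \<open>T ^ 3\<close>, two further factors \<open>T\<close> pay for any numerical constant below.\<close>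
  have absorb: "c * T1 ^ n \<le> T ^ (10 * A)" if "3 * n + 2 \<le> 10 * A" "0 \<le> c" "c \<le> 100" for n c
  proof -
    have "4 * T^2 \<le> T * T^2" using T by (intro mult_right_mono) auto
    then have "T1 \<le> T^3" by (simp add: T1_def eval_nat_numeral)
    then have "T1 ^ n \<le> (T^3) ^ n" by (intro power_mono) (auto simp: T1_def)
    moreover have "c \<le> T^2" using that T power_mono [of 10 T 2] by simp
    ultimately have "c * T1 ^ n \<le> T^2 * (T^3) ^ n" using that by (intro mult_mono) (auto simp: T1_def)
    also have "\<dots> = T ^ (3 * n + 2)" unfolding power_add power_mult by (rule mult.commute)
    also have "\<dots> \<le> T ^ (10 * A)" using that T by (intro power_increasing) auto
    finally show ?thesis .
  qed
  have T1: "10 \<le> T1" "1 \<le> T1" using T power_mono [of 10 T 2] by (auto simp: T1_def)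
  have T1A: "1 \<le> T1 ^ A" using T1 by (intro one_le_power) auto
  have TA: "1 \<le> T ^ (10 * A)" "100 \<le> T ^ (10 * A)" using absorb [of 0 100] absorb [of 0 1] A10 by auto
  have Lq: "T ^ (10 * A) \<le> L / of_int q" using L q by (simp add: pos_le_divide_eq mult.commute)
  have L1: "T ^ (10 * A) \<le> L" 
  proof -
    have "1 * T ^ (10 * A) \<le> of_int q * T ^ (10 * A)" using q TA by (intro mult_right_mono) auto
    then show ?thesis using L by linarith
  qed
  then have L0: "0 < L" "1 \<le> L" using TA by auto
  have Kr: "real K = of_int \<lfloor>L / of_int q\<rfloor>" using L0 q by (simp add: K_def)
  have K: "L / (2 * of_int q) \<le> real K" "real K \<le> L / of_int q"
  proof -
    have "L / of_int q - 1 \<le> real K" "real K \<le> L / of_int q" unfolding Kr by linarith+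
    moreover have "L / (2 * of_int q) = L / of_int q / 2" by simp
    ultimately show "L / (2 * of_int q) \<le> real K" "real K \<le> L / of_int q" using Lq TA by linarith+
  qed
  have K1: "1 \<le> K" 
  proof -
    have "0 < L / (2 * of_int q)" using L0 q by simp
    then show ?thesis using K(1) by (simp add: Suc_le_eq)
  qed
  have ab: "a \<le> b"
  proof (rule ccontr)
    assume "\<not> a \<le> b"
    moreover have "0 < L / T" using L0 T by simp
    ultimately show False using large by simp
  qed
  define f where "f = (\<lambda>m. if m \<in> {a..<b} then \<psi> m * e (F m) else 0)"
  define C where "C = (\<lambda>h. \<Sum>m\<in>{a..<b}. f (m + q * h) * cnj (f m))"
  have "(\<Sum>m\<in>{a..<b}. f m) = (\<Sum>m\<in>{a..<b}. \<psi> m * e (F m))" by (simp add: f_def)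
  then have large': "L / T \<le> norm (\<Sum>m\<in>{a..<b}. f m)" using large by simp
  have fsupp: "f m = 0" if "m \<notin> {a..<b}" for m using that by (simp only: f_def if_False)
  have qK: "of_int q * real K \<le> L" using K(2) q by (simp add: pos_le_divide_eq mult.commute)
  have T0: "0 < T" using T by simp
  have "\<exists>c. real K * L / (2 * T^2) \<le> (\<Sum>h\<in>{c..<c + int K}. norm (C h))"
    unfolding C_def by (rule van_der_Corput [OF fsupp I ab qK L0(1) q K1 T0 large']) (assumption | rule exI)+
  then obtain c :: int where c: "real K * L / (2 * T^2) \<le> (\<Sum>h\<in>{c..<c + int K}. norm (C h))" by blast
  have Cle: "norm (C h) \<le> L" for h
  proof -
    have "norm (C h) \<le> (\<Sum>m\<in>{a..<b}. 1)" unfolding C_def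
      by (intro sum_norm_le) (auto simp: f_def norm_mult \<psi>)
    also have "\<dots> \<le> L" using I ab by simp
    finally show ?thesis .
  qed
  define good where "good = {h \<in> {c..<c + int K}. L / T1 \<le> norm (C h)}"
  have fing: "finite good" unfolding good_def by (rule finite_subset [of _ "{c..<c + int K}"]) auto
  have card_good: "real K / T1 \<le> real (card good)"
  proof -
    have "(\<Sum>h\<in>{c..<c + int K}. norm (C h)) \<le> (\<Sum>h\<in>{c..<c + int K}. (if h \<in> good then L else 0) + L / T1)"
    proof (rule sum_mono)
      fix h assume h: "h \<in> {c..<c + int K}"
      have "0 \<le> L / T1" using L0 T1 by simp
      then show "norm (C h) \<le> (if h \<in> good then L else 0) + L / T1"
        using Cle [of h] h by (cases "h \<in> good") (simp_all add: good_def)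
    qed
    also have "\<dots> = real (card good) * L + real K * (L / T1)"
    proof -
      have "{c..<c + int K} \<inter> {h. h \<in> good} = good" by (auto simp: good_def)
      then show ?thesis by (simp add: sum.distrib sum.If_cases)
    qed
    finally have "2 * (real K * (L / T1)) \<le> real (card good) * L + real K * (L / T1)" using c by (simp add: T1_def mult.commute)
    moreover have "(real K / T1) * L = real K * (L / T1)" by simp
    ultimately have "(real K / T1) * L \<le> real (card good) * L" by linarith
    then show ?thesis using L0 by (simp only: mult_le_cancel_right_pos)
  qed
  have "\<exists>q'::int. 1 \<le> q' \<and> of_int q' \<le> T1 ^ A \<and> near_int (T1 ^ A / L ^ Suc j) (of_int q' * (of_int (q * h) * \<gamma>))"
    if h: "h \<in> good" for h
  proof -
    let ?a = "max a (a - q * h)" and ?b = "min b (b - q * h)"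
    let ?G = "\<lambda>m. F (m + q * h) - F m"
    have "C h = (\<Sum>m\<in>{?a..<?b}. 1 * e (?G m))"
    proof -
      have "C h = (\<Sum>m\<in>{?a..<?b}. f (m + q * h) * cnj (f m))" unfolding C_def
        by (rule sum.mono_neutral_right) (auto simp: f_def)
      also have "\<dots> = (\<Sum>m\<in>{?a..<?b}. 1 * e (?G m))"
      proof (rule sum.cong [OF refl])
        fix m assume m: "m \<in> {?a..<?b}"
        have "f (m + q * h) = \<psi> m * e (F (m + q * h))" "f m = \<psi> m * e (F m)"
          using m periodic_add_mult [of \<psi> q, OF \<psi>(1)] by (auto simp: f_def)
        moreover have "\<psi> m * cnj (\<psi> m) = 1" using \<psi>(2) by (simp add: complex_norm_square [symmetric])
        ultimately show "f (m + q * h) * cnj (f m) = 1 * e (?G m)"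
          by (simp add: e_diff mult_ac)
      qed
      finally show ?thesis .
    qed
    with h have big: "L / T1 \<le> norm (\<Sum>m\<in>{?a..<?b}. 1 * e (?G m))" by (simp add: good_def)
    have pp: "polyphase (Suc j) (of_int (q * h) * \<gamma>) ?G" 
      using F by (subst (asm) polyphase.simps) blast
    have ab': "of_int (?b - ?a) \<le> L" 
    proof -
      have "?b - ?a \<le> b - a" by simp
      then show ?thesis using I by linarith
    qed
    have LT: "of_int 1 * T1 ^ 10 ^ Suc j \<le> L" using absorb [of A 1] A10 L1 by (simp add: A_def)
    show ?thesis using Suc.IH [OF pp, of "\<lambda>_. 1" 1 ?b ?a T1] ab' LT T1 big by (simp add: A_def)
  qed
  then obtain g :: "int \<Rightarrow> int" where g: "\<And>h. h \<in> good \<Longrightarrow> 1 \<le> g h" "\<And>h. h \<in> good \<Longrightarrow> of_int (g h) \<le> T1 ^ A"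
     "\<And>h. h \<in> good \<Longrightarrow> near_int (T1 ^ A / L ^ Suc j) (of_int (g h) * (of_int (q * h) * \<gamma>))" by metis
  \<comment> \<open>One value \<open>v\<close> of \<open>g\<close> is taken by so many \<open>h\<close> that their multiples of \<open>v * q * \<gamma>\<close> can be compared.\<close>
  define V where "V = {1..\<lfloor>T1 ^ A\<rfloor>}"
  have "g ` good \<subseteq> V" using g(1,2) by (auto simp: V_def le_floor_iff)
  moreover have "V \<noteq> {}" "finite V" using T1A by (auto simp: V_def le_floor_iff)
  ultimately obtain v where v: "v \<in> V" "real (card good) \<le> real (card V) * real (card {h \<in> good. g h = v})"
    using pigeonhole_fibre [OF fing] by metis
  define G where "G = {h \<in> good. g h = v}"
  have v1: "1 \<le> v" "of_int v \<le> T1 ^ A" using v(1) by (auto simp: V_def le_floor_iff)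
  have cV: "real (card V) \<le> T1 ^ A" using T1A by (simp add: V_def)
  have cardG: "real K / U \<le> real (card G)"
  proof -
    have "real K / T1 \<le> T1 ^ A * real (card G)"
      using card_good v(2) mult_right_mono [OF cV, of "real (card G)"] by (simp add: G_def)
    then show ?thesis using T1 by (simp add: U_def field_simps)
  qed
  have nearG: "near_int (T1 ^ A / L ^ Suc j) (of_int h * (of_int v * of_int q * \<gamma>))" if "h \<in> G" for h
    using g(3) [of h] that by (simp add: G_def mult_ac)
  have LS: "L \<le> L ^ Suc j" using L0 by (simp add: one_le_power)
  have U1: "1 \<le> U" using T1 by (auto simp: U_def intro!: one_le_power mult_ge1_I)
  have small: "16 * U * (T1 ^ A / L ^ Suc j) \<le> 1"
  proof -
    have "16 * T1 ^ (Suc A + A) \<le> T ^ (10 * A)" using A10 by (intro absorb) auto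
    then have "16 * U * T1 ^ A \<le> L ^ Suc j" using L1 LS by (simp add: U_def power_add mult_ac)
    then show ?thesis using L0 by (simp add: field_simps)
  qed
  have bigK: "24 * U^2 \<le> real K"
  proof -
    have "48 * T1 ^ (Suc A * 2) \<le> T ^ (10 * A)" using A10 by (intro absorb) auto
    then have "48 * U^2 \<le> L / of_int q" using Lq unfolding U_def power_mult by linarith
    moreover have "L / (2 * of_int q) = L / of_int q / 2" by simp
    ultimately show ?thesis using K(1) by linarith
  qed
  have G_sub: "G \<subseteq> {c..<c + int K}" by (auto simp: G_def good_def)
  have \<kappa>0: "0 \<le> T1 ^ A / L ^ Suc j" using T1A L0 by simp
  obtain u :: int where u: "1 \<le> u" "of_int u \<le> 2 * U" 
     "near_int (24 * (T1 ^ A / L ^ Suc j) * U^2 / K) (of_int u * (of_int v * of_int q * \<gamma>))"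
    by (rule near_int_of_many_multiples [OF G_sub cardG U1 nearG \<kappa>0 small bigK])
  have "24 * (T1 ^ A / L ^ Suc j) * U^2 / K \<le> of_int q * T ^ (10 * A) / L ^ Suc (Suc j)"
  proof -
    have "24 * (T1 ^ A / L ^ Suc j) * U^2 / K \<le> 24 * (T1 ^ A / L ^ Suc j) * U^2 / (L / (2 * of_int q))"
      using K(1) K1 L0 q T1A by (intro divide_left_mono mult_pos_pos) auto
    also have "\<dots> = of_int q * (48 * (T1 ^ A * U^2)) / L ^ Suc (Suc j)" using L0 q by (simp add: field_simps)
    also have "T1 ^ A * U^2 = T1 ^ (A + Suc A * 2)" unfolding U_def power_add power_mult by simp
    also have "of_int q * (48 * T1 ^ (A + Suc A * 2)) / L ^ Suc (Suc j) \<le> of_int q * T ^ (10 * A) / L ^ Suc (Suc j)"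
      using A10 q L0 by (intro divide_right_mono mult_left_mono absorb) auto
    finally show ?thesis .
  qed
  with u(3) have "near_int (of_int q * T ^ (10 * A) / L ^ Suc (Suc j)) (of_int u * (of_int v * of_int q * \<gamma>))"
    by (rule near_int_mono)
  moreover have "of_int (u * v) \<le> T ^ (10 * A)"
  proof -
    have "of_int (u * v) \<le> (2 * U) * T1 ^ A" unfolding of_int_mult
      using u v1 U1 by (intro mult_mono) auto
    also have "\<dots> = 2 * T1 ^ (Suc A + A)" by (simp add: U_def power_add)
    also have "\<dots> \<le> T ^ (10 * A)" using A10 by (intro absorb) auto
    finally show ?thesis .
  qed
  moreover have "1 \<le> u * v" using u(1) v1(1) mult_mono [of 1 u 1 v] by simp
  ultimately show ?case unfolding expo by (intro exI [of _ "u * v"]) (simp add: mult_ac)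
qed

section \<open>Rational and real frequencies\<close>

lemma dvd_if_near_int_rat:
  assumes "near_int \<kappa> (of_int x / of_int v)" "0 < v" "\<kappa> * of_int v < 1"
  shows "v dvd x"
proof -
  obtain u :: int where u: "\<bar>of_int x / of_int v - of_int u\<bar> \<le> \<kappa>" using assms(1) unfolding near_int_def by blast
  have "of_int (x - u * v) = (of_int x / of_int v - of_int u) * (of_int v :: real)"
    using assms(2) by (simp add: field_simps)
  then have "\<bar>of_int (x - u * v)\<bar> = \<bar>of_int x / of_int v - of_int u\<bar> * (of_int v :: real)"
    using assms(2) by (simp add: abs_mult)
  also have "\<dots> \<le> \<kappa> * of_int v" using u assms(2) by (intro mult_right_mono) auto
  finally have "\<bar>of_int (x - u * v)\<bar> < (1::real)" using assms(3) by linarith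
  then have "\<bar>x - u * v\<bar> < 1" by (metis of_int_abs of_int_less_1_iff)
  then have "x = u * v" by simp
  then show ?thesis by simp
qed

lemma poly_eq_sum_le:
  fixes p :: "'a :: comm_semiring_1 poly"
  assumes "degree p \<le> k"
  shows "poly p x = (\<Sum>i\<le>k. coeff p i * x ^ i)"
proof -
  have "poly p x = poly (\<Sum>i\<le>k. monom (coeff p i) i) x" using poly_as_sum_of_monoms' [OF assms] by simp
  then show ?thesis by (simp add: poly_sum poly_monom)
qed

lemma polyphase_power_sum: "polyphase j (fact j * c j) (\<lambda>m. \<Sum>i\<le>j. c i * of_int m ^ i)"
proof -
  let ?p = "\<Sum>i\<le>j. monom (c i) i"
  have "degree ?p \<le> j" by (intro degree_sum_le) (auto intro: order_trans [OF degree_monom_le])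
  from polyphase_poly [OF this] show ?thesis
    by (simp add: poly_sum poly_monom coeff_sum)
qed

lemma dvd_add_power_diff:
  fixes q :: "'a :: comm_ring_1"
  shows "q dvd (m + q) ^ i - m ^ i"
proof (induction i)
  case (Suc i)
  have "(m + q) ^ Suc i - m ^ Suc i = m * ((m + q) ^ i - m ^ i) + q * (m + q) ^ i" by (simp add: algebra_simps)
  then show ?case using Suc by (metis dvd_add dvd_mult dvd_triv_left)
qed simp

text \<open>
The denominators are found from the top coefficient downwards. Suppose \<open>v\<close> divides \<open>q\<close> times every
coefficient of degree above \<open>j\<close>. Then these terms contribute an exactly \<open>q\<close>-periodic unimodular
factor, and \<open>weyl_twisted\<close> applies to the rest, whose degree is \<open>j\<close>. The resulting approximation to a
number with denominator \<open>v\<close> is better than \<open>1/v\<close>, hence exact, so \<open>v\<close> divides a new \<open>q\<close> times the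
coefficient of degree \<open>j\<close> as well. Working with an exact fraction keeps the loss additive in the
exponents; approximations would have to be carried through shorter and shorter ranges. In the end \<open>v\<close>
divides \<open>q\<close> times all nonconstant coefficients, and these have no common factor.
\<close>

lemma weyl_rational:
  fixes g :: "int poly" and T L :: real and n v :: int
  assumes deg: "degree g \<le> k" and prim: "\<And>w. (\<And>i. 1 \<le> i \<Longrightarrow> w dvd coeff g i) \<Longrightarrow> w dvd 1"
    and cop: "coprime n v" and v: "1 \<le> v" and T: "10 \<le> T" "real k \<le> T" and I: "of_int (b - a) \<le> L"
    and large: "L / T \<le> norm (\<Sum>m\<in>{a..<b}. e (of_int n / of_int v * of_int (poly g m)))"
    and L: "of_int v * T ^ (k * (10 ^ k + k)) < L"
  shows "of_int v \<le> T ^ (k * (10 ^ k + k))"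
proof -
  define E where "E = 10 ^ k + k"
  have TE: "T ^ (t * E) \<le> T ^ (k * E)" if "t \<le> k" for t using that T by (intro power_increasing) auto
  have TL: "T ^ (k * E) < L"
  proof -
    have "1 * T ^ (k * E) \<le> of_int v * T ^ (k * E)" using v T by (intro mult_right_mono) auto
    then show ?thesis using L by (simp add: E_def)
  qed
  have "1 \<le> T ^ (k * E)" using T by (intro one_le_power) auto
  then have L1: "1 \<le> L" using TL by linarith
  have "\<exists>q::int. 1 \<le> q \<and> of_int q \<le> T ^ (t * E) \<and> (\<forall>i>k - t. v dvd q * coeff g i)" if "t \<le> k" for t
    using that
  proof (induction t)
    case 0
    then show ?case using deg by (intro exI [of _ 1]) (auto simp: coeff_eq_0)
  next
    case (Suc t)
    then obtain q :: int where q: "1 \<le> q" "of_int q \<le> T ^ (t * E)" "\<And>i. k - t < i \<Longrightarrow> v dvd q * coeff g i" by auto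
    define j' where "j' = k - Suc t"
    define j where "j = Suc j'"
    have j: "j = k - t" "j \<le> k" "1 \<le> j" using Suc.prems by (auto simp: j_def j'_def)
    define x :: real where "x = of_int n / of_int v"
    define \<psi> where "\<psi> = (\<lambda>m::int. e (\<Sum>i\<in>{j<..k}. x * of_int (coeff g i) * of_int m ^ i))"
    define F where "F = (\<lambda>m::int. \<Sum>i\<le>j. (x * of_int (coeff g i)) * of_int m ^ i)"
    have split: "e (x * of_int (poly g m)) = \<psi> m * e (F m)" for m
    proof -
      have "x * of_int (poly g m) = (\<Sum>i\<le>k. x * of_int (coeff g i) * of_int m ^ i)"
        by (simp add: poly_eq_sum_le [OF deg] sum_distrib_left mult.assoc)
      also have "{..k} = {j<..k} \<union> {..j}" using j by auto
      also have "(\<Sum>i\<in>{j<..k} \<union> {..j}. x * of_int (coeff g i) * of_int m ^ i) = 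
         (\<Sum>i\<in>{j<..k}. x * of_int (coeff g i) * of_int m ^ i) + F m"
        unfolding F_def by (subst sum.union_disjoint) auto
      finally show ?thesis unfolding \<psi>_def by (simp only: e_add)
    qed
    have per: "\<psi> (m + q) = \<psi> m" for m
    proof -
      have "\<exists>z::int. x * of_int (coeff g i) * of_int (m + q) ^ i = x * of_int (coeff g i) * of_int m ^ i + of_int z"
        if i: "i \<in> {j<..k}" for i
      proof -
        obtain w where w: "(m + q) ^ i - m ^ i = q * w" using dvd_add_power_diff [of q m i] by (auto elim: dvdE)
        obtain y where y: "q * coeff g i = v * y" using q(3) [of i] i j by (auto elim: dvdE)
        have "of_int (coeff g i) * (of_int (m + q) ^ i - of_int m ^ i) = (of_int (coeff g i * (q * w)) :: real)"
          by (simp flip: w)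
        also have "\<dots> = of_int (v * y * w)" by (simp flip: y add: mult_ac)
        finally have "x * (of_int (coeff g i) * (of_int (m + q) ^ i - of_int m ^ i)) = of_int (n * y * w)"
          using v by (simp add: x_def)
        then show ?thesis by (intro exI [of _ "n * y * w"]) (simp add: algebra_simps)
      qed
      then obtain z :: "nat \<Rightarrow> int" where z: "\<And>i. i \<in> {j<..k} \<Longrightarrow> 
         x * of_int (coeff g i) * of_int (m + q) ^ i = x * of_int (coeff g i) * of_int m ^ i + of_int (z i)" by metis
      have "(\<Sum>i\<in>{j<..k}. x * of_int (coeff g i) * of_int (m + q) ^ i) = 
         (\<Sum>i\<in>{j<..k}. x * of_int (coeff g i) * of_int m ^ i + of_int (z i))"
        by (rule sum.cong [OF refl z])
      also have "\<dots> = (\<Sum>i\<in>{j<..k}. x * of_int (coeff g i) * of_int m ^ i) + of_int (\<Sum>i\<in>{j<..k}. z i)"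
        by (simp add: sum.distrib)
      finally show ?thesis unfolding \<psi>_def by (simp only: e_add e_of_int mult_1_right)
    qed
    have pp: "polyphase (Suc j') (fact j * (x * of_int (coeff g j))) F"
      unfolding F_def j_def [symmetric] by (rule polyphase_power_sum)
    have Tj: "T ^ (10 ^ j) \<le> T ^ (10 ^ k)" using j T by (intro power_increasing) auto
    have Tq: "of_int q * T ^ (10 ^ j) \<le> T ^ (t * E + 10 ^ k)" unfolding power_add
      using q Tj T by (intro mult_mono) auto
    have "T ^ (t * E + 10 ^ k) \<le> T ^ (k * E)"
    proof (rule power_increasing)
      have "t * E + 10 ^ k \<le> Suc t * E" by (simp add: E_def)
      also have "\<dots> \<le> k * E" using Suc.prems by (rule mult_right_mono) simp
      finally show "t * E + 10 ^ k \<le> k * E" .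
    qed (use T in auto)
    with Tq have Tq': "of_int q * T ^ (10 ^ j) \<le> T ^ (k * E)" by linarith
    then have qL: "of_int q * T ^ (10 ^ Suc j') \<le> L" using TL unfolding j_def [symmetric] by linarith
    have nrm: "norm (\<psi> m) = 1" for m by (simp add: \<psi>_def)
    have large': "L / T \<le> norm (\<Sum>m\<in>{a..<b}. \<psi> m * e (F m))" using large unfolding x_def [symmetric] split .
    obtain q' :: int where q': "1 \<le> q'" "of_int q' \<le> T ^ (10 ^ j)" 
        "near_int (of_int q * T ^ (10 ^ j) / L ^ j) (of_int q' * of_int q * (fact j * (x * of_int (coeff g j))))"
      using weyl_twisted [OF pp per nrm q(1) I qL T(1) large'] unfolding j_def [symmetric] by blast
    have eq: "of_int q' * of_int q * (fact j * (x * of_int (coeff g j))) = 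
        of_int (n * (q' * q * fact j * coeff g j)) / (of_int v :: real)" by (simp add: x_def)
    have "v dvd n * (q' * q * fact j * coeff g j)"
    proof (rule dvd_if_near_int_rat)
      show "near_int (of_int q * T ^ (10 ^ j) / L ^ j) (of_int (n * (q' * q * fact j * coeff g j)) / of_int v)"
        using q'(3) unfolding eq .
      have "of_int v * (of_int q * T ^ (10 ^ j)) \<le> of_int v * T ^ (k * E)" using Tq' v by (intro mult_left_mono) auto
      also have "\<dots> < L" using L by (simp add: E_def)
      also have "L \<le> L ^ j" using L1 j by (metis power_increasing power_one_right)
      finally show "of_int q * T ^ (10 ^ j) / L ^ j * of_int v < 1" using L1 by (simp add: field_simps)
    qed (use v in auto)
    then have new: "v dvd q' * q * fact j * coeff g j" using cop by (simp add: coprime_commute coprime_dvd_mult_right_iff)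
    show ?case
    proof (intro exI conjI allI impI)
      have "1 * 1 * 1 \<le> q' * q * fact j" using q(1) q'(1) by (intro mult_mono) auto
      then show "1 \<le> q' * q * fact j" by simp
      have "fact j \<le> T ^ k"
      proof -
        have "(fact j :: real) \<le> of_nat (j ^ j)" by (rule fact_le_power)
        also have "\<dots> \<le> T ^ j" using j T by (simp add: power_mono)
        also have "\<dots> \<le> T ^ k" using j T by (intro power_increasing) auto
        finally show ?thesis .
      qed
      then have "of_int q' * of_int q * fact j \<le> T ^ (10 ^ k) * T ^ (t * E) * T ^ k"
        using q q' T order_trans [OF q'(2) Tj] by (intro mult_mono) auto
      also have "\<dots> = T ^ (Suc t * E)" by (simp add: E_def power_add)
      finally show "of_int (q' * q * fact j) \<le> T ^ (Suc t * E)" by simp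
      fix i assume i: "k - Suc t < i"
      show "v dvd q' * q * fact j * coeff g i"
      proof (cases "i = j")
        case False
        then have "v dvd q * coeff g i" using i j Suc.prems by (intro q(3)) (auto simp: j'_def)
        then have "v dvd (q' * fact j) * (q * coeff g i)" by (rule dvd_mult)
        then show ?thesis by (simp add: mult_ac)
      qed (use new in simp)
    qed
  qed
  from this [of k] obtain q :: int where q: "1 \<le> q" "of_int q \<le> T ^ (k * E)" "\<And>i. 0 < i \<Longrightarrow> v dvd q * coeff g i" by auto
  define w where "w = v div gcd v q"
  have "w dvd coeff g i" if i: "1 \<le> i" for i
  proof -
    have gp: "gcd v q \<noteq> 0" using v by simp
    have "gcd v q * w = v" "gcd v q * ((q div gcd v q) * coeff g i) = q * coeff g i"
      by (simp_all add: w_def flip: mult.assoc)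
    moreover have "v dvd q * coeff g i" using q(3) [of i] i by simp
    ultimately have "gcd v q * w dvd gcd v q * ((q div gcd v q) * coeff g i)" by argo
    then have "w dvd (q div gcd v q) * coeff g i" using gp unfolding dvd_mult_cancel_left by blast
    moreover have "coprime w (q div gcd v q)" unfolding w_def using v by (intro div_gcd_coprime) auto
    ultimately show ?thesis by (simp add: coprime_dvd_mult_right_iff)
  qed
  then have "w dvd 1" by (rule prim)
  then obtain y where y: "w * y = 1" by (metis dvdE)
  have "gcd v q = gcd v q * (w * y)" by (simp only: y mult_1_right)
  also have "\<dots> = v * y" by (simp add: w_def)
  finally have "v dvd gcd v q" by (rule dvdI)
  then have "v dvd q" by simp
  then have "v \<le> q" using q(1) by (intro zdvd_imp_le) auto
  then have "of_int v \<le> (of_int q :: real)" by simp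
  with q(2) show ?thesis by (simp add: E_def)
qed

lemma norm_sum_blocks_le:
  fixes f :: "int \<Rightarrow> complex"
  assumes l: "1 \<le> l" and c: "\<And>a b. a0 \<le> a \<Longrightarrow> a \<le> b \<Longrightarrow> b \<le> b0 \<Longrightarrow> b - a \<le> int l \<Longrightarrow> norm (\<Sum>m\<in>{a..<b}. f m) \<le> c"
  shows "a0 \<le> a \<Longrightarrow> a + int n \<le> b0 \<Longrightarrow> norm (\<Sum>m\<in>{a..<a + int n}. f m) \<le> (real n / real l + 1) * c"
proof (induction n arbitrary: a rule: less_induct)
  case (less n)
  have c0: "0 \<le> c" using c [of a a] less.prems by simp
  show ?case
  proof (cases "n \<le> l")
    case True
    then have "norm (\<Sum>m\<in>{a..<a + int n}. f m) \<le> c" using less.prems by (intro c) auto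
    also have "\<dots> \<le> (real n / real l + 1) * c" using c0 by (simp add: algebra_simps)
    finally show ?thesis .
  next
    case False
    have "{a..<a + int l} \<union> {a + int l..<(a + int l) + int (n - l)} = {a..<a + int n}" using False by auto
    moreover have "(\<Sum>m\<in>{a..<a + int l} \<union> {a + int l..<(a + int l) + int (n - l)}. f m) = 
        (\<Sum>m\<in>{a..<a + int l}. f m) + (\<Sum>m\<in>{a + int l..<(a + int l) + int (n - l)}. f m)"
      by (rule sum.union_disjoint) auto
    ultimately have eq: "(\<Sum>m\<in>{a..<a + int n}. f m) = 
        (\<Sum>m\<in>{a..<a + int l}. f m) + (\<Sum>m\<in>{a + int l..<(a + int l) + int (n - l)}. f m)" by argo
    have "norm (\<Sum>m\<in>{a..<a + int n}. f m) \<le> norm (\<Sum>m\<in>{a..<a + int l}. f m) + norm (\<Sum>m\<in>{a + int l..<(a + int l) + int (n - l)}. f m)"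
      unfolding eq by (rule norm_triangle_ineq)
    also have "\<dots> \<le> c + (real (n - l) / real l + 1) * c"
      using less.prems False l by (intro add_mono c less.IH) auto
    also have "\<dots> = (real n / real l + 1) * c" using False l by (simp add: field_simps of_nat_diff)
    finally show ?thesis .
  qed
qed

lemma abs_power_diff_le:
  fixes x y M :: real
  assumes "0 \<le> x" "x \<le> M" "0 \<le> y" "y \<le> M"
  shows "\<bar>x ^ i - y ^ i\<bar> \<le> real i * M ^ (i - 1) * \<bar>x - y\<bar>"
proof (induction i)
  case (Suc i)
  show ?case
  proof (cases i)
    case (Suc i')
    have "x ^ Suc i - y ^ Suc i = x * (x ^ i - y ^ i) + (x - y) * y ^ i" by (simp add: algebra_simps)
    then have "\<bar>x ^ Suc i - y ^ Suc i\<bar> \<le> x * \<bar>x ^ i - y ^ i\<bar> + \<bar>x - y\<bar> * y ^ i"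
      using assms abs_triangle_ineq [of "x * (x ^ i - y ^ i)" "(x - y) * y ^ i"] by (simp add: abs_mult)
    also have "\<dots> \<le> M * (real i * M ^ (i - 1) * \<bar>x - y\<bar>) + \<bar>x - y\<bar> * M ^ i"
      using assms Suc.IH by (intro add_mono mult_mono power_mono mult_left_mono) auto
    also have "\<dots> = real (Suc i) * M ^ (Suc i - 1) * \<bar>x - y\<bar>" using Suc by (simp add: algebra_simps)
    finally show ?thesis .
  qed simp
qed simp

lemma ten_mult_le_power:
  fixes k :: nat
  assumes "1 \<le> k"
  shows "10 * k \<le> 10 ^ k"
  using assms
proof (induction k rule: dec_induct)
  case (step n)
  have "10 * Suc n = 10 * n + 10" by simp
  also have "\<dots> \<le> 10 ^ n + 9 * 10 ^ n" using step self_le_power [of 10 n] by (intro add_mono) auto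
  finally show ?case by simp
qed simp

lemma exists_large_block:
  fixes f :: "int \<Rightarrow> complex"
  assumes l: "1 \<le> l" "l < M" and T: "0 < T" and large: "real M / T \<le> norm (\<Sum>m\<in>{1..<1 + int M}. f m)"
  obtains a b where "1 \<le> a" "a \<le> b" "b \<le> 1 + int M" "b - a \<le> int l" 
    "real l / (2 * T) \<le> norm (\<Sum>m\<in>{a..<b}. f m)"
proof -
  have "\<exists>a b. 1 \<le> a \<and> a \<le> b \<and> b \<le> 1 + int M \<and> b - a \<le> int l \<and> real l / (2 * T) \<le> norm (\<Sum>m\<in>{a..<b}. f m)"
  proof (rule ccontr)
    assume "\<not> ?thesis"
    then have "norm (\<Sum>m\<in>{a..<b}. f m) \<le> real l / (2 * T)" if "1 \<le> a" "a \<le> b" "b \<le> 1 + int M" "b - a \<le> int l" for a b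
      using that by (metis less_imp_le not_le)
    then have "norm (\<Sum>m\<in>{1..<1 + int M}. f m) \<le> (real M / real l + 1) * (real l / (2 * T))"
      using l by (intro norm_sum_blocks_le [where ?a0.0 = 1 and ?b0.0 = "1 + int M"]) auto
    also have "\<dots> = (real M + real l) / (2 * T)" using l T by (simp add: field_simps)
    also have "\<dots> < real M / T" using l T by (simp add: field_simps)
    finally show False using large by simp
  qed
  then show ?thesis using that by blast
qed

text \<open>
The leading coefficient \<open>b\<close> alone yields \<open>\<beta> = u / x + \<theta>\<close> with \<open>x\<close> a multiple of \<open>b\<close>, a denominator that may be
as large as \<open>B\<close>, but with an error \<open>\<theta>\<close> of the optimal order \<open>M^(-k) / x\<close>, both up to powers of \<open>T\<close>. On a suitable block of
length only a power of \<open>T\<close> below \<open>M\<close> this error is invisible, so \<open>weyl_rational\<close> applies to the fraction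
in lowest terms and shows that its denominator is in fact bounded by a power of \<open>T\<close>.
\<close>

lemma major_arc:
  fixes g :: "int poly" and \<beta> T B :: real and M :: nat
  assumes deg: "degree g = k" "1 \<le> k" and prim: "\<And>w. (\<And>i. 1 \<le> i \<Longrightarrow> w dvd coeff g i) \<Longrightarrow> w dvd 1"
    and B: "\<And>i. of_int \<bar>coeff g i\<bar> \<le> B" and T: "10 \<le> T" "real k \<le> T"
    and large: "real M / T \<le> norm (\<Sum>m\<in>{1..<1 + int M}. e (\<beta> * of_int (poly g m)))"
    and M: "B * T ^ (100 ^ k) \<le> real M"
  obtains v :: int where "1 \<le> v" "of_int v \<le> T ^ (100 ^ k)"
    "near_int (T ^ (100 ^ k) / (of_int \<bar>lead_coeff g\<bar> * real M ^ k)) (of_int v * \<beta>)"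
proof -
  define X :: nat where "X = 10 ^ k"
  define b where "b = lead_coeff g"
  have "g \<noteq> 0" using deg by auto
  then have b0: "b \<noteq> 0" by (simp add: b_def)
  have b1: "1 \<le> (of_int \<bar>b\<bar> :: real)" using b0 by linarith
  have B1: "1 \<le> B" using b1 B [of k] by (simp add: b_def deg)
  have X10: "10 \<le> X" "10 * k \<le> X"
  proof -
    have "10 ^ 1 \<le> X" unfolding X_def using deg by (intro power_increasing) auto
    then show "10 \<le> X" by simp
    show "10 * k \<le> X" unfolding X_def using deg(2) by (rule ten_mult_le_power)
  qed
  define E where "E = 2 * (k * (X + k))"
  have big: "2 * X + 2 * k + 10 + E \<le> 100 ^ k"
  proof -
    have "10 * k * k \<le> X * k" "10 * k * X \<le> X * X" "10 * X \<le> X * X" using X10 by (intro mult_right_mono; simp)+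
    moreover have "E = 2 * (X * k) + 2 * (k * k)" by (simp add: E_def algebra_simps)
    moreover have "10 * k * k = 10 * (k * k)" "10 * k * X = 10 * (X * k)" by simp_all
    ultimately have "2 * X + 2 * k + 10 + E \<le> X * X" using X10 by linarith
    also have "X * X = 100 ^ k" by (simp add: X_def flip: power_mult_distrib)
    finally show ?thesis .
  qed
  have pw: "T ^ i \<le> T ^ j" if "i \<le> j" for i j using that T by (intro power_increasing) auto
  have T1: "1 \<le> T ^ i" for i using T by (intro one_le_power) auto
  have TM: "B * T ^ (2 * X + 2 * k + 10 + E) \<le> M" 
  proof -
    have "B * T ^ (2 * X + 2 * k + 10 + E) \<le> B * T ^ (100 ^ k)" using pw [OF big] B1 by (intro mult_left_mono) auto
    with M show ?thesis by linarith
  qed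
  have TM': "T ^ i \<le> M" if "i \<le> 2 * X + 2 * k + 10 + E" for i
  proof -
    have "1 * T ^ i \<le> B * T ^ (2 * X + 2 * k + 10 + E)" using B1 pw [OF that] T by (intro mult_mono) auto
    then show ?thesis using TM by simp
  qed
  have BM: "B \<le> M" 
  proof -
    have "B * 1 \<le> B * T ^ (2 * X + 2 * k + 10 + E)" using B1 T1 by (intro mult_left_mono) auto
    then show ?thesis using TM by simp
  qed
  have M0: "1 \<le> real M" using B1 BM by simp
  define \<kappa> where "\<kappa> = T ^ X / real M ^ k"
  have \<kappa>0: "0 \<le> \<kappa>" using T1 [of X] by (simp add: \<kappa>_def)
  \<comment> \<open>The whole polynomial phase, without twist, has top difference \<open>k!\<close> times its leading coefficient.\<close>
  obtain k' where k': "k = Suc k'" using deg by (cases k) auto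
  have "polyphase k (fact k * (\<beta> * of_int b)) (\<lambda>m. \<Sum>i\<le>k. (\<beta> * of_int (coeff g i)) * of_int m ^ i)"
    using polyphase_power_sum [of k "\<lambda>i. \<beta> * of_int (coeff g i)"] by (simp add: b_def deg)
  also have "(\<lambda>m. \<Sum>i\<le>k. (\<beta> * of_int (coeff g i)) * of_int m ^ i) = (\<lambda>m. \<beta> * of_int (poly g m))"
    using deg by (simp add: poly_eq_sum_le [of g k] sum_distrib_left mult.assoc)
  finally have pp: "polyphase (Suc k') (fact k * (\<beta> * of_int b)) (\<lambda>m. \<beta> * of_int (poly g m))" by (simp add: k')
  have "\<exists>q'::int. 1 \<le> q' \<and> of_int q' \<le> T ^ (10 ^ Suc k') \<and> 
     near_int (of_int 1 * T ^ (10 ^ Suc k') / real M ^ Suc k') (of_int q' * of_int 1 * (fact k * (\<beta> * of_int b)))"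
  proof (rule weyl_twisted [OF pp, where \<psi> = "\<lambda>_. 1" and a = 1 and b = "1 + int M"])
    show "of_int 1 * T ^ (10 ^ Suc k') \<le> real M" using TM' [of X] by (simp add: X_def k')
  qed (use T large in auto)
  then obtain q :: int where q: "1 \<le> q" "of_int q \<le> T ^ X" "near_int \<kappa> (of_int q * (fact k * (\<beta> * of_int b)))"
    by (auto simp: X_def k' \<kappa>_def)
  define x where "x = q * fact k * b"
  have "near_int \<kappa> (of_int x * \<beta>)" using q(3) by (simp add: x_def mult_ac)
  then obtain u :: int where u: "\<bar>of_int x * \<beta> - of_int u\<bar> \<le> \<kappa>" unfolding near_int_def by blast
  have x0: "x \<noteq> 0" using q b0 by (simp add: x_def)
  have bx: "(of_int \<bar>b\<bar> :: real) \<le> of_int \<bar>x\<bar>"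
  proof -
    have "1 * 1 * \<bar>b\<bar> \<le> \<bar>q\<bar> * \<bar>fact k\<bar> * \<bar>b\<bar>" using q by (intro mult_right_mono mult_mono) auto
    then have "\<bar>b\<bar> \<le> \<bar>x\<bar>" by (simp add: x_def abs_mult)
    then show ?thesis by (simp only: of_int_le_iff)
  qed
  have xB: "of_int \<bar>x\<bar> \<le> T ^ (X + k) * B"
  proof -
    have "(fact k :: real) \<le> of_nat (k ^ k)" by (rule fact_le_power)
    also have "\<dots> \<le> T ^ k" using T by (simp add: power_mono)
    finally have "of_int \<bar>q\<bar> * fact k * of_int \<bar>b\<bar> \<le> T ^ X * T ^ k * B"
      using q T B [of k] by (intro mult_mono) (auto simp: b_def deg)
    then show ?thesis by (simp add: x_def abs_mult power_add)
  qed
  \<comment> \<open>The fraction \<open>u / x\<close> in lowest terms is \<open>n / v\<close>; the sign of \<open>x\<close> goes to the numerator.\<close>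
  define v where "v = \<bar>x\<bar> div gcd u x"
  define n where "n = sgn x * (u div gcd u x)"
  have gp: "0 < gcd u x" using x0 by simp
  have v: "1 \<le> v" "v \<le> \<bar>x\<bar>" 
  proof -
    have "gcd u x dvd \<bar>x\<bar>" by simp
    then have "\<bar>x\<bar> = v * gcd u x" by (simp add: v_def)
    moreover have "0 < \<bar>x\<bar>" using x0 by simp
    ultimately have "0 < v" using gp by (simp add: zero_less_mult_iff)
    then show "1 \<le> v" by simp
    moreover have "1 \<le> gcd u x" using gp by linarith
    ultimately have "v * 1 \<le> v * gcd u x" by (intro mult_left_mono) linarith+
    then show "v \<le> \<bar>x\<bar>" using \<open>\<bar>x\<bar> = v * gcd u x\<close> by simp
  qed
  have cop: "coprime n v"
  proof -
    have "coprime (u div gcd u x) (x div gcd u x)" using x0 by (intro div_gcd_coprime) auto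
    moreover have "n = u div gcd u x \<or> n = - (u div gcd u x)" using x0 by (auto simp: n_def sgn_if)
    moreover have "v = x div gcd u x \<or> v = - (x div gcd u x)" using dvd_neg_div [of "gcd u x" x] by (auto simp: v_def abs_if)
    ultimately show ?thesis by auto
  qed
  have frac: "(of_int u / of_int x :: real) = of_int n / of_int v"
  proof -
    have "u * v = n * x"
    proof -
      have "gcd u x * (u * v) = u * (gcd u x * v)" "gcd u x * (n * x) = x * sgn x * (gcd u x * (u div gcd u x))"
        by (simp_all only: n_def mult_ac)
      moreover have "gcd u x * v = \<bar>x\<bar>" "gcd u x * (u div gcd u x) = u" by (simp_all add: v_def)
      ultimately have "gcd u x * (u * v) = gcd u x * (n * x)" by (simp only: abs_sgn mult_ac)
      then show ?thesis using x0 by simp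
    qed
    then have "of_int u * of_int v = (of_int n * of_int x :: real)" by (metis of_int_mult)
    then show ?thesis using x0 v by (simp add: field_simps)
  qed
  define \<theta> where "\<theta> = \<beta> - of_int n / of_int v"
  have \<theta>: "\<bar>\<theta>\<bar> \<le> \<kappa> / of_int \<bar>x\<bar>"
  proof -
    have "\<theta> = (of_int x * \<beta> - of_int u) / of_int x" using x0 unfolding \<theta>_def frac [symmetric] by (simp add: field_simps)
    then have "\<bar>\<theta>\<bar> = \<bar>of_int x * \<beta> - of_int u\<bar> / of_int \<bar>x\<bar>" by (simp add: abs_divide)
    then show ?thesis using u by (simp add: divide_right_mono)
  qed
  \<comment> \<open>Over a block of this length the phase \<open>\<theta> * g\<close> varies by less than the size of the normalised sum.\<close>
  define l where "l = nat \<lfloor>real M / T ^ (X + 5)\<rfloor>"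
  have l: "real M / (2 * T ^ (X + 5)) \<le> real l" "real l \<le> real M / T ^ (X + 5)"
  proof -
    have "T ^ (X + 5) * T ^ 1 \<le> real M" unfolding power_add [symmetric] by (rule TM') simp
    then have "T \<le> real M / T ^ (X + 5)" using T1 [of "X + 5"] T by (simp add: field_simps)
    then have "2 \<le> real M / T ^ (X + 5)" using T by linarith
    moreover have "real l = of_int \<lfloor>real M / T ^ (X + 5)\<rfloor>" using T by (simp add: l_def)
    moreover have "real M / (2 * T ^ (X + 5)) = real M / T ^ (X + 5) / 2" by simp
    ultimately show "real M / (2 * T ^ (X + 5)) \<le> real l" "real l \<le> real M / T ^ (X + 5)" by linarith+
  qed
  have lM: "1 \<le> l" "l < M"
  proof -
    have "0 < real M / (2 * T ^ (X + 5))" using M0 T1 [of "X + 5"] T by (intro divide_pos_pos mult_pos_pos) auto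
    then show "1 \<le> l" using l(1) by (simp add: Suc_le_eq)
    have "10 \<le> T ^ (X + 5)" using pw [of 1 "X + 5"] T by simp
    then have "real M / T ^ (X + 5) \<le> real M / 10" using T by (intro divide_left_mono) auto
    then have "real l < real M" using l(2) M0 by linarith
    then show "l < M" by simp
  qed
  obtain a c where ac: "1 \<le> a" "a \<le> c" "c \<le> 1 + int M" "c - a \<le> int l" 
    "real l / (2 * T) \<le> norm (\<Sum>m\<in>{a..<c}. e (\<beta> * of_int (poly g m)))"
    using exists_large_block [OF lM _ large] T by auto
  have vary: "\<bar>of_int (poly g m) - of_int (poly g a)\<bar> \<le> real k ^ 2 * of_int \<bar>b\<bar> * real M ^ (k - 1) * real l" if m: "m \<in> {a..<c}" for m
  proof -
    have term_le: "\<bar>of_int (coeff g i) * (of_int m ^ i - of_int a ^ i)\<bar> \<le> real k * of_int \<bar>b\<bar> * real M ^ (k - 1) * real l" 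
      if i: "i \<in> {1..k}" for i
    proof -
      have "\<bar>of_int m ^ i - of_int a ^ i :: real\<bar> \<le> real i * real M ^ (i - 1) * \<bar>of_int m - of_int a\<bar>"
        using m ac by (intro abs_power_diff_le) auto
      also have "\<dots> \<le> real k * real M ^ (i - 1) * real l"
        using i m ac by (intro mult_mono) auto
      finally have 1: "\<bar>of_int m ^ i - of_int a ^ i :: real\<bar> \<le> real k * real M ^ (i - 1) * real l" .
      have 2: "of_int \<bar>coeff g i\<bar> * real M ^ (i - 1) \<le> of_int \<bar>b\<bar> * real M ^ (k - 1)"
      proof (cases "i = k")
        case True
        then show ?thesis by (simp add: b_def deg)
      next
        case False
        have "of_int \<bar>coeff g i\<bar> * real M ^ (i - 1) \<le> real M * real M ^ (i - 1)"
          using B [of i] BM by (intro mult_right_mono) auto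
        also have "\<dots> = real M ^ i" using i by (cases i) auto
        also have "\<dots> \<le> 1 * real M ^ (k - 1)" using M0 i False by (simp only: mult_1, intro power_increasing) auto
        also have "\<dots> \<le> of_int \<bar>b\<bar> * real M ^ (k - 1)" using b1 by (intro mult_right_mono) auto
        finally show ?thesis .
      qed
      have "\<bar>of_int (coeff g i) * (of_int m ^ i - of_int a ^ i)\<bar> \<le> of_int \<bar>coeff g i\<bar> * (real k * real M ^ (i - 1) * real l)"
        unfolding abs_mult using 1 by (intro mult_mono) auto
      also have "\<dots> = real k * real l * (of_int \<bar>coeff g i\<bar> * real M ^ (i - 1))" by simp
      also have "\<dots> \<le> real k * real l * (of_int \<bar>b\<bar> * real M ^ (k - 1))" using 2 by (intro mult_left_mono) auto
      finally show ?thesis by (simp add: mult_ac)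
    qed
    have "of_int (poly g m) - of_int (poly g a) = (\<Sum>i\<in>{1..k}. of_int (coeff g i) * (of_int m ^ i - of_int a ^ i) :: real)"
    proof -
      have "of_int (poly g m) - of_int (poly g a) = (\<Sum>i\<le>k. of_int (coeff g i) * (of_int m ^ i - of_int a ^ i) :: real)"
        using deg by (simp add: poly_eq_sum_le [of g k] right_diff_distrib sum_subtractf)
      also have "\<dots> = (\<Sum>i\<in>{1..k}. of_int (coeff g i) * (of_int m ^ i - of_int a ^ i))"
        by (rule sum.mono_neutral_right) (auto simp: not_le)
      finally show ?thesis .
    qed
    then have "\<bar>of_int (poly g m) - of_int (poly g a)\<bar> \<le> (\<Sum>i\<in>{1..k}. real k * of_int \<bar>b\<bar> * real M ^ (k - 1) * real l)"
      by (simp only:) (intro order_trans [OF sum_abs] sum_mono term_le)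
    then show ?thesis by (simp add: power2_eq_square mult_ac)
  qed
  have phase: "2 * pi * \<bar>\<theta> * of_int (poly g m) - \<theta> * of_int (poly g a)\<bar> \<le> 1 / (4 * T)" if m: "m \<in> {a..<c}" for m
  proof -
    have "\<bar>\<theta> * of_int (poly g m) - \<theta> * of_int (poly g a)\<bar> = \<bar>\<theta>\<bar> * \<bar>of_int (poly g m) - of_int (poly g a)\<bar>"
      by (simp only: abs_mult [symmetric] right_diff_distrib)
    also have "\<dots> \<le> (\<kappa> / of_int \<bar>x\<bar>) * (real k ^ 2 * of_int \<bar>b\<bar> * real M ^ (k - 1) * real l)"
      using \<theta> vary [OF m] \<kappa>0 by (intro mult_mono) auto
    also have "\<dots> \<le> (\<kappa> / of_int \<bar>b\<bar>) * (real k ^ 2 * of_int \<bar>b\<bar> * real M ^ (k - 1) * real l)"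
      using \<kappa>0 bx b1 x0 by (intro mult_right_mono divide_left_mono mult_pos_pos) auto
    also have "\<dots> = \<kappa> * real k ^ 2 * real M ^ (k - 1) * real l" using b0 by simp
    also have "\<dots> \<le> \<kappa> * T ^ 2 * real M ^ (k - 1) * (real M / T ^ (X + 5))"
      using \<kappa>0 T l by (intro mult_mono power_mono) auto
    also have "\<dots> = T ^ X * T ^ 2 / T ^ (X + 5) * (real M ^ (k - 1) * real M / real M ^ k)" by (simp add: \<kappa>_def mult_ac)
    also have "real M ^ (k - 1) * real M / real M ^ k = 1" using M0 by (simp add: k')
    also have "T ^ X * T ^ 2 / T ^ (X + 5) * 1 = 1 / T ^ 3" using T by (simp add: power_add field_simps eval_nat_numeral)
    finally have "\<bar>\<theta> * of_int (poly g m) - \<theta> * of_int (poly g a)\<bar> \<le> 1 / T ^ 3" .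
    then have "2 * pi * \<bar>\<theta> * of_int (poly g m) - \<theta> * of_int (poly g a)\<bar> \<le> 8 * (1 / T ^ 3)"
      using pi_less_4 by (intro mult_mono) auto
    also have "\<dots> \<le> 1 / (4 * T)"
    proof -
      have "32 * T \<le> T * T ^ 2" using T power_mono [of 10 T 2] by simp
      then show ?thesis using T by (simp add: field_simps eval_nat_numeral)
    qed
    finally show ?thesis .
  qed
  define S where "S = (\<Sum>m\<in>{a..<c}. e (of_int n / of_int v * of_int (poly g m)))"
  have S_large: "real l / T ^ 2 \<le> norm S"
  proof -
    define u where "u = (\<lambda>m. e (of_int n / of_int v * of_int (poly g m)))"
    define w where "w = (\<lambda>m. e (\<theta> * of_int (poly g m)))"
    have "e (\<beta> * of_int (poly g m)) = u m * w m" for m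
      unfolding u_def w_def e_add [symmetric] by (simp add: \<theta>_def left_diff_distrib)
    then have "e (\<beta> * of_int (poly g m)) = u m * w a + u m * (w m - w a)" for m
      by (simp add: right_diff_distrib)
    then have eq: "(\<Sum>m\<in>{a..<c}. e (\<beta> * of_int (poly g m))) = S * w a + (\<Sum>m\<in>{a..<c}. u m * (w m - w a))"
      unfolding S_def u_def [symmetric] sum_distrib_right by (simp add: sum.distrib)
    have "norm (\<Sum>m\<in>{a..<c}. e (\<beta> * of_int (poly g m))) \<le> norm (S * w a) + norm (\<Sum>m\<in>{a..<c}. u m * (w m - w a))"
      unfolding eq by (rule norm_triangle_ineq)
    also have "norm (S * w a) = norm S" by (simp add: norm_mult w_def)
    also have "norm (\<Sum>m\<in>{a..<c}. u m * (w m - w a)) \<le> (\<Sum>m\<in>{a..<c}. 1 / (4 * T))"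
    proof (rule sum_norm_le)
      fix m assume "m \<in> {a..<c}"
      then show "norm (u m * (w m - w a)) \<le> 1 / (4 * T)"
        using order_trans [OF norm_e_diff_le phase] by (simp add: norm_mult u_def w_def)
    qed
    also have "\<dots> = of_int (c - a) * (1 / (4 * T))" using ac by simp
    also have "\<dots> \<le> real l * (1 / (4 * T))" using ac T by (intro mult_right_mono) auto
    finally have "real l / (2 * T) \<le> norm S + real l * (1 / (4 * T))" using ac by linarith
    moreover have "real l / (2 * T) = 2 * (real l * (1 / (4 * T)))" by simp
    ultimately have "real l * (1 / (4 * T)) \<le> norm S" by linarith
    moreover have "real l / T ^ 2 \<le> real l / (4 * T)" 
      using T by (intro divide_left_mono) (auto simp: power2_eq_square)
    ultimately show ?thesis by simp
  qed
  have kE: "(T ^ 2) ^ (k * (10 ^ k + k)) = T ^ E" by (simp add: E_def X_def flip: power_mult)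
  have vsmall: "of_int v \<le> (T ^ 2) ^ (k * (10 ^ k + k))"
  proof (rule weyl_rational [OF _ prim cop])
    show "of_int v * (T ^ 2) ^ (k * (10 ^ k + k)) < real l" unfolding kE
    proof -
      have "of_int v \<le> T ^ (X + k) * B" using v(2) xB by linarith
      then have "of_int v * T ^ E \<le> T ^ (X + k) * B * T ^ E" using T by (intro mult_right_mono) auto
      moreover have "T ^ (X + k) * B * T ^ E * (2 * T ^ (X + 5)) < real M"
      proof -
        have "2 * X + k + 5 + E = (X + k) + E + (X + 5)" by simp
        then have "T ^ (2 * X + k + 5 + E) = T ^ (X + k) * T ^ E * T ^ (X + 5)" by (simp only: power_add)
        then have "T ^ (X + k) * B * T ^ E * (2 * T ^ (X + 5)) = 2 * (B * T ^ (2 * X + k + 5 + E))" by simp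
        also have "\<dots> < T * (B * T ^ (2 * X + k + 5 + E))" using B1 T by (intro mult_strict_right_mono) auto
        also have "\<dots> = B * T ^ Suc (2 * X + k + 5 + E)" by (simp only: power_Suc mult.left_commute)
        also have "\<dots> \<le> B * T ^ (2 * X + 2 * k + 10 + E)" using B1 by (intro mult_left_mono pw) auto
        finally show ?thesis using TM by linarith
      qed
      then have "T ^ (X + k) * B * T ^ E < real M / (2 * T ^ (X + 5))" using T by (simp add: field_simps)
      ultimately show "of_int v * T ^ E < real l" using l(1) by linarith
    qed
    show "10 \<le> T ^ 2" "real k \<le> T ^ 2" using T self_le_power [of T 2] by auto
    show "real_of_int (c - a) \<le> real l" using ac by linarith
    show "real l / T ^ 2 \<le> norm (\<Sum>m\<in>{a..<c}. e (of_int n / of_int v * of_int (poly g m)))" using S_large by (simp add: S_def)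
  qed (use deg v in auto)
  show ?thesis
  proof (rule that)
    show "1 \<le> v" by (fact v)
    show "of_int v \<le> T ^ (100 ^ k)" using vsmall pw [of E "100 ^ k"] big unfolding kE by linarith
    have "of_int v * \<beta> - of_int n = of_int v * \<theta>" using v by (simp add: \<theta>_def right_diff_distrib)
    then have "\<bar>of_int v * \<beta> - of_int n\<bar> = of_int v * \<bar>\<theta>\<bar>" using v by (simp add: abs_mult)
    also have "\<dots> \<le> T ^ E * (\<kappa> / of_int \<bar>b\<bar>)"
    proof -
      have "\<kappa> / of_int \<bar>x\<bar> \<le> \<kappa> / of_int \<bar>b\<bar>" using \<kappa>0 bx b1 x0 by (intro divide_left_mono mult_pos_pos) auto
      then show ?thesis using \<theta> vsmall v T unfolding kE by (intro mult_mono) auto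
    qed
    also have "\<dots> = T ^ (E + X) / (of_int \<bar>b\<bar> * real M ^ k)" by (simp add: \<kappa>_def power_add)
    also have "\<dots> \<le> T ^ (100 ^ k) / (of_int \<bar>b\<bar> * real M ^ k)" using big by (intro divide_right_mono pw) auto
    finally show "near_int (T ^ (100 ^ k) / (of_int \<bar>lead_coeff g\<bar> * real M ^ k)) (of_int v * \<beta>)"
      unfolding near_int_def b_def by blast
  qed
qed

section \<open>Integer linear dependence with one common denominator\<close>

text \<open>
Rows are vectors, columns are selected coordinates. The definition reads only the first
\<open>length xs\<close> entries of \<open>js\<close>.
\<close>

definition minor :: "(nat \<Rightarrow> int) list \<Rightarrow> nat list \<Rightarrow> int" where
  "minor xs js = Determinant.det (Matrix.mat (length xs) (length xs) (\<lambda>(a, b). (xs ! a) (js ! b)))"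

lemma abs_det_le:
  fixes A :: "int mat"
  assumes A: "A \<in> carrier_mat n n" and s: "\<And>a b. a < n \<Longrightarrow> b < n \<Longrightarrow> \<bar>A $$ (a, b)\<bar> \<le> s"
  shows "\<bar>Determinant.det A\<bar> \<le> fact n * s ^ n"
proof -
  have "\<bar>Determinant.det A\<bar> \<le> (\<Sum>p | p permutes {0..<n}. \<bar>signof p * (\<Prod>i = 0..<n. A $$ (i, p i))\<bar>)"
    unfolding det_def' [OF A] by (rule sum_abs)
  also have "\<dots> \<le> (\<Sum>p | p permutes {0..<n}. s ^ n)"
  proof (rule sum_mono)
    fix p assume p: "p \<in> {p. p permutes {0..<n}}"
    have "\<bar>signof p * (\<Prod>i = 0..<n. A $$ (i, p i))\<bar> = (\<Prod>i = 0..<n. \<bar>A $$ (i, p i)\<bar>)"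
      by (simp add: abs_mult abs_prod sign_def)
    also have "\<dots> \<le> (\<Prod>i = 0..<n. s)"
      using p s permutes_in_image [of p "{0..<n}"] by (intro prod_mono) auto
    finally show "\<bar>signof p * (\<Prod>i = 0..<n. A $$ (i, p i))\<bar> \<le> s ^ n" by simp
  qed
  also have "\<dots> = fact n * s ^ n" by (simp add: card_permutations [of "{0..<n}" n])
  finally show ?thesis .
qed

lemma abs_minor_le:
  assumes "length js = length xs" "\<And>x j. x \<in> set xs \<Longrightarrow> j \<in> set js \<Longrightarrow> \<bar>x j\<bar> \<le> s"
  shows "\<bar>minor xs js\<bar> \<le> fact (length xs) * s ^ length xs"
  unfolding minor_def using assms by (intro abs_det_le) auto

lemma distinct_if_minor_nonzero:
  assumes "length js = length xs" "minor xs js \<noteq> 0"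
  shows "distinct js"
proof (rule ccontr)
  assume "\<not> distinct js"
  then obtain a b where ab: "a < length xs" "b < length xs" "a \<noteq> b" "js ! a = js ! b"
    using assms(1) by (auto simp: distinct_conv_nth)
  let ?n = "length xs"
  let ?A = "Matrix.mat ?n ?n (\<lambda>(a, b). (xs ! a) (js ! b))"
  have "Matrix.col ?A a = Matrix.col ?A b" using ab by (intro eq_vecI) auto
  then have "Determinant.det ?A = 0" using ab by (intro det_identical_columns [of ?A ?n a b]) auto
  then show False using assms(2) by (simp add: minor_def)
qed

text \<open>
Cramer's rule. The adjugate of the chosen square block solves the linear system on the coordinates \<open>js\<close>
with the determinant as denominator. If this solution is wrong at some coordinate \<open>j\<close> of \<open>J\<close>, the block
bordered by \<open>\<eta>\<close> and \<open>j\<close> is nonsingular, as a kernel vector would exhibit the solution as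
correct there. What matters for the application is that the denominator is the same for all \<open>\<eta>\<close>.
\<close>

lemma minor_extends_or_dependent:
  fixes xs :: "(nat \<Rightarrow> int) list" and \<eta> :: "nat \<Rightarrow> int"
  assumes len: "length js = length xs" and D: "minor xs js \<noteq> 0" and js: "set js \<subseteq> J"
    and s: "\<And>x j. x \<in> insert \<eta> (set xs) \<Longrightarrow> j \<in> J \<Longrightarrow> \<bar>x j\<bar> \<le> s" "0 \<le> s"
  shows "(\<exists>j\<in>J. minor (xs @ [\<eta>]) (js @ [j]) \<noteq> 0) \<or>
    (\<exists>c. (\<forall>a<length xs. \<bar>c a\<bar> \<le> fact (length xs) * s ^ length xs) \<and>
         (\<forall>j\<in>J. \<bar>minor xs js\<bar> * \<eta> j = (\<Sum>a<length xs. c a * (xs ! a) j)))"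
proof -
  define n where "n = length xs"
  define A where "A = Matrix.mat n n (\<lambda>(a, b). (xs ! a) (js ! b))"
  define D where "D = minor xs js"
  have A: "A \<in> carrier_mat n n" by (simp add: A_def)
  have detA: "Determinant.det A = D" by (simp add: A_def D_def minor_def n_def)
  have D0: "D \<noteq> 0" using D by (simp add: D_def)
  have jJ: "js ! b \<in> J" if "b < n" for b using that js len by (auto simp: n_def subset_iff)
  define R where "R = adj_mat A"
  have R: "R \<in> carrier_mat n n" unfolding R_def by (rule adj_mat(1) [OF A])
  have Aent: "A $$ (a, b) = (xs ! a) (js ! b)" if "a < n" "b < n" for a b using that by (simp add: A_def)
  have AR: "(\<Sum>b<n. (xs ! a) (js ! b) * R $$ (b, a')) = (if a = a' then D else 0)" if "a < n" "a' < n" for a a'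
  proof -
    have "(A * R) $$ (a, a') = (\<Sum>b\<in>{0..<n}. A $$ (a, b) * R $$ (b, a'))"
      using that A R by (simp add: scalar_prod_def)
    moreover have "(A * R) $$ (a, a') = (if a = a' then D else 0)"
      using that unfolding R_def adj_mat(2) [OF A] by (simp add: detA)
    ultimately show ?thesis using that by (simp add: Aent lessThan_atLeast0)
  qed
  have RA: "(\<Sum>a<n. R $$ (b, a) * (xs ! a) (js ! b')) = (if b = b' then D else 0)" if "b < n" "b' < n" for b b'
  proof -
    have "(R * A) $$ (b, b') = (\<Sum>a\<in>{0..<n}. R $$ (b, a) * A $$ (a, b'))"
      using that A R by (simp add: scalar_prod_def)
    moreover have "(R * A) $$ (b, b') = (if b = b' then D else 0)"
      using that unfolding R_def adj_mat(3) [OF A] by (simp add: detA)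
    ultimately show ?thesis using that by (simp add: Aent lessThan_atLeast0)
  qed
  define c where "c = (\<lambda>a. \<Sum>b<n. \<eta> (js ! b) * R $$ (b, a))"
  have cA: "(\<Sum>a<n. c a * (xs ! a) (js ! b')) = D * \<eta> (js ! b')" if "b' < n" for b'
  proof -
    have "(\<Sum>a<n. c a * (xs ! a) (js ! b')) = (\<Sum>a<n. \<Sum>b<n. \<eta> (js ! b) * (R $$ (b, a) * (xs ! a) (js ! b')))"
      by (simp add: c_def sum_distrib_right mult.assoc)
    also have "\<dots> = (\<Sum>b<n. \<eta> (js ! b) * (\<Sum>a<n. R $$ (b, a) * (xs ! a) (js ! b')))"
      by (subst sum.swap) (simp add: sum_distrib_left)
    also have "\<dots> = (\<Sum>b<n. if b = b' then \<eta> (js ! b) * D else 0)"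
      using that by (intro sum.cong) (auto simp: RA)
    also have "\<dots> = D * \<eta> (js ! b')" using that by simp
    finally show ?thesis .
  qed
  have cbound: "\<bar>c a\<bar> \<le> fact n * s ^ n" if a: "a < n" for a
  proof -
    obtain n' where n': "n = Suc n'" using a by (cases n) auto
    have "\<bar>\<eta> (js ! b) * R $$ (b, a)\<bar> \<le> s * (fact n' * s ^ n')" if b: "b < n" for b
    proof -
      have "\<bar>R $$ (b, a)\<bar> = \<bar>Determinant.det (mat_delete A a b)\<bar>"
        using a b A by (simp add: R_def adj_mat_def cofactor_def abs_mult power_abs)
      also have "\<dots> \<le> fact n' * s ^ n'"
      proof (rule abs_det_le)
        show "mat_delete A a b \<in> carrier_mat n' n'" using A n' by (simp add: mat_delete_def)
        fix i j assume "i < n'" "j < n'"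
        then show "\<bar>mat_delete A a b $$ (i, j)\<bar> \<le> s"
          using A n' len by (auto simp: mat_delete_def Aent n_def intro!: s(1) jJ [unfolded n_def])
      qed
      finally show ?thesis unfolding abs_mult using s b jJ by (intro mult_mono) auto
    qed
    then have "\<bar>c a\<bar> \<le> (\<Sum>b<n. s * (fact n' * s ^ n'))" 
      unfolding c_def by (intro order_trans [OF sum_abs] sum_mono) auto
    also have "\<dots> = fact n * s ^ n" by (simp add: n' algebra_simps)
    finally show ?thesis .
  qed
  show ?thesis
  proof (cases "\<forall>j\<in>J. D * \<eta> j = (\<Sum>a<n. c a * (xs ! a) j)")
    case True
    have "\<bar>D\<bar> * \<eta> j = (\<Sum>a<n. (sgn D * c a) * (xs ! a) j)" if "j \<in> J" for j
    proof -
      have "\<bar>D\<bar> * \<eta> j = sgn D * (D * \<eta> j)" by (simp add: abs_sgn mult_ac)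
      also have "\<dots> = (\<Sum>a<n. (sgn D * c a) * (xs ! a) j)" using True that by (simp add: sum_distrib_left mult.assoc)
      finally show ?thesis .
    qed
    moreover have "\<bar>sgn D * c a\<bar> \<le> fact n * s ^ n" if "a < n" for a
      using cbound [OF that] D0 by (simp add: abs_mult)
    ultimately show ?thesis unfolding n_def D_def by (intro disjI2 exI [of _ "\<lambda>a. sgn (minor xs js) * c a"]) (auto simp: n_def D_def)
  next
    case False
    then obtain j0 where j0: "j0 \<in> J" "D * \<eta> j0 \<noteq> (\<Sum>a<n. c a * (xs ! a) j0)" by blast
    have "minor (xs @ [\<eta>]) (js @ [j0]) \<noteq> 0"
    proof
      assume zero: "minor (xs @ [\<eta>]) (js @ [j0]) = 0"
      define A' where "A' = Matrix.mat (Suc n) (Suc n) (\<lambda>(a, b). ((xs @ [\<eta>]) ! a) ((js @ [j0]) ! b))"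
      have A': "A' \<in> carrier_mat (Suc n) (Suc n)" by (simp add: A'_def)
      have "Determinant.det (A'\<^sup>T) = 0" using zero det_transpose [OF A'] by (simp add: minor_def A'_def n_def)
      then obtain v where v: "v \<in> carrier_vec (Suc n)" "v \<noteq> 0\<^sub>v (Suc n)" "A'\<^sup>T *\<^sub>v v = 0\<^sub>v (Suc n)"
        using det_0_iff_vec_prod_zero [of "A'\<^sup>T" "Suc n"] A' by auto
      have col: "(\<Sum>a<n. (xs ! a) ((js @ [j0]) ! b) * v $ a) + \<eta> ((js @ [j0]) ! b) * v $ n = 0" if b: "b < Suc n" for b
      proof -
        have "(A'\<^sup>T *\<^sub>v v) $ b = (\<Sum>a\<in>{0..<Suc n}. ((xs @ [\<eta>]) ! a) ((js @ [j0]) ! b) * v $ a)"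
          using b v(1) by (simp add: A'_def scalar_prod_def)
        also have "\<dots> = (\<Sum>a<n. (xs ! a) ((js @ [j0]) ! b) * v $ a) + \<eta> ((js @ [j0]) ! b) * v $ n"
          by (simp add: lessThan_atLeast0 nth_append n_def)
        finally show ?thesis using v(3) b by simp
      qed
      define w where "w = (\<lambda>a. D * v $ a + v $ n * c a)"
      have wcol: "(\<Sum>a<n. w a * (xs ! a) (js ! b)) = 0" if b: "b < n" for b
      proof -
        have "(js @ [j0]) ! b = js ! b" using b len by (simp add: nth_append n_def)
        then have 1: "(\<Sum>a<n. (xs ! a) (js ! b) * v $ a) = - (\<eta> (js ! b) * v $ n)" using col [of b] b by simp
        have "(\<Sum>a<n. w a * (xs ! a) (js ! b)) = 
           D * (\<Sum>a<n. (xs ! a) (js ! b) * v $ a) + v $ n * (\<Sum>a<n. c a * (xs ! a) (js ! b))"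
          by (simp add: w_def algebra_simps sum.distrib sum_distrib_left)
        then show ?thesis using 1 cA [OF b] by simp
      qed
      have w0: "w a' = 0" if a': "a' < n" for a'
      proof -
        have "0 = (\<Sum>b<n. (\<Sum>a<n. w a * (xs ! a) (js ! b)) * R $$ (b, a'))" using wcol by simp
        also have "\<dots> = (\<Sum>b<n. \<Sum>a<n. w a * ((xs ! a) (js ! b) * R $$ (b, a')))"
          by (simp add: sum_distrib_right mult.assoc)
        also have "\<dots> = (\<Sum>a<n. w a * (\<Sum>b<n. (xs ! a) (js ! b) * R $$ (b, a')))"
          by (subst sum.swap) (simp add: sum_distrib_left)
        also have "\<dots> = (\<Sum>a<n. if a = a' then w a * D else 0)"
          using a' by (intro sum.cong) (auto simp: AR)
        also have "\<dots> = w a' * D" using a' by simp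
        finally show ?thesis using D0 by simp
      qed
      have vn: "v $ n \<noteq> 0"
      proof
        assume vn: "v $ n = 0"
        have "v $ a = 0" if "a < Suc n" for a
          using that w0 [of a] vn D0 by (cases "a = n") (auto simp: w_def)
        then have "v = 0\<^sub>v (Suc n)" using v(1) by (intro eq_vecI) auto
        then show False using v(2) by simp
      qed
      have "(js @ [j0]) ! n = j0" using len by (simp add: n_def nth_append)
      then have "D * ((\<Sum>a<n. (xs ! a) j0 * v $ a) + \<eta> j0 * v $ n) = 0" using col [of n] by simp
      moreover have "D * (\<Sum>a<n. (xs ! a) j0 * v $ a) = (\<Sum>a<n. (xs ! a) j0 * (- (v $ n * c a)))"
        unfolding sum_distrib_left
      proof (rule sum.cong [OF refl])
        fix a assume "a \<in> {..<n}"
        then have "D * v $ a = - (v $ n * c a)" using w0 [of a] by (simp add: w_def)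
        then show "D * ((xs ! a) j0 * v $ a) = (xs ! a) j0 * (- (v $ n * c a))" by (metis mult.left_commute)
      qed
      moreover have "(\<Sum>a<n. (xs ! a) j0 * (- (v $ n * c a))) = - (v $ n * (\<Sum>a<n. c a * (xs ! a) j0))"
        by (simp add: sum_distrib_left sum_negf mult_ac)
      ultimately have "v $ n * (D * \<eta> j0 - (\<Sum>a<n. c a * (xs ! a) j0)) = 0" by (simp add: algebra_simps)
      then show False using vn j0(2) by simp
    qed
    then show ?thesis using j0(1) by blast
  qed
qed

section \<open>Refining residue classes that contain roots\<close>

text \<open>
By compactness this says that \<open>h\<close> has a profinite integer root congruent to \<open>r\<close> modulo \<open>Q\<close>; intersectivity
is the case \<open>Q = 1\<close>.
\<close>

definition roots_in_class :: "int poly \<Rightarrow> int \<Rightarrow> int \<Rightarrow> bool" where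
  "roots_in_class h r Q \<longleftrightarrow> (\<forall>m\<ge>1. \<exists>x. Q dvd x - r \<and> m dvd poly h x)"

lemma diff_dvd_poly_diff:
  fixes p :: "'a :: comm_ring_1 poly"
  shows "x - y dvd poly p x - poly p y"
proof (induction p)
  case (pCons a p)
  have "poly (pCons a p) x - poly (pCons a p) y = x * (poly p x - poly p y) + (x - y) * poly p y"
    by (simp add: algebra_simps)
  then show ?case using pCons.IH by (metis dvd_add dvd_mult dvd_triv_left)
qed simp

text \<open>
If each of the \<open>t\<close> subclasses missed the roots to some modulus, the whole class would miss the roots to the
product of these moduli.
\<close>

lemma roots_in_class_refine:
  assumes "roots_in_class h r Q" "1 \<le> t"
  obtains r' where "Q dvd r' - r" "roots_in_class h r' (Q * t)"
proof -
  have "\<exists>s\<in>{0..<t}. roots_in_class h (r + Q * s) (Q * t)"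
  proof (rule ccontr)
    assume "\<not> ?thesis"
    then obtain m :: "int \<Rightarrow> int" where m: "\<And>s. s \<in> {0..<t} \<Longrightarrow> 1 \<le> m s"
      "\<And>s x. s \<in> {0..<t} \<Longrightarrow> Q * t dvd x - (r + Q * s) \<Longrightarrow> \<not> m s dvd poly h x"
      unfolding roots_in_class_def by metis
    have "0 < prod m {0..<t}" using m(1) by (intro prod_pos) force
    then have "1 \<le> prod m {0..<t}" by simp
    then obtain x where x: "Q dvd x - r" "prod m {0..<t} dvd poly h x"
      using assms(1) unfolding roots_in_class_def by blast
    then obtain y where y: "x - r = Q * y" by (auto elim: dvdE)
    define s where "s = y mod t"
    have s: "s \<in> {0..<t}" using assms(2) by (simp add: s_def)
    have "x - (r + Q * s) = Q * (y - s)" using y by (simp add: algebra_simps)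
    moreover have "t dvd y - s" by (simp add: s_def)
    ultimately have "Q * t dvd x - (r + Q * s)" by simp
    then have "\<not> m s dvd poly h x" by (rule m(2) [OF s])
    moreover have "m s dvd prod m {0..<t}" using s by (intro dvd_prodI) auto
    ultimately show False using x(2) dvd_trans by blast
  qed
  then obtain s where "roots_in_class h (r + Q * s) (Q * t)" by blast
  then show ?thesis by (intro that [of "r + Q * s"]) auto
qed

lemma roots_in_class_representative:
  assumes "roots_in_class h r Q" "1 \<le> Q" "1 \<le> W"
  obtains r' where "1 \<le> r'" "r' \<le> Q * W" "Q dvd r' - r" "W dvd poly h r'" "roots_in_class h r' Q"
proof -
  obtain x where x: "Q dvd x - r" "W dvd poly h x" using assms unfolding roots_in_class_def by blast
  define r' where "r' = (x - 1) mod (Q * W) + 1"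
  have QW: "0 < Q * W" using assms by simp
  have "r' - x = (x - 1) mod (Q * W) - (x - 1)" by (simp add: r'_def)
  then have d: "Q * W dvd r' - x" by (metis dvd_minus_mod dvd_minus_iff minus_diff_eq)
  show ?thesis
  proof (rule that)
    show "1 \<le> r'" "r' \<le> Q * W"
      using QW pos_mod_bound [OF QW, of "x - 1"] pos_mod_sign [OF QW, of "x - 1"] by (simp_all add: r'_def)
    have "Q dvd (r' - x) + (x - r)" using d x(1) by (intro dvd_add) (auto dest: dvd_mult_left)
    then show Qr: "Q dvd r' - r" by simp
    have "W dvd r' - x" using d by (rule dvd_mult_right)
    then have "W dvd poly h r' - poly h x" using diff_dvd_poly_diff dvd_trans by blast
    then show "W dvd poly h r'" using x(2) by (metis diff_add_cancel dvd_add)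
    show "roots_in_class h r' Q" unfolding roots_in_class_def
    proof (intro allI impI)
      fix m :: int assume "1 \<le> m"
      then obtain z where "Q dvd z - r" "m dvd poly h z" using assms(1) unfolding roots_in_class_def by blast
      moreover have "z - r' = (z - r) - (r' - r)" by simp
      ultimately show "\<exists>z. Q dvd z - r' \<and> m dvd poly h z" using Qr by (metis dvd_diff)
    qed
  qed
qed

lemma dvd_coeff_pcompose_linear:
  fixes p :: "'a :: comm_ring_1 poly"
  assumes "1 \<le> i"
  shows "t dvd coeff (pcompose p [:s, t:]) i"
  using assms
proof (induction p arbitrary: i)
  case (pCons a p)
  obtain i' where i': "i = Suc i'" using pCons.prems by (cases i) auto
  have "coeff (pcompose (pCons a p) [:s, t:]) i = s * coeff (pcompose p [:s, t:]) i + t * coeff (pcompose p [:s, t:]) i'"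
    by (simp add: pcompose_pCons i')
  then show ?case using pCons.IH [OF pCons.prems] by simp
qed simp

lemma abs_coeff_pcompose_linear_le:
  fixes p :: "int poly"
  assumes "0 \<le> r" "0 \<le> q"
  shows "\<bar>coeff (pcompose p [:r, q:]) i\<bar> \<le> poly (map_poly abs p) (r + q)"
proof (induction p arbitrary: i)
  case (pCons a p)
  let ?B = "poly (map_poly abs p) (r + q)"
  have B: "0 \<le> ?B" using pCons.IH [of 0] by linarith
  have eq: "poly (map_poly abs (pCons a p)) (r + q) = \<bar>a\<bar> + (r + q) * ?B"
    using pCons.hyps by (simp add: map_poly_pCons)
  show ?case
  proof (cases i)
    case 0
    have "\<bar>a + r * coeff (pcompose p [:r, q:]) 0\<bar> \<le> \<bar>a\<bar> + r * ?B"
      using pCons.IH [of 0] assms by (intro order_trans [OF abs_triangle_ineq] add_mono) (auto simp: abs_mult mult_left_mono)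
    moreover have "0 \<le> q * ?B" using B assms by simp
    ultimately have "\<bar>a + r * coeff (pcompose p [:r, q:]) 0\<bar> \<le> \<bar>a\<bar> + (r + q) * ?B" by (simp add: distrib_right)
    then show ?thesis unfolding eq using 0 by (simp add: pcompose_pCons)
  next
    case (Suc i')
    have "\<bar>r * coeff (pcompose p [:r, q:]) i + q * coeff (pcompose p [:r, q:]) i'\<bar> \<le> r * ?B + q * ?B"
      using pCons.IH [of i] pCons.IH [of i'] assms
      by (intro order_trans [OF abs_triangle_ineq] add_mono) (auto simp: abs_mult mult_left_mono)
    then show ?thesis unfolding eq using Suc by (simp add: pcompose_pCons distrib_right)
  qed
qed simp

lemma poly_map_abs_le:
  fixes p :: "int poly"
  assumes "1 \<le> x"
  shows "poly (map_poly abs p) x \<le> (\<Sum>i\<le>degree p. \<bar>coeff p i\<bar>) * x ^ degree p"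
proof -
  have "poly (map_poly abs p) x = (\<Sum>i\<le>degree p. \<bar>coeff p i\<bar> * x ^ i)"
    by (simp add: poly_altdef coeff_map_poly degree_map_poly)
  also have "\<dots> \<le> (\<Sum>i\<le>degree p. \<bar>coeff p i\<bar> * x ^ degree p)"
    using assms by (intro sum_mono mult_left_mono power_increasing) auto
  finally show ?thesis by (simp add: sum_distrib_right)
qed

lemma abs_poly_le:
  fixes p :: "int poly"
  assumes "1 \<le> x"
  shows "\<bar>poly p x\<bar> \<le> (\<Sum>i\<le>degree p. \<bar>coeff p i\<bar>) * x ^ degree p"
proof -
  have "\<bar>poly p x\<bar> \<le> (\<Sum>i\<le>degree p. \<bar>coeff p i * x ^ i\<bar>)" unfolding poly_altdef by (rule sum_abs)
  also have "\<dots> \<le> (\<Sum>i\<le>degree p. \<bar>coeff p i\<bar> * x ^ degree p)"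
    using assms by (intro sum_mono) (auto simp: abs_mult intro!: mult_left_mono power_increasing)
  finally show ?thesis by (simp add: sum_distrib_right)
qed

lemma coeff_degree_pcompose_linear:
  fixes p :: "'a :: idom poly"
  assumes "q \<noteq> 0"
  shows "coeff (pcompose p [:r, q:]) (degree p) = lead_coeff p * q ^ degree p"
  using lead_coeff_comp [of "[:r, q:]" p] assms by (simp add: degree_pcompose)

text \<open>
The choice of \<open>r'\<close> as a root of \<open>h\<close> modulo \<open>a (Q t)\<^sup>k\<close>, with \<open>a\<close> the absolute value of the leading
coefficient of \<open>h\<close>, is what controls the constant term. The greatest common divisor \<open>lam'\<close> of the
nonconstant coefficients of \<open>h(r' + Q t x)\<close> divides the leading one, which is \<open>a (Q t)\<^sup>k\<close> up to sign, hence
also the constant one, \<open>h(r')\<close>. The factor \<open>t\<close> is gained since \<open>r' + Q t x\<close> arises from \<open>r + Q x\<close> by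
an affine substitution with slope \<open>t\<close>.
\<close>

lemma primitive_refinement:
  fixes h :: "int poly"
  assumes deg: "degree h = k" "1 \<le> k" and rt: "roots_in_class h r Q" and Q: "1 \<le> Q" and t: "1 \<le> t"
    and lam: "1 \<le> lam" "\<forall>i\<ge>1. lam dvd coeff (pcompose h [:r, Q:]) i"
  shows "\<exists>r' lam' g. 1 \<le> r' \<and> r' \<le> \<bar>lead_coeff h\<bar> * (Q * t) ^ (k + 1) \<and> roots_in_class h r' (Q * t) \<and>
    1 \<le> lam' \<and> lam * t dvd lam' \<and> pcompose h [:r', Q * t:] = Polynomial.smult lam' g \<and>
    (\<forall>w. (\<forall>i\<ge>1. w dvd coeff g i) \<longrightarrow> w dvd 1)"
proof -
  define a where "a = \<bar>lead_coeff h\<bar>"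
  have "h \<noteq> 0" using deg by auto
  then have a: "1 \<le> a" unfolding a_def by (simp add: int_one_le_iff_zero_less)
  have Qt: "1 \<le> Q * t" using mult_mono [of 1 Q 1 t] Q t by simp
  have W: "1 \<le> a * (Q * t) ^ k" using mult_mono [of 1 a 1 "(Q * t) ^ k"] a one_le_power [OF Qt, of k] by simp
  obtain r1 where r1: "Q dvd r1 - r" "roots_in_class h r1 (Q * t)" using roots_in_class_refine [OF rt t] by blast
  obtain r' where r': "1 \<le> r'" "r' \<le> Q * t * (a * (Q * t) ^ k)" "Q * t dvd r' - r1" "a * (Q * t) ^ k dvd poly h r'"
      "roots_in_class h r' (Q * t)"
    using roots_in_class_representative [OF r1(2) Qt W] by blast
  have "Q dvd (r' - r1) + (r1 - r)" using r' r1 by (intro dvd_add) (auto dest: dvd_mult_left)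
  then obtain s where "(r' - r1) + (r1 - r) = Q * s" by (elim dvdE)
  then have s: "r' = r + Q * s" by simp
  define P where "P = pcompose h [:r', Q * t:]"
  define lam' where "lam' = Gcd (coeff P ` {1..k})"
  have degP: "degree P = k" using Q t deg by (simp add: P_def degree_pcompose)
  have top: "coeff P k = lead_coeff h * (Q * t) ^ k"
    using coeff_degree_pcompose_linear [of "Q * t" h r'] Q t deg by (simp add: P_def)
  have lam'_dvd: "lam' dvd coeff P i" if "1 \<le> i" for i
  proof (cases "i \<le> k")
    case True
    then show ?thesis using that unfolding lam'_def by (intro Gcd_dvd) auto
  next
    case False
    then show ?thesis using degP by (simp add: coeff_eq_0)
  qed
  have "coeff P k \<noteq> 0" using top \<open>h \<noteq> 0\<close> Q t by simp
  then have lam'0: "lam' \<noteq> 0" using lam'_dvd [of k] deg by auto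
  have "0 \<le> lam'" by (simp add: lam'_def)
  with lam'0 have lam'1: "1 \<le> lam'" by simp
  have "lam' dvd a * (Q * t) ^ k"
  proof -
    have "lam' dvd \<bar>coeff P k\<bar>" using lam'_dvd [of k] deg by simp
    also have "\<bar>coeff P k\<bar> = a * (Q * t) ^ k" using Q t by (simp add: top a_def abs_mult power_abs)
    finally show ?thesis .
  qed
  then have "lam' dvd poly h r'" using r'(4) dvd_trans by blast
  moreover have "coeff P 0 = poly h r'" by (simp add: P_def flip: poly_0_coeff_0) (simp add: poly_pcompose)?
  ultimately have "lam' dvd coeff P i" for i using lam'_dvd by (cases "i = 0") auto
  then have "[:lam':] dvd P" by (simp add: const_poly_dvd_iff)
  then obtain g where g: "P = Polynomial.smult lam' g" by (auto elim!: dvdE)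
  have prim: "w dvd 1" if w: "\<And>i. 1 \<le> i \<Longrightarrow> w dvd coeff g i" for w
  proof -
    have "lam' * w dvd Gcd (coeff P ` {1..k})"
    proof (rule Gcd_greatest)
      fix b assume "b \<in> coeff P ` {1..k}"
      then obtain i where i: "1 \<le> i" "b = lam' * coeff g i" using g by auto
      then show "lam' * w dvd b" using w by (simp add: mult_dvd_mono)
    qed
    then have "lam' * w dvd lam' * 1" by (simp add: lam'_def)
    then show ?thesis using lam'0 by (metis dvd_mult_cancel_left mult_1_right)
  qed
  have "lam * t dvd lam'" unfolding lam'_def
  proof (rule Gcd_greatest)
    fix b assume "b \<in> coeff P ` {1..k}"
    then obtain i where i: "1 \<le> i" "b = coeff P i" by auto
    define H where "H = pcompose h [:r, Q:]"
    have PH: "P = pcompose H [:s, t:]"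
      unfolding P_def H_def by (simp add: pcompose_assoc [symmetric] pcompose_pCons s algebra_simps)
    have "[:lam:] dvd H - [:coeff H 0:]"
      unfolding const_poly_dvd_iff using lam(2) by (auto simp: H_def coeff_pCons split: nat.splits)
    then obtain H1 where H1: "H - [:coeff H 0:] = Polynomial.smult lam H1" by (auto elim!: dvdE)
    then have "H = [:coeff H 0:] + Polynomial.smult lam H1" by (simp add: algebra_simps)
    then have "P = [:coeff H 0:] + Polynomial.smult lam (pcompose H1 [:s, t:])" 
      unfolding PH by (metis pcompose_add pcompose_const pcompose_smult)
    then have "b = lam * coeff (pcompose H1 [:s, t:]) i" using i by (cases i) auto
    then show "lam * t dvd b" using dvd_coeff_pcompose_linear [OF i(1), of t H1 s] by (simp add: mult_dvd_mono)
  qed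
  moreover have "r' \<le> \<bar>lead_coeff h\<bar> * (Q * t) ^ (k + 1)" using r'(2) by (simp add: a_def algebra_simps)
  ultimately show ?thesis using r' lam'1 g prim unfolding P_def by blast
qed

section \<open>A nonnegative kernel\<close>

text \<open>
The Fourier coefficient of \<open>cos(\<pi> x)^(2 s)\<close> at the integer frequency \<open>\<xi>\<close>, meant for \<open>\<bar>\<xi>\<bar> \<le> s\<close>.
\<close>

definition cos_weight :: "nat \<Rightarrow> int \<Rightarrow> real" where
  "cos_weight s \<xi> = real ((2 * s) choose nat (\<xi> + int s)) / 4 ^ s"

lemma cos_weight_nonneg [simp]: "0 \<le> cos_weight s \<xi>"
  by (simp add: cos_weight_def)

lemma cos_power_expansion:
  "complex_of_real (cos (pi * x) ^ (2 * s)) =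
     (\<Sum>\<xi>\<in>{- int s..int s}. complex_of_real (cos_weight s \<xi>) * e (of_int \<xi> * x))"
proof -
  have cos: "complex_of_real (cos (pi * x)) = (cis (pi * x) + cis (- (pi * x))) / 2"
    by (simp add: complex_eq_iff)
  have "complex_of_real (cos (pi * x) ^ (2 * s)) = (cis (pi * x) + cis (- (pi * x))) ^ (2 * s) / 4 ^ s"
    by (simp only: of_real_power cos power_divide) (simp add: power_mult)
  also have "(cis (pi * x) + cis (- (pi * x))) ^ (2 * s) =
      (\<Sum>i\<le>2 * s. of_nat ((2 * s) choose i) * cis (pi * x) ^ i * cis (- (pi * x)) ^ (2 * s - i))"
    by (rule binomial_ring)
  also have "\<dots> = (\<Sum>i\<le>2 * s. of_nat ((2 * s) choose i) * e (of_int (int i - int s) * x))"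
  proof (rule sum.cong [OF refl])
    fix i assume "i \<in> {..2 * s}"
    then have i: "i \<le> 2 * s" by simp
    have "cis (pi * x) ^ i * cis (- (pi * x)) ^ (2 * s - i) = cis (real i * (pi * x) + real (2 * s - i) * (- (pi * x)))"
      by (simp only: Complex.DeMoivre cis_mult)
    also have "real i * (pi * x) + real (2 * s - i) * (- (pi * x)) = 2 * pi * (of_int (int i - int s) * x)"
      using i by (simp add: of_nat_diff algebra_simps)
    finally show "of_nat ((2 * s) choose i) * cis (pi * x) ^ i * cis (- (pi * x)) ^ (2 * s - i) =
        of_nat ((2 * s) choose i) * e (of_int (int i - int s) * x)" by (simp add: e_def mult.assoc)
  qed
  also have "\<dots> / 4 ^ s = (\<Sum>i\<le>2 * s. complex_of_real (cos_weight s (int i - int s)) * e (of_int (int i - int s) * x))"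
    by (simp add: cos_weight_def sum_divide_distrib)
  also have "\<dots> = (\<Sum>\<xi>\<in>{- int s..int s}. complex_of_real (cos_weight s \<xi>) * e (of_int \<xi> * x))"
    by (rule sum.reindex_bij_witness [of _ "\<lambda>\<xi>. nat (\<xi> + int s)" "\<lambda>i. int i - int s"]) auto
  finally show ?thesis .
qed

lemma sum_cos_weight: "(\<Sum>\<xi>\<in>{- int s..int s}. cos_weight s \<xi>) = 1"
  using cos_power_expansion [of 0 s] by (simp flip: of_real_sum)

lemma cos_weight_0_ge: "1 / (2 * real s + 1) \<le> cos_weight s 0"
proof -
  have "1 = (\<Sum>\<xi>\<in>{- int s..int s}. cos_weight s \<xi>)" by (simp add: sum_cos_weight)
  also have "\<dots> \<le> (\<Sum>\<xi>\<in>{- int s..int s}. cos_weight s 0)"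
    using binomial_maximum' [of s] by (intro sum_mono) (simp add: cos_weight_def divide_right_mono)
  also have "\<dots> = (2 * real s + 1) * cos_weight s 0" by (simp add: algebra_simps)
  finally show ?thesis by (simp add: field_simps)
qed

lemma e_sum: "finite J \<Longrightarrow> e (\<Sum>j\<in>J. f j) = (\<Prod>j\<in>J. e (f j))"
  by (induction J rule: finite_induct) (auto simp: e_add)

lemma cos_product_expansion:
  assumes "finite J"
  shows "complex_of_real (\<Prod>j\<in>J. cos (pi * x j) ^ (2 * s)) =
    (\<Sum>\<xi>\<in>PiE J (\<lambda>_. {- int s..int s}). 
       complex_of_real (\<Prod>j\<in>J. cos_weight s (\<xi> j)) * e (\<Sum>j\<in>J. of_int (\<xi> j) * x j))"
proof -
  have "complex_of_real (\<Prod>j\<in>J. cos (pi * x j) ^ (2 * s)) =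
      (\<Prod>j\<in>J. \<Sum>\<xi>\<in>{- int s..int s}. complex_of_real (cos_weight s \<xi>) * e (of_int \<xi> * x j))"
    by (simp only: of_real_prod cos_power_expansion)
  also have "\<dots> = (\<Sum>\<xi>\<in>PiE J (\<lambda>_. {- int s..int s}). 
       \<Prod>j\<in>J. complex_of_real (cos_weight s (\<xi> j)) * e (of_int (\<xi> j) * x j))"
    using assms by (intro prod_sum_PiE) auto
  finally show ?thesis by (simp add: prod.distrib e_sum [OF assms])
qed

lemma cos_power_le_exp:
  assumes "\<not> near_int \<epsilon> x" "0 \<le> \<epsilon>"
  shows "cos (pi * x) ^ (2 * s) \<le> exp (- (\<epsilon>\<^sup>2 * real s))"
proof -
  let ?y = "x - of_int (round x)"
  have y: "\<bar>?y\<bar> \<le> 1/2" using of_int_round_abs_le [of x] by (simp add: abs_minus_commute)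
  have "\<epsilon> < \<bar>?y\<bar>" using assms(1) unfolding near_int_def by (meson not_le)
  also have "\<dots> \<le> \<bar>sin (pi * ?y)\<bar>" by (rule abs_sin_pi_ge [OF y])
  also have "\<dots> = \<bar>sin (pi * x)\<bar>"
  proof -
    have "e x = e ?y" using e_add [of ?y "of_int (round x)"] by simp
    then show ?thesis using norm_e_minus_1 [of x] norm_e_minus_1 [of ?y] by simp
  qed
  finally have "\<epsilon>\<^sup>2 \<le> (sin (pi * x))\<^sup>2" using assms(2) by (metis less_imp_le power2_abs power_mono)
  then have "(cos (pi * x))\<^sup>2 \<le> 1 - \<epsilon>\<^sup>2" by (simp add: cos_squared_eq)
  also have "\<dots> \<le> exp (- (\<epsilon>\<^sup>2))" using exp_ge_add_one_self [of "- (\<epsilon>\<^sup>2)"] by simp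
  finally have "((cos (pi * x))\<^sup>2) ^ s \<le> exp (- (\<epsilon>\<^sup>2)) ^ s" by (intro power_mono) auto
  also have "\<dots> = exp (- (\<epsilon>\<^sup>2 * real s))" by (simp add: exp_of_nat_mult [symmetric] mult.commute)
  finally show ?thesis by (simp only: power_mult)
qed

lemma cos_even_power_nonneg: "0 \<le> cos (y::real) ^ (2 * s)"
  by (rule zero_le_even_power) simp

lemma cos_even_power_le_1: "cos (y::real) ^ (2 * s) \<le> 1"
  unfolding power_mult by (rule power_le_one) (simp_all add: abs_square_le_1)

section \<open>The iteration over independent frequencies\<close>

text \<open>
Every quantity that depends on \<open>h\<close>, \<open>d\<close> and \<open>s\<close> alone is at most \<open>T\<close>, so all costs are counted in powers of
\<open>T\<close>. The exponent \<open>A\<close> is the one lost in \<open>major_arc\<close>, and \<open>C\<close> is the loss in the length of the range per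
step. The range after \<open>i\<close> steps is \<open>N / T^(C i)\<close>, and the lower bound on \<open>N\<close> guarantees
that even after \<open>d\<close> steps it exceeds the modulus and the coefficients of the rescaled polynomial by
what \<open>major_arc\<close> requires.
\<close>

locale recurrence_setting =
  fixes h :: "int poly" and k d s N A C :: nat and \<alpha> :: "nat \<Rightarrow> real" and T :: real
  assumes deg: "degree h = k" "1 \<le> k" and d: "1 \<le> d" "d \<le> s" 
    and s: "10 \<le> s" "k \<le> s" "(\<Sum>i\<le>k. \<bar>coeff h i\<bar>) \<le> int s"
    and T_def: "T = real s ^ (2 * d)" and A_def: "A = 100 ^ k" and C_def: "C = A + k + 4"
    and N: "T ^ (C * d + 3 + A + (A + 1) * (d + 1) * (k + 2) + (2 + (A + 1) * (d + 1) * (k + 1)) * k) \<le> real N"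
begin

definition dot :: "(nat \<Rightarrow> int) \<Rightarrow> real" where
  "dot \<eta> = (\<Sum>j\<in>{1..d}. of_int (\<eta> j) * \<alpha> j)"

text \<open>
The modulus never exceeds \<open>T\<close> to the power \<open>W\<close>.
\<close>

definition W :: nat where "W = (A + 1) * (d + 1)"

text \<open>
The situation after \<open>i\<close> steps: \<open>xs\<close> lists the harmless independent frequencies, certified by the minor on the
coordinates \<open>js\<close>, and the progression is \<open>r\<close> modulo \<open>Q\<close>. The tolerance in the last clause is \<open>lam / T\<^sup>4\<close>
divided by the \<open>k\<close>-th power of the current range \<open>N / T^(C i)\<close>; since \<open>h(n) / lam\<close> is at most \<open>T / lam\<close> times
that power, multiplication by it moves the phase of a listed frequency by at most \<open>T^(-3)\<close>.
\<close>

definition state :: "nat \<Rightarrow> (nat \<Rightarrow> int) list \<Rightarrow> nat list \<Rightarrow> int \<Rightarrow> int \<Rightarrow> int \<Rightarrow> bool" where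
  "state i xs js r Q lam \<longleftrightarrow>
     length xs = i \<and> length js = i \<and> minor xs js \<noteq> 0 \<and> set js \<subseteq> {1..d} \<and>
     (\<forall>x\<in>set xs. \<forall>j\<in>{1..d}. \<bar>x j\<bar> \<le> int s) \<and>
     roots_in_class h r Q \<and> 1 \<le> Q \<and> of_int Q \<le> T ^ ((A + 1) * i) \<and>
     1 \<le> lam \<and> (\<forall>l\<ge>1. lam dvd coeff (pcompose h [:r, Q:]) l) \<and>
     (\<forall>x\<in>set xs. near_int (of_int lam * T ^ (C * i * k) / (T ^ 4 * real N ^ k)) (of_int lam * dot x))"

lemma s2_le_T: "real s ^ 2 \<le> T"
  unfolding T_def using s d by (intro power_increasing) auto

lemma s_le_T: "real s \<le> T"
proof -
  have "1 * real s \<le> real s * real s" using s by (intro mult_right_mono) auto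
  then show ?thesis using s2_le_T by (simp add: power2_eq_square)
qed

lemma T10: "10 \<le> T" and k_le_T: "real k \<le> T" and d_le_T: "real d \<le> T"
  using s_le_T s d by linarith+

lemma T_mono: "i \<le> j \<Longrightarrow> T ^ i \<le> T ^ j"
  using T10 by (intro power_increasing) auto

lemma T_ge1: "1 \<le> T ^ i"
  using T10 by (intro one_le_power) auto

lemma fact_power_le_T:
  assumes "i \<le> d"
  shows "fact i * real s ^ i \<le> T"
proof -
  have "(fact i :: real) \<le> of_nat (i ^ i)" by (rule fact_le_power)
  also have "\<dots> \<le> real s ^ i" using assms d by (simp add: power_mono)
  finally have "fact i * real s ^ i \<le> real s ^ i * real s ^ i" by (intro mult_right_mono) auto
  also have "\<dots> = real s ^ (i + i)" by (simp add: power_add)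
  also have "\<dots> \<le> T" unfolding T_def using assms s by (intro power_increasing) auto
  finally show ?thesis .
qed

lemma weight_0_ge: "2 / T \<le> (\<Prod>j\<in>{1..d}. cos_weight s 0)"
proof -
  have "2 * (2 * real s + 1) ^ d \<le> T"
  proof -
    have "2 * (2 * real s + 1) ^ d \<le> 2 ^ d * (2 * real s + 1) ^ d"
      using d self_le_power [of "2::real" d] by (intro mult_right_mono) auto
    also have "\<dots> = (2 * (2 * real s + 1)) ^ d" by (simp only: power_mult_distrib)
    also have "\<dots> \<le> (real s ^ 2) ^ d"
    proof (rule power_mono)
      have "2 * (2 * real s + 1) \<le> 10 * real s" using s by simp
      also have "\<dots> \<le> real s * real s" using s by (intro mult_right_mono) auto
      finally show "2 * (2 * real s + 1) \<le> real s ^ 2" by (simp only: power2_eq_square)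
    qed auto
    finally show ?thesis by (simp add: T_def power_mult)
  qed
  then have "2 / T \<le> 1 / (2 * real s + 1) ^ d" using T10 by (simp add: field_simps)
  also have "\<dots> = (1 / (2 * real s + 1)) ^ d" by (simp add: power_divide)
  also have "\<dots> \<le> cos_weight s 0 ^ d" using cos_weight_0_ge by (intro power_mono) auto
  finally show ?thesis by simp
qed

lemma N_pos: "0 < real N"
  using N T_ge1 by (smt (verit))

lemma state_0: "state 0 [] [] 0 1 1" if "roots_in_class h 0 1"
  using that by (simp add: state_def minor_def)

lemma state_rank_le:
  assumes "state i xs js r Q lam"
  shows "i \<le> d"
proof -
  have "distinct js" using assms distinct_if_minor_nonzero unfolding state_def by metis
  then have "length js = card (set js)" by (simp add: distinct_card)
  also have "\<dots> \<le> card {1..d}" using assms by (intro card_mono) (auto simp: state_def)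
  finally show ?thesis using assms by (simp add: state_def)
qed

lemma near_int_dvd_mult:
  assumes "near_int (of_int l * \<kappa>) (of_int l * x)" "l dvd l'" "1 \<le> l" "1 \<le> l'" 
  shows "near_int (of_int l' * \<kappa>) (of_int l' * x)"
proof -
  obtain z where z: "l' = l * z" using assms(2) by (auto elim: dvdE)
  then have "0 < l * z" using assms(4) by simp
  then have "0 < z" using assms(3) by (simp add: zero_less_mult_iff)
  then show ?thesis using near_int_mult_of_int [OF assms(1), of z] by (simp add: z mult_ac)
qed

text \<open>
One factor \<open>T\<close> pays for the Cramer coefficients and one for their number; both come out of the \<open>T\<^sup>4\<close> kept in
reserve in the tolerance.
\<close>

lemma near_int_dependent:
  assumes st: "state i xs js r Q lam" and c: "\<And>a. a < i \<Longrightarrow> \<bar>c a\<bar> \<le> fact i * int s ^ i"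
    and dep: "\<And>j. j \<in> {1..d} \<Longrightarrow> \<bar>minor xs js\<bar> * \<eta> j = (\<Sum>a<i. c a * (xs ! a) j)"
    and lam': "lam * \<bar>minor xs js\<bar> dvd lam'" "1 \<le> lam'"
  shows "near_int (of_int lam' * (T ^ (C * i * k) / (T ^ 2 * real N ^ k))) (of_int lam' * dot \<eta>)"
proof -
  define D where "D = \<bar>minor xs js\<bar>"
  define \<kappa> where "\<kappa> = of_int lam * T ^ (C * i * k) / (T ^ 4 * real N ^ k)"
  have D: "1 \<le> D" using st by (auto simp: state_def D_def)
  have lam: "1 \<le> lam" using st by (simp add: state_def)
  have \<kappa>0: "0 \<le> \<kappa>" using lam T10 by (simp add: \<kappa>_def)
  have i: "i \<le> d" using st by (rule state_rank_le)
  have "of_int D * dot \<eta> = (\<Sum>j\<in>{1..d}. of_int (\<Sum>a<i. c a * (xs ! a) j) * \<alpha> j)"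
    unfolding dot_def sum_distrib_left
    by (intro sum.cong refl) (simp only: dep [symmetric] D_def of_int_mult mult.assoc)
  also have "\<dots> = (\<Sum>a<i. of_int (c a) * dot (xs ! a))"
    unfolding dot_def of_int_sum sum_distrib_left sum_distrib_right by (subst sum.swap) (simp add: mult.assoc)
  finally have "of_int lam * (of_int D * dot \<eta>) = (\<Sum>a<i. of_int lam * (of_int (c a) * dot (xs ! a)))"
    by (simp only: sum_distrib_left)
  then have eq: "of_int (lam * D) * dot \<eta> = (\<Sum>a<i. of_int (c a) * (of_int lam * dot (xs ! a)))"
    by (simp add: mult.assoc mult.left_commute)
  have "near_int (\<Sum>a<i. \<bar>of_int (c a)\<bar> * \<kappa>) (of_int (lam * D) * dot \<eta>)"
    unfolding eq using st by (intro near_int_sum near_int_mult_of_int) (auto simp: state_def \<kappa>_def)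
  moreover have "(\<Sum>a<i. \<bar>of_int (c a)\<bar> * \<kappa>) \<le> of_int (lam * D) * (T ^ (C * i * k) / (T ^ 2 * real N ^ k))"
  proof -
    have "(\<Sum>a<i. \<bar>of_int (c a)\<bar> * \<kappa>) \<le> (\<Sum>a<i. T * \<kappa>)"
    proof (rule sum_mono)
      fix a assume "a \<in> {..<i}"
      then have "of_int \<bar>c a\<bar> \<le> (of_int (fact i * int s ^ i) :: real)" using c by (simp only: of_int_le_iff lessThan_iff)
      then have "\<bar>of_int (c a)\<bar> \<le> T" using fact_power_le_T [OF i] by simp
      then show "\<bar>of_int (c a)\<bar> * \<kappa> \<le> T * \<kappa>" using \<kappa>0 by (intro mult_right_mono)
    qed
    also have "\<dots> = real i * (T * \<kappa>)" by simp
    also have "\<dots> \<le> T * (T * \<kappa>)" using i d_le_T \<kappa>0 T10 by (intro mult_right_mono) auto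
    also have "\<dots> = of_int lam * (T ^ (C * i * k) / (T ^ 2 * real N ^ k))" 
      using T10 N_pos by (simp add: \<kappa>_def field_simps eval_nat_numeral)
    also have "\<dots> \<le> of_int (lam * D) * (T ^ (C * i * k) / (T ^ 2 * real N ^ k))"
      using lam D T10 mult_left_mono [of 1 D lam] by (intro mult_right_mono) (auto simp flip: of_int_mult)
    finally show ?thesis .
  qed
  ultimately have "near_int (of_int (lam * D) * (T ^ (C * i * k) / (T ^ 2 * real N ^ k))) (of_int (lam * D) * dot \<eta>)"
    by (rule near_int_mono)
  then show ?thesis
  proof (rule near_int_dvd_mult)
    show "1 \<le> lam * D" using lam D mult_mono [of 1 lam 1 D] by simp
  qed (use lam' in \<open>auto simp: D_def\<close>)
qed

lemma state_extend:
  assumes st: "state i xs js r Q lam" and minor: "minor (xs @ [\<eta>]) (js @ [j]) \<noteq> 0" "j \<in> {1..d}"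
    and \<eta>: "\<And>j. j \<in> {1..d} \<Longrightarrow> \<bar>\<eta> j\<bar> \<le> int s"
    and new: "roots_in_class h r' Q'" "1 \<le> Q'" "of_int Q' \<le> T ^ ((A + 1) * Suc i)"
      "1 \<le> lam'" "lam dvd lam'" "\<And>l. 1 \<le> l \<Longrightarrow> lam' dvd coeff (pcompose h [:r', Q':]) l"
    and near: "near_int (of_int lam' * T ^ (C * Suc i * k) / (T ^ 4 * real N ^ k)) (of_int lam' * dot \<eta>)"
  shows "state (Suc i) (xs @ [\<eta>]) (js @ [j]) r' Q' lam'"
proof -
  have "near_int (of_int lam' * T ^ (C * Suc i * k) / (T ^ 4 * real N ^ k)) (of_int lam' * dot x)" if x: "x \<in> set xs" for x
  proof -
    have "near_int (of_int lam * (T ^ (C * i * k) / (T ^ 4 * real N ^ k))) (of_int lam * dot x)"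
      using st x by (simp add: state_def)
    then have "near_int (of_int lam' * (T ^ (C * i * k) / (T ^ 4 * real N ^ k))) (of_int lam' * dot x)"
      by (rule near_int_dvd_mult) (use st new in \<open>auto simp: state_def\<close>)
    moreover have "of_int lam' * (T ^ (C * i * k) / (T ^ 4 * real N ^ k)) \<le> of_int lam' * (T ^ (C * Suc i * k) / (T ^ 4 * real N ^ k))"
      using new T10 by (intro mult_left_mono divide_right_mono T_mono) auto
    ultimately show ?thesis using near_int_mono by simp
  qed
  then show ?thesis using st minor \<eta> new near by (auto simp: state_def)
qed

lemma coeff_sum_le_T: "of_int (\<Sum>i\<le>k. \<bar>coeff h i\<bar>) \<le> T"
  using s(3) s_le_T by linarith

lemma lead_coeff_le_T: "of_int \<bar>lead_coeff h\<bar> \<le> T"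
proof -
  have "\<bar>coeff h k\<bar> \<le> (\<Sum>i\<le>k. \<bar>coeff h i\<bar>)" by (intro member_le_sum) auto
  then have "of_int \<bar>lead_coeff h\<bar> \<le> (of_int (\<Sum>i\<le>k. \<bar>coeff h i\<bar>) :: real)" by (simp only: of_int_le_iff deg)
  then show ?thesis using coeff_sum_le_T by linarith
qed

text \<open>
If no good \<open>n\<close> exists, the state can always be extended. Multiply the modulus by the determinant \<open>D\<close> so that
all dependent frequencies become harmless, and average the kernel over the resulting progression. If
every independent frequency had a small exponential sum, the average would be at least \<open>1/T\<close>,
while by assumption it is at most \<open>1/(8 T)\<close> plus the contribution of the few roots of \<open>h\<close>. So some
independent \<open>\<eta>\<close> has a large sum, and multiplying the modulus by the denominator \<open>v\<close> from \<open>major_arc\<close>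
makes it harmless. The approximation obtained is in terms of the leading coefficient of \<open>g\<close>, which is
that of \<open>h\<close> times \<open>Q'\<^sup>k / lam'\<close>; the powers of \<open>Q'\<close> cancel against those in \<open>M\<^sup>k\<close>, so that no power of
the modulus is lost.
\<close>

lemma state_Suc:
  assumes fail: "\<And>n. 1 \<le> n \<Longrightarrow> n \<le> int N \<Longrightarrow> poly h n \<noteq> 0 \<Longrightarrow>
      (\<Prod>j\<in>{1..d}. cos (pi * (of_int (poly h n) * \<alpha> j)) ^ (2 * s)) \<le> 1 / (8 * T)"
    and st: "state i xs js r Q lam"
  shows "\<exists>xs js r Q lam. state (Suc i) xs js r Q lam"
proof -
  have i: "i \<le> d" using st by (rule state_rank_le)
  have T0: "0 < T" using T10 by simp
  have lenxs: "length xs = i" and lenjs: "length js = i" and js: "set js \<subseteq> {1..d}"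
    and minor0: "minor xs js \<noteq> 0" and xs_le: "\<And>x j. x \<in> set xs \<Longrightarrow> j \<in> {1..d} \<Longrightarrow> \<bar>x j\<bar> \<le> int s"
    and rt: "roots_in_class h r Q" and Q: "1 \<le> Q" "of_int Q \<le> T ^ ((A + 1) * i)" and lam: "1 \<le> lam"
    and lam_dvd: "\<forall>l\<ge>1. lam dvd coeff (pcompose h [:r, Q:]) l"
    using st unfolding state_def by blast+
  define D where "D = \<bar>minor xs js\<bar>"
  have D: "1 \<le> D" "of_int D \<le> T"
  proof -
    show "1 \<le> D" using minor0 by (simp add: D_def int_one_le_iff_zero_less)
    have "D \<le> fact i * int s ^ i" 
      unfolding D_def lenxs [symmetric] using lenxs lenjs js xs_le by (intro abs_minor_le) auto
    then have "of_int D \<le> (of_int (fact i * int s ^ i) :: real)" by (simp only: of_int_le_iff)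
    then show "of_int D \<le> T" using fact_power_le_T [OF i] by simp
  qed
  obtain r' lam' g where ref: "1 \<le> r'" "r' \<le> \<bar>lead_coeff h\<bar> * (Q * D) ^ (k + 1)" "roots_in_class h r' (Q * D)"
    "1 \<le> lam'" "lam * D dvd lam'" "pcompose h [:r', Q * D:] = Polynomial.smult lam' g"
    "\<forall>w. (\<forall>i\<ge>1. w dvd coeff g i) \<longrightarrow> w dvd 1"
    using primitive_refinement [OF deg rt Q(1) D(1) lam lam_dvd] by blast
  define Q' where "Q' = Q * D"
  have Q'1: "1 \<le> Q'" using Q D mult_mono [of 1 Q 1 D] by (simp add: Q'_def)
  have Q'i: "of_int Q' \<le> T ^ ((A + 1) * i + 1)"
  proof -
    have "of_int Q * of_int D \<le> T ^ ((A + 1) * i) * T ^ 1" using Q D T0 by (intro mult_mono) auto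
    then show ?thesis unfolding Q'_def power_add by simp
  qed
  have Q'W: "of_int Q' \<le> T ^ W"
  proof -
    have "(A + 1) * i + 1 \<le> W" using mult_left_mono [OF i, of "A + 1"] by (simp add: W_def)
    then show ?thesis using Q'i T_mono by (meson order_trans)
  qed
  have r'T: "of_int r' \<le> T ^ (1 + W * (k + 1))"
  proof -
    have "of_int r' \<le> of_int \<bar>lead_coeff h\<bar> * (of_int Q' :: real) ^ (k + 1)"
    proof -
      have "of_int r' \<le> (of_int (\<bar>lead_coeff h\<bar> * Q' ^ (k + 1)) :: real)" 
        using ref(2) unfolding Q'_def by (simp only: of_int_le_iff)
      then show ?thesis by (simp only: of_int_mult of_int_power)
    qed
    also have "\<dots> \<le> T * (T ^ W) ^ (k + 1)"
      using lead_coeff_le_T Q'W Q'1 T0 by (intro mult_mono power_mono) auto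
    finally show ?thesis by (simp only: power_add power_mult power_one_right)
  qed
  define L where "L = real N / T ^ (C * i)"
  define G where "G = 3 + A + W * (k + 2) + (2 + W * (k + 1)) * k"
  have L0: "0 < L" using N_pos T0 by (simp add: L_def)
  have LG: "T ^ G \<le> L"
  proof -
    have "T ^ (G + C * i) \<le> T ^ (C * d + 3 + A + (A + 1) * (d + 1) * (k + 2) + (2 + (A + 1) * (d + 1) * (k + 1)) * k)"
      using mult_left_mono [OF i, of C] by (intro T_mono) (simp add: G_def W_def)
    then have "T ^ G * T ^ (C * i) \<le> real N" using N by (simp only: power_add)
    then show ?thesis using T0 by (simp add: L_def field_simps)
  qed
  have LT: "T ^ l \<le> L" if "l \<le> G" for l using T_mono [OF that] LG by linarith
  have LN: "L \<le> real N" 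
  proof -
    have "real N * 1 \<le> real N * T ^ (C * i)" using T_ge1 by (intro mult_left_mono) auto
    then show ?thesis using T0 by (simp add: L_def field_simps)
  qed
  have Lk: "L ^ k = real N ^ k / T ^ (C * i * k)" by (simp add: L_def power_divide power_mult)
  define M where "M = nat \<lfloor>L / (2 * of_int Q')\<rfloor>"
  have big: "4 * of_int Q' * T ^ (A + 1 + (2 + W * (k + 1)) * k) \<le> L"
  proof -
    have "4 * of_int Q' * T ^ (A + 1 + (2 + W * (k + 1)) * k) \<le> T ^ 1 * T ^ W * T ^ (A + 1 + (2 + W * (k + 1)) * k)"
      using Q'W Q'1 T10 by (intro mult_mono) auto
    also have "\<dots> = T ^ (1 + W + (A + 1 + (2 + W * (k + 1)) * k))" by (simp only: power_add)
    also have "\<dots> \<le> L" by (intro LT) (simp add: G_def)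
    finally show ?thesis .
  qed
  have M: "L / (4 * of_int Q') \<le> real M" "real M \<le> L / (2 * of_int Q')"
  proof -
    have "4 * of_int Q' * 1 \<le> 4 * of_int Q' * T ^ (A + 1 + (2 + W * (k + 1)) * k)" 
      using Q'1 by (intro mult_left_mono T_ge1) auto
    then have "4 * of_int Q' \<le> L" using big by simp
    then have "2 \<le> L / (2 * of_int Q')" using Q'1 by (simp add: field_simps)
    moreover have "real M = of_int \<lfloor>L / (2 * of_int Q')\<rfloor>" using L0 Q'1 by (simp add: M_def)
    moreover have "L / (4 * of_int Q') = L / (2 * of_int Q') / 2" by simp
    ultimately show "L / (4 * of_int Q') \<le> real M" "real M \<le> L / (2 * of_int Q')" by linarith+
  qed
  have MT: "T ^ (A + 1 + (2 + W * (k + 1)) * k) \<le> real M"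
  proof -
    have "T ^ (A + 1 + (2 + W * (k + 1)) * k) \<le> L / (4 * of_int Q')" using big Q'1 by (simp add: field_simps)
    then show ?thesis using M(1) by linarith
  qed
  \<comment> \<open>The margin of two in the choice of \<open>M\<close> leaves room for the offset \<open>r'\<close>.\<close>
  define n where "n = (\<lambda>m. r' + Q' * m)"
  have hn: "poly h (n m) = lam' * poly g m" for m
  proof -
    have "poly h (n m) = poly (pcompose h [:r', Q':]) m" by (simp add: n_def poly_pcompose mult.commute)
    then show ?thesis using ref(6) by (simp add: Q'_def)
  qed
  have n_range: "1 \<le> n m" "of_int (n m) \<le> L" if m: "m \<in> {1..<1 + int M}" for m
  proof -
    have "0 \<le> Q' * m" using m Q'1 by simp
    then show "1 \<le> n m" using ref(1) by (simp add: n_def)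
    have "of_int r' * 2 \<le> T ^ (1 + W * (k + 1)) * T ^ 1" using r'T T10 ref(1) by (intro mult_mono) auto
    also have "\<dots> = T ^ (1 + W * (k + 1) + 1)" by (simp only: power_add)
    also have "\<dots> \<le> L" by (intro LT) (simp add: G_def)
    finally have "of_int r' \<le> L / 2" by simp
    moreover have "of_int Q' * of_int m \<le> of_int Q' * real M" using m Q'1 by (intro mult_left_mono) auto
    moreover have "of_int Q' * real M \<le> L / 2" using M(2) Q'1 by (simp add: field_simps)
    ultimately show "of_int (n m) \<le> L" by (simp add: n_def)
  qed
  have n_le_N: "n m \<le> int N" if "m \<in> {1..<1 + int M}" for m
    using n_range(2) [OF that] LN by linarith
  have hn_le: "\<bar>of_int (poly h (n m))\<bar> \<le> T * L ^ k" if m: "m \<in> {1..<1 + int M}" for m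
  proof -
    have "\<bar>poly h (n m)\<bar> \<le> (\<Sum>i\<le>k. \<bar>coeff h i\<bar>) * n m ^ k" using abs_poly_le [OF n_range(1) [OF m], of h] deg by simp
    then have "of_int \<bar>poly h (n m)\<bar> \<le> (of_int ((\<Sum>i\<le>k. \<bar>coeff h i\<bar>) * n m ^ k) :: real)" by (simp only: of_int_le_iff)
    also have "\<dots> = of_int (\<Sum>i\<le>k. \<bar>coeff h i\<bar>) * of_int (n m) ^ k" by simp
    also have "\<dots> \<le> T * L ^ k"
      using coeff_sum_le_T n_range [OF m] T0 by (intro mult_mono power_mono) (auto simp: sum_nonneg)
    finally show ?thesis by simp
  qed
  have deg_g: "degree g = k"
  proof -
    have "degree (Polynomial.smult lam' g) = k" unfolding ref(6) [symmetric] using Q D deg by (simp add: degree_pcompose)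
    then show ?thesis using ref(4) by simp
  qed
  have lead_g: "lam' * lead_coeff g = lead_coeff h * Q' ^ k"
  proof -
    have "coeff (pcompose h [:r', Q':]) k = lead_coeff h * Q' ^ k" 
      using coeff_degree_pcompose_linear [of Q' h r'] Q'1 deg by simp
    then show ?thesis using ref(6) deg_g by (simp add: Q'_def)
  qed
  define S where "S = (\<lambda>\<eta>. \<Sum>m\<in>{1..<1 + int M}. e (of_int lam' * dot \<eta> * of_int (poly g m)))"
  define \<Xi> where "\<Xi> = PiE {1..d} (\<lambda>_. {- int s..int s})"
  show ?thesis
  proof (cases "\<exists>\<eta>\<in>\<Xi>. (\<exists>j\<in>{1..d}. minor (xs @ [\<eta>]) (js @ [j]) \<noteq> 0) \<and> real M / T \<le> norm (S \<eta>)")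
    case True
    then obtain \<eta> j where \<eta>: "\<eta> \<in> \<Xi>" "j \<in> {1..d}" "minor (xs @ [\<eta>]) (js @ [j]) \<noteq> 0" "real M / T \<le> norm (S \<eta>)" by blast
    define B where "B = T * (T ^ (2 + W * (k + 1))) ^ k"
    have B: "of_int \<bar>coeff g l\<bar> \<le> B" for l
    proof -
      have "\<bar>coeff g l\<bar> \<le> \<bar>lam' * coeff g l\<bar>" using ref(4) mult_right_mono [of 1 lam' "\<bar>coeff g l\<bar>"] by (simp add: abs_mult)
      also have "lam' * coeff g l = coeff (pcompose h [:r', Q':]) l" using ref(6) by (simp add: Q'_def)
      also have "\<bar>\<dots>\<bar> \<le> poly (map_poly abs h) (r' + Q')"
        using ref(1) Q'1 by (intro abs_coeff_pcompose_linear_le) auto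
      also have "\<dots> \<le> (\<Sum>i\<le>k. \<bar>coeff h i\<bar>) * (r' + Q') ^ k"
        using poly_map_abs_le [of "r' + Q'" h] ref(1) Q'1 deg by simp
      finally have "of_int \<bar>coeff g l\<bar> \<le> (of_int ((\<Sum>i\<le>k. \<bar>coeff h i\<bar>) * (r' + Q') ^ k) :: real)" by (simp only: of_int_le_iff)
      also have "\<dots> = of_int (\<Sum>i\<le>k. \<bar>coeff h i\<bar>) * (of_int r' + of_int Q') ^ k" by simp
      also have "\<dots> \<le> B" unfolding B_def
      proof (intro mult_mono power_mono)
        have "T ^ W \<le> T ^ (1 + W * (k + 1))" by (intro T_mono) simp
        then have "of_int r' + of_int Q' \<le> 2 * T ^ (1 + W * (k + 1))" using r'T Q'W by linarith
        also have "\<dots> \<le> T * T ^ (1 + W * (k + 1))" using T10 by (intro mult_right_mono) auto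
        finally show "of_int r' + of_int Q' \<le> T ^ (2 + W * (k + 1))" by simp
      qed (use coeff_sum_le_T ref(1) Q'1 T0 in \<open>auto simp: sum_nonneg\<close>)
      finally show ?thesis .
    qed
    have BM: "B * T ^ (100 ^ k) \<le> real M"
    proof -
      have "B * T ^ (100 ^ k) = T ^ (A + 1 + (2 + W * (k + 1)) * k)" 
        unfolding B_def A_def power_add power_mult by simp
      then show ?thesis using MT by simp
    qed
    have prim: "w dvd 1" if "\<And>i. 1 \<le> i \<Longrightarrow> w dvd coeff g i" for w using ref(7) that by blast
    obtain v :: int where v: "1 \<le> v" "of_int v \<le> T ^ A" 
        "near_int (T ^ A / (of_int \<bar>lead_coeff g\<bar> * real M ^ k)) (of_int v * (of_int lam' * dot \<eta>))"
      using major_arc [OF deg_g deg(2) prim B T10 k_le_T _ BM, of "of_int lam' * dot \<eta>"] \<eta>(4) 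
      unfolding S_def A_def by blast
    have lam'_dvd: "\<forall>l\<ge>1. lam' dvd coeff (pcompose h [:r', Q':]) l" using ref(6) by (simp add: Q'_def)
    obtain r2 lam2 g2 where ref2: "roots_in_class h r2 (Q' * v)" "1 \<le> lam2" "lam' * v dvd lam2" 
      "pcompose h [:r2, Q' * v:] = Polynomial.smult lam2 g2"
      using primitive_refinement [OF deg ref(3) [folded Q'_def] Q'1 v(1) ref(4) lam'_dvd] by blast
    have "near_int (of_int (lam' * v) * (T ^ (A + k) / L ^ k)) (of_int (lam' * v) * dot \<eta>)"
    proof -
      have "T ^ A / (of_int \<bar>lead_coeff g\<bar> * real M ^ k) \<le> of_int (lam' * v) * (T ^ (A + k) / L ^ k)"
      proof -
        have "h \<noteq> 0" using deg by auto
        then have h1: "1 \<le> \<bar>lead_coeff h\<bar>" by (simp add: int_one_le_iff_zero_less)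
        have "lam' * \<bar>lead_coeff g\<bar> = \<bar>lead_coeff h\<bar> * Q' ^ k" 
          using arg_cong [OF lead_g, of abs] ref(4) Q'1 by (simp add: abs_mult power_abs)
        moreover have "1 * Q' ^ k \<le> \<bar>lead_coeff h\<bar> * Q' ^ k" using h1 Q'1 by (intro mult_right_mono) auto
        ultimately have "Q' ^ k \<le> lam' * \<bar>lead_coeff g\<bar>" by simp
        then have "of_int (Q' ^ k) \<le> (of_int (lam' * \<bar>lead_coeff g\<bar>) :: real)" by (simp only: of_int_le_iff)
        then have lg: "of_int Q' ^ k \<le> of_int lam' * (of_int \<bar>lead_coeff g\<bar> :: real)" 
          by (simp only: of_int_mult of_int_power)
        have "(L / 4) ^ k \<le> (of_int Q' * real M) ^ k"
          using M(1) L0 Q'1 by (intro power_mono) (auto simp: field_simps)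
        also have "\<dots> = of_int Q' ^ k * real M ^ k" by (rule power_mult_distrib)
        also have "\<dots> \<le> of_int lam' * of_int \<bar>lead_coeff g\<bar> * real M ^ k" using lg by (intro mult_right_mono) auto
        finally have 1: "L ^ k / 4 ^ k \<le> of_int lam' * of_int \<bar>lead_coeff g\<bar> * real M ^ k" by (simp add: power_divide)
        have pos: "0 < of_int \<bar>lead_coeff g\<bar> * real M ^ k"
        proof -
          have "0 < L ^ k / 4 ^ k" using L0 by simp
          then have "0 < of_int lam' * (of_int \<bar>lead_coeff g\<bar> * real M ^ k)" using 1 by (simp add: mult.assoc)
          then show ?thesis using ref(4) by (simp add: zero_less_mult_iff)
        qed
        have "L ^ k \<le> 4 ^ k * (of_int lam' * of_int \<bar>lead_coeff g\<bar> * real M ^ k)" using 1 by (simp add: field_simps)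
        also have "\<dots> \<le> T ^ k * (of_int lam' * of_int \<bar>lead_coeff g\<bar> * real M ^ k)"
          using T10 ref(4) by (intro mult_right_mono power_mono) auto
        finally have "T ^ A * L ^ k \<le> T ^ A * (T ^ k * (of_int lam' * of_int \<bar>lead_coeff g\<bar> * real M ^ k))"
          using T0 by (intro mult_left_mono) auto
        then have "T ^ A / (of_int \<bar>lead_coeff g\<bar> * real M ^ k) \<le> of_int lam' * (T ^ (A + k) / L ^ k)"
          using pos L0 by (simp add: power_add divide_simps mult_ac)
        also have "\<dots> \<le> of_int (lam' * v) * (T ^ (A + k) / L ^ k)"
          using v(1) ref(4) L0 T0 mult_left_mono [of 1 v lam'] by (intro mult_right_mono) (auto simp flip: of_int_mult)
        finally show ?thesis .
      qed
      with v(3) have "near_int (of_int (lam' * v) * (T ^ (A + k) / L ^ k)) (of_int v * (of_int lam' * dot \<eta>))"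
        by (rule near_int_mono)
      then show ?thesis by (simp add: mult_ac)
    qed
    then have near2: "near_int (of_int lam2 * (T ^ (A + k) / L ^ k)) (of_int lam2 * dot \<eta>)"
    proof (rule near_int_dvd_mult)
      show "1 \<le> lam' * v" using ref(4) v(1) mult_mono [of 1 lam' 1 v] by simp
    qed (use ref2 in auto)
    have tol: "of_int lam2 * (T ^ (A + k) / L ^ k) \<le> of_int lam2 * T ^ (C * Suc i * k) / (T ^ 4 * real N ^ k)"
    proof -
      have "A + k + 4 \<le> C * k" using deg(2) by (simp add: C_def)
      then have "T ^ (A + k + C * i * k + 4) \<le> T ^ (C * Suc i * k)" by (intro T_mono) (simp add: algebra_simps)
      then have "T ^ (A + k) * T ^ (C * i * k) * T ^ 4 \<le> T ^ (C * Suc i * k)" by (simp only: power_add)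
      then have "T ^ (A + k) * T ^ (C * i * k) \<le> T ^ (C * Suc i * k) / T ^ 4" using T0 by (simp add: pos_le_divide_eq)
      then have "T ^ (A + k) * T ^ (C * i * k) / real N ^ k \<le> T ^ (C * Suc i * k) / T ^ 4 / real N ^ k"
        by (intro divide_right_mono) auto
      then have "T ^ (A + k) / L ^ k \<le> T ^ (C * Suc i * k) / (T ^ 4 * real N ^ k)" unfolding Lk by simp
      then have "of_int lam2 * (T ^ (A + k) / L ^ k) \<le> of_int lam2 * (T ^ (C * Suc i * k) / (T ^ 4 * real N ^ k))"
        using ref2(2) by (intro mult_left_mono) auto
      then show ?thesis by simp
    qed
    have "state (Suc i) (xs @ [\<eta>]) (js @ [j]) r2 (Q' * v) lam2"
    proof (rule state_extend [OF st \<eta>(3,2) _ ref2(1) _ _ ref2(2)])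
      show "\<bar>\<eta> j\<bar> \<le> int s" if "j \<in> {1..d}" for j
        using PiE_mem [OF \<eta>(1) [unfolded \<Xi>_def] that] by (auto simp: abs_le_iff)
      show "1 \<le> Q' * v" using Q'1 v(1) mult_mono [of 1 Q' 1 v] by simp
      have "of_int Q' * of_int v \<le> T ^ ((A + 1) * i + 1) * T ^ A" using Q'i v T0 Q'1 by (intro mult_mono) auto
      also have "\<dots> = T ^ ((A + 1) * Suc i)" by (simp add: power_add)
      finally show "of_int (Q' * v) \<le> T ^ ((A + 1) * Suc i)" by simp
      show "lam dvd lam2" using ref(5) ref2(3) by (meson dvd_mult_left dvd_trans)
      show "lam2 dvd coeff (pcompose h [:r2, Q' * v:]) l" for l using ref2(4) by simp
      show "near_int (of_int lam2 * T ^ (C * Suc i * k) / (T ^ 4 * real N ^ k)) (of_int lam2 * dot \<eta>)"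
        using near2 tol by (rule near_int_mono)
    qed
    then show ?thesis by blast
  next
    case False
    \<comment> \<open>Independent frequencies have small sums, and for dependent ones every phase is within \<open>1/4\<close> of an integer.\<close>
    have Re_S: "- (real M / T) \<le> Re (S \<eta>)" if \<eta>: "\<eta> \<in> \<Xi>" for \<eta>
    proof (cases "\<exists>j\<in>{1..d}. minor (xs @ [\<eta>]) (js @ [j]) \<noteq> 0")
      case True
      then have "norm (S \<eta>) < real M / T" using False \<eta> by force
      then show ?thesis using abs_Re_le_cmod [of "S \<eta>"] by linarith
    next
      case indep: False
      have "\<bar>\<eta> j\<bar> \<le> int s" if "j \<in> {1..d}" for j
        using PiE_mem [OF \<eta> [unfolded \<Xi>_def] that] by (auto simp: abs_le_iff)
      then have all_le: "\<bar>x j\<bar> \<le> int s" if "x \<in> insert \<eta> (set xs)" "j \<in> {1..d}" for x j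
        using that xs_le by blast
      have len: "length js = length xs" using lenxs lenjs by simp
      have s0: "0 \<le> int s" by simp
      have "(\<exists>j\<in>{1..d}. minor (xs @ [\<eta>]) (js @ [j]) \<noteq> 0) \<or>
         (\<exists>c. (\<forall>a<length xs. \<bar>c a\<bar> \<le> fact (length xs) * int s ^ length xs) \<and>
         (\<forall>j\<in>{1..d}. \<bar>minor xs js\<bar> * \<eta> j = (\<Sum>a<length xs. c a * (xs ! a) j)))"
        using all_le s0 by (intro minor_extends_or_dependent [OF len minor0 js])
      then obtain c where "\<forall>a<i. \<bar>c a\<bar> \<le> fact i * int s ^ i"
          "\<forall>j\<in>{1..d}. \<bar>minor xs js\<bar> * \<eta> j = (\<Sum>a<i. c a * (xs ! a) j)"
        using indep unfolding lenxs by blast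
      then have c: "\<And>a. a < i \<Longrightarrow> \<bar>c a\<bar> \<le> fact i * int s ^ i"
          "\<And>j. j \<in> {1..d} \<Longrightarrow> \<bar>minor xs js\<bar> * \<eta> j = (\<Sum>a<i. c a * (xs ! a) j)"
        by blast+
      have near: "near_int (of_int lam' * (T ^ (C * i * k) / (T ^ 2 * real N ^ k))) (of_int lam' * dot \<eta>)"
        using near_int_dependent [OF st c _ ref(4)] ref(5) by (simp add: D_def)
      have "0 \<le> Re (e (of_int lam' * dot \<eta> * of_int (poly g m)))" if m: "m \<in> {1..<1 + int M}" for m
      proof -
        have "near_int (\<bar>of_int (poly g m)\<bar> * (of_int lam' * (T ^ (C * i * k) / (T ^ 2 * real N ^ k)))) 
            (of_int (poly g m) * (of_int lam' * dot \<eta>))" by (rule near_int_mult_of_int [OF near])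
        moreover have "\<bar>of_int (poly g m)\<bar> * (of_int lam' * (T ^ (C * i * k) / (T ^ 2 * real N ^ k))) \<le> 1/4"
        proof -
          have "\<bar>of_int (poly g m)\<bar> * (of_int lam' * (T ^ (C * i * k) / (T ^ 2 * real N ^ k)))
             = \<bar>of_int (poly h (n m))\<bar> * (T ^ (C * i * k) / (T ^ 2 * real N ^ k))"
            using ref(4) by (simp add: hn abs_mult)
          also have "\<dots> \<le> (T * L ^ k) * (T ^ (C * i * k) / (T ^ 2 * real N ^ k))"
            using hn_le [OF m] T0 by (intro mult_right_mono) auto
          also have "\<dots> = 1 / T" unfolding Lk using T0 N_pos by (simp add: field_simps power2_eq_square)
          also have "\<dots> \<le> 1/4" using T10 by (simp add: field_simps)
          finally show ?thesis .
        qed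
        ultimately obtain u :: int where u: "\<bar>of_int (poly g m) * (of_int lam' * dot \<eta>) - of_int u\<bar> \<le> 1/4"
          using near_int_mono unfolding near_int_def by blast
        define y where "y = of_int (poly g m) * (of_int lam' * dot \<eta>) - of_int u"
        have "of_int lam' * dot \<eta> * of_int (poly g m) = y + of_int u" by (simp add: y_def)
        then have "Re (e (of_int lam' * dot \<eta> * of_int (poly g m))) = cos (2 * pi * y)" by (simp add: e_add) (simp add: e_def)
        moreover have "\<bar>2 * pi * y\<bar> \<le> pi / 2" using u by (simp add: y_def abs_mult)
        then have "0 \<le> cos (2 * pi * y)" by (intro cos_ge_zero) linarith+
        ultimately show ?thesis by simp
      qed
      then have "0 \<le> Re (S \<eta>)" unfolding S_def Re_sum by (rule sum_nonneg)
      moreover have "0 \<le> real M / T" using T0 by simp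
      ultimately show ?thesis by linarith
    qed
    define w where "w = (\<lambda>\<xi>. \<Prod>j\<in>{1..d}. cos_weight s (\<xi> j))"
    define F where "F = (\<lambda>m. \<Prod>j\<in>{1..d}. cos (pi * (of_int (poly h (n m)) * \<alpha> j)) ^ (2 * s))"
    have w0: "0 \<le> w \<xi>" for \<xi> unfolding w_def by (intro prod_nonneg) auto
    have fin\<Xi>: "finite \<Xi>" unfolding \<Xi>_def by (intro finite_PiE) auto
    have sum_w: "(\<Sum>\<xi>\<in>\<Xi>. w \<xi>) = 1"
    proof -
      have "(\<Sum>\<xi>\<in>\<Xi>. w \<xi>) = (\<Prod>j\<in>{1..d}. \<Sum>\<xi>\<in>{- int s..int s}. cos_weight s \<xi>)"
        unfolding w_def \<Xi>_def by (intro prod_sum_PiE [symmetric]) auto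
      then show ?thesis by (simp add: sum_cos_weight)
    qed
    have expand: "complex_of_real (F m) = (\<Sum>\<xi>\<in>\<Xi>. complex_of_real (w \<xi>) * e (of_int lam' * dot \<xi> * of_int (poly g m)))" for m
    proof -
      have "(\<Sum>j\<in>{1..d}. of_int (\<xi> j) * (of_int (poly h (n m)) * \<alpha> j)) = of_int lam' * dot \<xi> * of_int (poly g m)" for \<xi>
        by (simp add: hn dot_def sum_distrib_left sum_distrib_right mult_ac)
      then show ?thesis unfolding F_def w_def \<Xi>_def by (subst cos_product_expansion) simp_all
    qed
    have "complex_of_real (\<Sum>m\<in>{1..<1 + int M}. F m) = (\<Sum>\<xi>\<in>\<Xi>. complex_of_real (w \<xi>) * S \<xi>)"
      unfolding of_real_sum expand S_def sum_distrib_left by (rule sum.swap)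
    then have "Re (complex_of_real (\<Sum>m\<in>{1..<1 + int M}. F m)) = Re (\<Sum>\<xi>\<in>\<Xi>. complex_of_real (w \<xi>) * S \<xi>)" by (rule arg_cong)
    then have total: "(\<Sum>m\<in>{1..<1 + int M}. F m) = (\<Sum>\<xi>\<in>\<Xi>. w \<xi> * Re (S \<xi>))" by simp
    define z where "z = (\<lambda>j\<in>{1..d}. 0::int)"
    have z: "z \<in> \<Xi>" by (auto simp: z_def \<Xi>_def)
    have "dot z = 0" by (simp add: dot_def z_def)
    then have Sz: "Re (S z) = real M" by (simp add: S_def)
    have wz: "2 / T \<le> w z" using weight_0_ge by (simp add: w_def z_def)
    have "w z * real M - real M / T \<le> (\<Sum>\<xi>\<in>\<Xi>. w \<xi> * Re (S \<xi>))"
    proof -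
      have "(\<Sum>\<xi>\<in>\<Xi>. w \<xi> * Re (S \<xi>)) \<ge> (\<Sum>\<xi>\<in>\<Xi>. (if \<xi> = z then w z * real M else 0) - w \<xi> * (real M / T))"
      proof (rule sum_mono)
        fix \<xi> assume \<xi>: "\<xi> \<in> \<Xi>"
        have "0 \<le> w \<xi> * (real M / T)" using w0 T0 by simp
        moreover have "w \<xi> * (- (real M / T)) \<le> w \<xi> * Re (S \<xi>)" using Re_S [OF \<xi>] w0 by (rule mult_left_mono)
        ultimately show "(if \<xi> = z then w z * real M else 0) - w \<xi> * (real M / T) \<le> w \<xi> * Re (S \<xi>)"
          using Sz by (cases "\<xi> = z") auto
      qed
      also have "(\<Sum>\<xi>\<in>\<Xi>. (if \<xi> = z then w z * real M else 0) - w \<xi> * (real M / T)) = w z * real M - real M / T"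
        using fin\<Xi> z sum_w by (simp add: sum_subtractf flip: sum_distrib_right sum_divide_distrib)
      finally show ?thesis .
    qed
    moreover have "2 * (real M / T) \<le> w z * real M" using mult_right_mono [OF wz, of "real M"] by simp
    ultimately have lower: "real M / T \<le> (\<Sum>m\<in>{1..<1 + int M}. F m)" using total by linarith
    define Z where "Z = {m \<in> {1..<1 + int M}. poly g m = 0}"
    have "F m \<le> (if m \<in> Z then 1 else 0) + 1 / (8 * T)" if m: "m \<in> {1..<1 + int M}" for m
    proof (cases "m \<in> Z")
      case True
      have "F m \<le> (\<Prod>j\<in>{1..d}. 1)" unfolding F_def 
        by (intro prod_mono conjI cos_even_power_nonneg cos_even_power_le_1)
      moreover have "0 \<le> 1 / (8 * T)" using T0 by simp
      ultimately have "F m \<le> 1 + 1 / (8 * T)" unfolding prod.neutral_const by linarith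
      then show ?thesis using True by simp
    next
      case False
      then have "poly h (n m) \<noteq> 0" using m ref(4) by (simp add: Z_def hn)
      then have "F m \<le> 1 / (8 * T)" unfolding F_def using n_range(1) [OF m] n_le_N [OF m] by (intro fail)
      then show ?thesis using False by simp
    qed
    then have "(\<Sum>m\<in>{1..<1 + int M}. F m) \<le> (\<Sum>m\<in>{1..<1 + int M}. (if m \<in> Z then 1 else 0) + 1 / (8 * T))"
      by (rule sum_mono)
    also have "\<dots> = real (card Z) + real M * (1 / (8 * T))"
    proof -
      have "{1..<1 + int M} \<inter> {m. m \<in> Z} = Z" by (auto simp: Z_def)
      then show ?thesis by (simp add: sum.distrib sum.If_cases)
    qed
    also have "card Z \<le> k"
    proof -
      have "g \<noteq> 0" using deg_g deg by auto
      then have "card Z \<le> card {m. poly g m = 0}" by (intro card_mono poly_roots_finite) (auto simp: Z_def)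
      also have "\<dots> \<le> k" using card_poly_roots_bound [OF \<open>g \<noteq> 0\<close>] deg_g by simp
      finally show ?thesis .
    qed
    finally have "real M / T \<le> T + real M * (1 / (8 * T))" using lower k_le_T by linarith
    moreover have "2 * T \<le> real M / T"
    proof -
      have "2 * T * T \<le> T ^ 1 * T * T" using T10 by (intro mult_right_mono) auto
      also have "\<dots> = T ^ 3" by (simp add: eval_nat_numeral)
      also have "\<dots> \<le> T ^ (A + 1 + (2 + W * (k + 1)) * k)"
      proof (rule T_mono)
        have "2 \<le> (2 + W * (k + 1)) * k" using deg(2) mult_mono [of 2 "2 + W * (k + 1)" 1 k] by simp
        then show "3 \<le> A + 1 + (2 + W * (k + 1)) * k" by simp
      qed
      finally have "2 * T * T \<le> real M" using MT by linarith
      then show ?thesis using T0 by (simp add: pos_le_divide_eq)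
    qed
    moreover have "real M * (1 / (8 * T)) = (real M / T) / 8" by simp
    moreover have False if "x \<le> t + y" "2 * t \<le> x" "y = x / 8" "10 \<le> t" for x y t :: real
      using that by linarith
    ultimately have False using T10 by blast
    then show ?thesis ..
  qed
qed

text \<open>
Extending the state \<open>d + 1\<close> times would produce \<open>d + 1\<close> distinct column indices among \<open>d\<close>.
\<close>

proposition exists_large_product:
  assumes "roots_in_class h 0 1"
  obtains n where "1 \<le> n" "n \<le> int N" "poly h n \<noteq> 0"
    "1 / (8 * T) < (\<Prod>j\<in>{1..d}. cos (pi * (of_int (poly h n) * \<alpha> j)) ^ (2 * s))"
proof -
  have "\<exists>n. 1 \<le> n \<and> n \<le> int N \<and> poly h n \<noteq> 0 \<and>
    1 / (8 * T) < (\<Prod>j\<in>{1..d}. cos (pi * (of_int (poly h n) * \<alpha> j)) ^ (2 * s))"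
  proof (rule ccontr)
    assume "\<not> ?thesis"
    then have fail: "1 \<le> n \<Longrightarrow> n \<le> int N \<Longrightarrow> poly h n \<noteq> 0 \<Longrightarrow>
      (\<Prod>j\<in>{1..d}. cos (pi * (of_int (poly h n) * \<alpha> j)) ^ (2 * s)) \<le> 1 / (8 * T)" for n
      by (meson not_le)
    have "\<exists>xs js r Q lam. state i xs js r Q lam" for i
    proof (induction i)
      case 0
      then show ?case using state_0 [OF assms] by blast
    next
      case (Suc i)
      then show ?case using state_Suc [OF fail] by blast
    qed
    then obtain xs js r Q lam where "state (Suc d) xs js r Q lam" by blast
    then show False using state_rank_le by fastforce
  qed
  then show ?thesis using that by blast
qed

end

section \<open>The recurrence theorem\<close>

lemma dist_nearest_int_le_if_near_int:
  assumes "near_int \<kappa> x"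
  shows "dist_nearest_int x \<le> \<kappa>"
proof -
  obtain u :: int where u: "\<bar>x - of_int u\<bar> \<le> \<kappa>" using assms unfolding near_int_def by blast
  have "dist_nearest_int x \<le> \<bar>x - of_int u\<bar>"
    unfolding dist_nearest_int_def using infdist_le [of "of_int u" "\<int>" x] by (simp add: dist_real_def)
  with u show ?thesis by linarith
qed

lemma dist_nearest_int_le_half: "dist_nearest_int x \<le> 1/2"
  using of_int_round_abs_le [of x] by (simp add: dist_nearest_int_eq_round abs_minus_commute)

lemma exponent_le:
  fixes k d A C :: nat
  assumes "1 \<le> k" "1 \<le> d" and A: "A = 100 ^ k" and C: "C = A + k + 4"
  shows "C * d + 3 + A + (A + 1) * (d + 1) * (k + 2) + (2 + (A + 1) * (d + 1) * (k + 1)) * k \<le> 10000 ^ k * d"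
proof -
  have k2: "100 * k ^ 2 \<le> A"
  proof -
    have "10 * k \<le> 10 ^ k" using assms(1) by (rule ten_mult_le_power)
    then have "(10 * k) ^ 2 \<le> (10 ^ k) ^ 2" by (rule power_mono) simp
    also have "(10 ^ k) ^ 2 = A" unfolding power2_eq_square by (simp add: A flip: power_mult_distrib)
    finally show ?thesis by (simp add: power_mult_distrib)
  qed
  have kk: "k \<le> k ^ 2" "1 \<le> k ^ 2" using assms(1) by (auto simp: self_le_power)
  have A1: "1 \<le> A" using k2 kk by linarith
  have "(A + 1) * (d + 1) \<le> (2 * A) * (2 * d)" using A1 assms(2) by (intro mult_mono) auto
  then have q: "(A + 1) * (d + 1) \<le> 4 * (A * d)" by simp
  have dA: "d \<le> A * d" "A \<le> A * d" "1 \<le> A * d" using A1 assms(2) by (auto simp: Suc_le_eq)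
  have kd: "k * d \<le> k ^ 2 * (A * d)" "1 \<le> k ^ 2 * (A * d)" "k \<le> k ^ 2 * (A * d)" "A * d \<le> k ^ 2 * (A * d)" "d \<le> k ^ 2 * (A * d)"
    using kk dA mult_mono [OF kk(1) dA(1)] mult_mono [OF kk(2) dA(3)] mult_mono [OF kk(1) dA(3)] mult_right_mono [OF kk(2), of "A * d"]
      mult_mono [OF kk(2) dA(1)] by auto
  have "C * d = A * d + k * d + 4 * d" by (simp add: C algebra_simps)
  also have "\<dots> \<le> 6 * (k ^ 2 * (A * d))" using kd by linarith
  finally have 1: "C * d \<le> 6 * (k ^ 2 * (A * d))" .
  have "k + 2 \<le> 3 * k ^ 2" using kk by linarith
  then have "(A + 1) * (d + 1) * (k + 2) \<le> 4 * (A * d) * (3 * k ^ 2)" by (rule mult_mono [OF q]) simp_all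
  also have "\<dots> = 12 * (k ^ 2 * (A * d))" by simp
  finally have 2: "(A + 1) * (d + 1) * (k + 2) \<le> 12 * (k ^ 2 * (A * d))" .
  have "(2 + (A + 1) * (d + 1) * (k + 1)) * k \<le> (2 * (A * d) + 4 * (A * d) * (2 * k)) * k"
  proof (intro mult_right_mono add_mono)
    show "2 \<le> 2 * (A * d)" using dA by simp
    have "k + 1 \<le> 2 * k" using assms(1) by simp
    then show "(A + 1) * (d + 1) * (k + 1) \<le> 4 * (A * d) * (2 * k)" by (rule mult_mono [OF q]) simp_all
  qed simp
  also have "\<dots> = 2 * (A * d) * k + 8 * (A * d) * k ^ 2" by (simp add: algebra_simps power2_eq_square)
  also have "\<dots> \<le> 2 * (A * d) * k ^ 2 + 8 * (A * d) * k ^ 2" using kk by (intro add_mono mult_left_mono) auto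
  also have "\<dots> = 10 * (k ^ 2 * (A * d))" by simp
  finally have 3: "(2 + (A + 1) * (d + 1) * (k + 1)) * k \<le> 10 * (k ^ 2 * (A * d))" .
  have "C * d + 3 + A + (A + 1) * (d + 1) * (k + 2) + (2 + (A + 1) * (d + 1) * (k + 1)) * k \<le> 100 * (k ^ 2 * (A * d))"
    using 1 2 3 kd dA by linarith
  also have "\<dots> = (100 * k ^ 2) * (A * d)" by simp
  also have "\<dots> \<le> A * (A * d)" using k2 by (rule mult_right_mono) simp
  also have "\<dots> = (A * A) * d" by simp
  also have "A * A = 10000 ^ k" by (simp add: A flip: power_mult_distrib)
  finally show ?thesis .
qed

text \<open>
The choice \<open>s = y\<^sup>5\<close> makes the kernel at most \<open>exp(- y\<^sup>3)\<close> when some coordinate is further than \<open>1/y\<close> from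
the integers, and this beats \<open>8 T = 8 y^(10 d)\<close> because \<open>d \<le> y\<close> and \<open>11 \<le> y\<close>.
\<close>

proposition simultaneous_recurrence:
  fixes h :: "int poly" and \<alpha> :: "nat \<Rightarrow> real" and k d y N :: nat
  assumes h: "h \<noteq> 0" "degree h = k" "1 \<le> k" "intersective h" and d: "1 \<le> d" "d \<le> y"
    and y: "11 \<le> y" "k \<le> y" "(\<Sum>i\<le>k. \<bar>coeff h i\<bar>) \<le> int y"
    and N: "y ^ (10 * 10000 ^ k * d\<^sup>2) \<le> N"
  obtains n where "1 \<le> n" "n \<le> int N" "poly h n \<noteq> 0"
    "\<And>j. j \<in> {1..d} \<Longrightarrow> near_int (1 / real y) (of_int (poly h n) * \<alpha> j)"
proof -
  define s where "s = y ^ 5"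
  define T where "T = real s ^ (2 * d)"
  have ys: "y \<le> s" unfolding s_def using y by (intro self_le_power) auto
  have T_eq: "T = real y ^ (10 * d)" by (simp add: T_def s_def flip: power_mult)
  interpret rs: recurrence_setting h k d s N "100 ^ k" "100 ^ k + k + 4" \<alpha> T
  proof
    have "T ^ ((100 ^ k + k + 4) * d + 3 + 100 ^ k + (100 ^ k + 1) * (d + 1) * (k + 2) + (2 + (100 ^ k + 1) * (d + 1) * (k + 1)) * k)
        \<le> T ^ (10000 ^ k * d)"
    proof (rule power_increasing [OF exponent_le])
      show "1 \<le> T" unfolding T_eq using y by (intro one_le_power) auto
    qed (use h d in auto)
    also have "\<dots> = real (y ^ (10 * 10000 ^ k * d\<^sup>2))" 
      unfolding T_eq of_nat_power power_mult [symmetric] by (simp add: power2_eq_square mult_ac)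
    also have "\<dots> \<le> real N" using N by (simp only: of_nat_le_iff)
    finally show "T ^ ((100 ^ k + k + 4) * d + 3 + 100 ^ k + (100 ^ k + 1) * (d + 1) * (k + 2) + (2 + (100 ^ k + 1) * (d + 1) * (k + 1)) * k) \<le> real N" .
    show "(\<Sum>i\<le>k. \<bar>coeff h i\<bar>) \<le> int s" using y(3) ys by linarith
  qed (use h d y ys in \<open>auto simp: T_def\<close>)
  have "roots_in_class h 0 1" unfolding roots_in_class_def
  proof (intro allI impI)
    fix m :: int assume m: "1 \<le> m"
    then have "1 \<le> nat m" by simp
    then obtain r where "int (nat m) dvd poly h r" using h(4) unfolding intersective_def by blast
    then show "\<exists>x. 1 dvd x - 0 \<and> m dvd poly h x" using m by auto
  qed
  then obtain n where n: "1 \<le> n" "n \<le> int N" "poly h n \<noteq> 0"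
    "1 / (8 * T) < (\<Prod>j\<in>{1..d}. cos (pi * (of_int (poly h n) * \<alpha> j)) ^ (2 * s))"
    by (rule rs.exists_large_product)
  have "near_int (1 / real y) (of_int (poly h n) * \<alpha> j)" if j: "j \<in> {1..d}" for j
  proof (rule ccontr)
    assume far: "\<not> near_int (1 / real y) (of_int (poly h n) * \<alpha> j)"
    let ?f = "\<lambda>j. cos (pi * (of_int (poly h n) * \<alpha> j)) ^ (2 * s)"
    note f01 = cos_even_power_nonneg cos_even_power_le_1
    have "(\<Prod>j\<in>{1..d}. ?f j) = ?f j * (\<Prod>j\<in>{1..d} - {j}. ?f j)" using j by (intro prod.remove) auto
    also have "\<dots> \<le> ?f j * 1" by (intro mult_left_mono prod_le_1 conjI f01)
    also have "\<dots> \<le> exp (- ((1 / real y)\<^sup>2 * real s))" using cos_power_le_exp [OF far] by simp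
    also have "(1 / real y)\<^sup>2 * real s = real y ^ 3" using y by (simp add: s_def power2_eq_square eval_nat_numeral)
    finally have "1 / (8 * T) < exp (- (real y ^ 3))" using n(4) by linarith
    moreover have "exp (- (real y ^ 3)) \<le> 1 / (8 * T)"
    proof -
      have "8 * T \<le> exp (real y) * exp (real y) ^ (10 * d)"
      proof (rule mult_mono)
        have "10 \<le> real y" using y(1) by simp
        then show "8 \<le> exp (real y)" using exp_ge_add_one_self [of "real y"] by linarith
        show "T \<le> exp (real y) ^ (10 * d)" unfolding T_eq
          using exp_ge_add_one_self [of "real y"] by (intro power_mono) linarith+
      qed (auto simp: T_def)
      also have "\<dots> = exp (real (1 + 10 * d) * real y)" unfolding exp_of_nat_mult by simp
      also have "\<dots> \<le> exp (real y ^ 3)"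
      proof -
        have "1 + 10 * d \<le> y * y"
        proof -
          have "1 + 10 * d \<le> 1 + 10 * y" using d by simp
          also have "\<dots> \<le> y * y"
          proof -
            have "11 * y \<le> y * y" using y(1) by (intro mult_right_mono) auto
            then show ?thesis using y(1) by linarith
          qed
          finally show ?thesis .
        qed
        then have "real (1 + 10 * d) * real y \<le> real (y * y) * real y" by (intro mult_right_mono) (simp_all only: of_nat_le_iff of_nat_0_le_iff)
        also have "\<dots> = real y ^ 3" by (simp add: eval_nat_numeral)
        finally show ?thesis by simp
      qed
      finally have "8 * T \<le> exp (real y ^ 3)" .
      moreover have "0 < T" unfolding T_eq using y by simp
      ultimately show ?thesis by (simp add: exp_minus field_simps)
    qed
    ultimately show False by linarith
  qed
  with n that show ?thesis by blast
qed

text \<open>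
The constant \<open>c = 1/200000\<close> comes from \<open>y \<le> \<rho>\<^sup>-\<^sup>2\<close> with \<open>\<rho> = N\<close> to the power \<open>- c\<^sup>k / d\<^sup>2\<close>: the required size of \<open>N\<close>
is then at most \<open>N\<close> to the power \<open>20 (10000 c)\<^sup>k\<close>, and \<open>20 / 20\<^sup>k \<le> 1\<close>.
\<close>

theorem theorem1:
  "\<exists>c::real. c > 0 \<and>
     (\<forall>(k::nat) (h::int poly). h \<noteq> 0 \<longrightarrow> degree h = k \<longrightarrow> intersective h \<longrightarrow>
       (\<exists>C::real. C > 0 \<and>
         (\<forall>(d::nat) (\<alpha>::nat \<Rightarrow> real) (N::nat). d \<ge> 1 \<longrightarrow> N \<ge> 1 \<longrightarrow>
           (\<exists>m::int. 1 \<le> m \<and> m \<le> int N \<and> poly h m \<noteq> 0) \<longrightarrow>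
           (\<exists>n::int. 1 \<le> n \<and> n \<le> int N \<and> poly h n \<noteq> 0 \<and>
             (\<forall>j\<in>{1..d}. dist_nearest_int (of_int (poly h n) * \<alpha> j)
                \<le> C * real d * real N powr (- (c ^ k / (real d)\<^sup>2)))))))"
proof (rule exI [of _ "1 / 200000"], intro conjI allI impI)
  show "(0::real) < 1 / 200000" by simp
  fix k :: nat and h :: "int poly"
  assume h: "h \<noteq> 0" "degree h = k" "intersective h"
  have k: "1 \<le> k"
  proof (rule ccontr)
    assume "\<not> 1 \<le> k"
    then obtain b where b: "h = [:b:]" using h(2) degree_eq_zeroE by (metis less_one not_le)
    then have "b \<noteq> 0" using h(1) by simp
    moreover have "int (nat (\<bar>b\<bar> + 1)) dvd b"
    proof -
      have "1 \<le> nat (\<bar>b\<bar> + 1)" by simp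
      then obtain r where "int (nat (\<bar>b\<bar> + 1)) dvd poly h r" using h(3) unfolding intersective_def by blast
      then show ?thesis by (simp only: b poly_pCons poly_0 mult_zero_right add_0_right)
    qed
    ultimately show False using dvd_imp_le_int [of b "int (nat (\<bar>b\<bar> + 1))"] by simp
  qed
  define H where "H = (\<Sum>i\<le>k. \<bar>coeff h i\<bar>)"
  have H0: "0 \<le> H" unfolding H_def by (intro sum_nonneg) auto
  define C where "C = 11 + real k + of_int H"
  have C10: "11 \<le> C" using H0 by (simp add: C_def)
  show "\<exists>C::real. C > 0 \<and>
         (\<forall>(d::nat) (\<alpha>::nat \<Rightarrow> real) (N::nat). d \<ge> 1 \<longrightarrow> N \<ge> 1 \<longrightarrow>
           (\<exists>m::int. 1 \<le> m \<and> m \<le> int N \<and> poly h m \<noteq> 0) \<longrightarrow>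
           (\<exists>n::int. 1 \<le> n \<and> n \<le> int N \<and> poly h n \<noteq> 0 \<and>
             (\<forall>j\<in>{1..d}. dist_nearest_int (of_int (poly h n) * \<alpha> j)
                \<le> C * real d * real N powr (- ((1 / 200000) ^ k / (real d)\<^sup>2)))))"
  proof (rule exI [of _ C], intro conjI allI impI)
    show "0 < C" using C10 by simp
    fix d :: nat and \<alpha> :: "nat \<Rightarrow> real" and N :: nat
    assume d: "1 \<le> d" and N: "1 \<le> N" and ex: "\<exists>m::int. 1 \<le> m \<and> m \<le> int N \<and> poly h m \<noteq> 0"
    define \<eta> :: real where "\<eta> = (1 / 200000) ^ k / (real d)\<^sup>2"
    define \<rho> where "\<rho> = real N powr (- \<eta>)"
    have \<rho>0: "0 < \<rho>" using N by (simp add: \<rho>_def)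
    show "\<exists>n::int. 1 \<le> n \<and> n \<le> int N \<and> poly h n \<noteq> 0 \<and>
             (\<forall>j\<in>{1..d}. dist_nearest_int (of_int (poly h n) * \<alpha> j)
                \<le> C * real d * real N powr (- ((1 / 200000) ^ k / (real d)\<^sup>2)))"
      unfolding \<eta>_def [symmetric] \<rho>_def [symmetric]
    proof (cases "1 / 2 \<le> C * real d * \<rho>")
      case True
      \<comment> \<open>No real number is further than \<open>1/2\<close> from the integers, so any \<open>n\<close> that is not a root will do.\<close>
      then show "\<exists>n::int. 1 \<le> n \<and> n \<le> int N \<and> poly h n \<noteq> 0 \<and>
             (\<forall>j\<in>{1..d}. dist_nearest_int (of_int (poly h n) * \<alpha> j) \<le> C * real d * \<rho>)"
        using ex order_trans [OF dist_nearest_int_le_half] by blast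
    next
      case False
      then have Cd: "C * real d < 1 / \<rho>" using \<rho>0 by (simp add: field_simps)
      define y where "y = nat \<lceil>1 / \<rho>\<rceil>"
      have "0 < 1 / \<rho>" using \<rho>0 by simp
      then have "real y = of_int \<lceil>1 / \<rho>\<rceil>" by (simp add: y_def)
      then have y1: "1 / \<rho> \<le> real y" and y2: "real y \<le> 1 / \<rho> + 1"
        using ceiling_correct [of "1 / \<rho>"] by linarith+
      have Cy: "C * real d \<le> real y" using Cd y1 by linarith
      have "C * 1 \<le> C * real d" "1 * real d \<le> C * real d" using C10 d by (intro mult_left_mono mult_right_mono; simp)+
      then have y: "C \<le> real y" "real d \<le> real y" "11 \<le> 1 / \<rho>" using Cy Cd C10 by linarith+
      have "real y \<le> (1 / \<rho>) ^ 2"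
      proof -
        have "11 * (1 / \<rho>) \<le> (1 / \<rho>) * (1 / \<rho>)" using y(3) \<rho>0 by (intro mult_right_mono) auto
        then show ?thesis using y2 y(3) unfolding power2_eq_square by linarith
      qed
      also have "1 / \<rho> = real N powr \<eta>" by (simp add: \<rho>_def powr_minus_divide)
      also have "(real N powr \<eta>) ^ 2 = real N powr (2 * \<eta>)"
        unfolding power2_eq_square mult_2 by (rule powr_add [symmetric])
      finally have yN: "real y \<le> real N powr (2 * \<eta>)" .
      have "real (y ^ (10 * 10000 ^ k * d\<^sup>2)) \<le> (real N powr (2 * \<eta>)) ^ (10 * 10000 ^ k * d\<^sup>2)"
        unfolding of_nat_power using yN by (intro power_mono) auto
      also have "\<dots> = real N powr (2 * \<eta> * real (10 * 10000 ^ k * d\<^sup>2))"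
        using N by (subst powr_realpow [symmetric]) (simp_all only: powr_powr, simp)
      also have "2 * \<eta> * real (10 * 10000 ^ k * d\<^sup>2) = 20 * (1 / 20) ^ k"
      proof -
        have "(1 / 200000 :: real) ^ k * 10000 ^ k = (1 / 20) ^ k" by (simp flip: power_mult_distrib)
        then show ?thesis using d by (simp add: \<eta>_def)
      qed
      also have "real N powr (20 * (1 / 20) ^ k) \<le> real N powr 1"
      proof (rule powr_mono)
        have "(1 / 20 :: real) ^ k \<le> (1 / 20) ^ 1" using k by (intro power_decreasing) auto
        then show "20 * (1 / 20 :: real) ^ k \<le> 1" by simp
      qed (use N in simp)
      finally have "real (y ^ (10 * 10000 ^ k * d\<^sup>2)) \<le> real N powr 1" .
      then have yN': "y ^ (10 * 10000 ^ k * d\<^sup>2) \<le> N" using N by (simp only: powr_one of_nat_le_iff of_nat_0_le_iff)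
      have "H \<le> int y" "11 \<le> y" "k \<le> y" "d \<le> y"
        using y H0 unfolding C_def by linarith+
      then obtain n where n: "1 \<le> n" "n \<le> int N" "poly h n \<noteq> 0"
          "\<And>j. j \<in> {1..d} \<Longrightarrow> near_int (1 / real y) (of_int (poly h n) * \<alpha> j)"
        using simultaneous_recurrence [OF h(1,2) k h(3) d _ _ _ _ yN', of \<alpha>] unfolding H_def by blast
      have "1 / real y \<le> C * real d * \<rho>"
      proof -
        have "1 / real y \<le> \<rho>" using y1 \<rho>0 y C10 by (simp add: field_simps)
        also have "1 * \<rho> \<le> C * real d * \<rho>" using \<rho>0 C10 d mult_mono [of 1 C 1 "real d"] by (intro mult_right_mono) auto
        finally show ?thesis by simp
      qed
      then have "dist_nearest_int (of_int (poly h n) * \<alpha> j) \<le> C * real d * \<rho>" if "j \<in> {1..d}" for j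
        using dist_nearest_int_le_if_near_int [OF n(4) [OF that]] by linarith
      with n show "\<exists>n::int. 1 \<le> n \<and> n \<le> int N \<and> poly h n \<noteq> 0 \<and>
             (\<forall>j\<in>{1..d}. dist_nearest_int (of_int (poly h n) * \<alpha> j) \<le> C * real d * \<rho>)" by blast
    qed
  qed
qed

end
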